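(* Let $n$ be a positive integer. If $B$ is a $2$-basic set of the symmetric group $\mathfrak S_n$ containing every $\chi_\lambda\in\operatorname{Irr}(\mathfrak S_n)$ with $\lambda=\lambda^*$, then the restriction $B_{\mathfrak A_n}$ of $B$ to the alternating group $\mathfrak A_n$ is a $2$-basic set of $\mathfrak A_n$.
   Context: $\operatorname{Irr}(G)$ is the set of complex irreducible characters of a finite group $G$; for a partition $\lambda\vdash n$, $\chi_\lambda\in\operatorname{Irr}(\mathfrak S_n)$ is the irreducible character labelled by $\lambda$ in the usual way, and $\lambda^*$ is the conjugate partition. $2$-basic set: for a finite group $G$, a subset $B\subseteq\operatorname{Irr}(G)$ is a $2$-basic set of $G$ if the restrictions $\chi^{2\text{-reg}}$, $\chi\in B$, of the characters in $B$ to the $2$-regular elements (elements of odd order) of $G$ form a $\mathbb Z$-basis of the ring of (virtual) $2$-Brauer characters of $G$, i.e. of the $\mathbb Z$-span of $\{\chi^{2\text{-reg}} \mid \chi\in\operatorname{Irr}(G)\}$ (the family being indexed by $B$). Restriction of a set: for $B\subseteq\operatorname{Irr}(\mathfrak S_n)$, the restriction $B_{\mathfrak A_n}$ of $B$ to $\mathfrak A_n$ is the subset of $\operatorname{Irr}(\mathfrak A_n)$ consisting of all irreducible constituents of the restrictions to $\mathfrak A_n$ of the characters in $B$. *)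

theory Defs
  imports
    "HOL-Algebra.Sym_Groups"
    "HOL-Algebra.Multiplicative_Group"
    "HOL-Library.Function_Algebras"
    "Jordan_Normal_Form.VS_Connect"
begin

section \<open>Linear structure on complex-valued functions\<close>

definition cscale :: "complex \<Rightarrow> ('a \<Rightarrow> complex) \<Rightarrow> 'a \<Rightarrow> complex" where
  "cscale c f = (\<lambda>x. c * f x)"

definition zscale :: "int \<Rightarrow> ('a \<Rightarrow> complex) \<Rightarrow> 'a \<Rightarrow> complex" where
  "zscale k f = (\<lambda>x. of_int k * f x)"

global_interpretation cfun: Vector_Spaces.vector_space cscale
  by unfold_locales (auto simp: cscale_def algebra_simps)

global_interpretation zfun: Modules.module zscale
  by unfold_locales (auto simp: zscale_def algebra_simps)

text \<open>All functions on a group or on a subset of it are extended by 0 to the whole type, so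
  that sums and scalar multiples of such functions are again of this form.\<close>

definition cut :: "'a set \<Rightarrow> ('a \<Rightarrow> complex) \<Rightarrow> 'a \<Rightarrow> complex" where
  "cut A f = (\<lambda>x. if x \<in> A then f x else 0)"


section \<open>Complex irreducible characters of a finite group\<close>

definition GL :: "nat \<Rightarrow> complex mat monoid" where
  "GL d = units_of (ring_mat TYPE(complex) d ())"

definition trace :: "complex mat \<Rightarrow> complex" where
  "trace A = (\<Sum>i<dim_row A. A $$ (i, i))"

definition irreducible_rep ::
    "('a, 'b) monoid_scheme \<Rightarrow> nat \<Rightarrow> ('a \<Rightarrow> complex mat) \<Rightarrow> bool" where
  "irreducible_rep G d \<rho> \<longleftrightarrow>
     d > 0 \<and> \<rho> \<in> hom G (GL d) \<and>
     (\<forall>W. VectorSpace.subspace class_ring W (module_vec TYPE(complex) d) \<and>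
          (\<forall>g\<in>carrier G. \<forall>w\<in>W. \<rho> g *\<^sub>v w \<in> W) \<longrightarrow>
          W = {0\<^sub>v d} \<or> W = carrier_vec d)"

definition Irr :: "('a, 'b) monoid_scheme \<Rightarrow> ('a \<Rightarrow> complex) set" where
  "Irr G = {cut (carrier G) (\<lambda>g. trace (\<rho> g)) | d \<rho>. irreducible_rep G d \<rho>}"

definition char_inner ::
    "('a, 'b) monoid_scheme \<Rightarrow> ('a \<Rightarrow> complex) \<Rightarrow> ('a \<Rightarrow> complex) \<Rightarrow> complex" where
  "char_inner G \<phi> \<psi> =
     (\<Sum>g\<in>carrier G. \<phi> g * cnj (\<psi> g)) / of_nat (card (carrier G))"

definition irr_constituents ::
    "('a, 'b) monoid_scheme \<Rightarrow> ('a \<Rightarrow> complex) \<Rightarrow> ('a \<Rightarrow> complex) set" where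
  "irr_constituents G \<phi> = {\<psi> \<in> Irr G. char_inner G \<phi> \<psi> \<noteq> 0}"

definition restriction_set ::
    "('a, 'b) monoid_scheme \<Rightarrow> ('a \<Rightarrow> complex) set \<Rightarrow> ('a \<Rightarrow> complex) set" where
  "restriction_set H B = (\<Union>\<chi>\<in>B. irr_constituents H (cut (carrier H) \<chi>))"


section \<open>2-basic sets\<close>

definition two_regular :: "('a, 'b) monoid_scheme \<Rightarrow> 'a set" where
  "two_regular G = {g \<in> carrier G. odd (group.ord G g)}"

text \<open>The basis is a family indexed by \<open>B\<close>: injectivity excludes that two members of \<open>B\<close>
  agree on the 2-regular elements, which independence of the image set alone would allow.\<close>

definition two_basic_set :: "('a, 'b) monoid_scheme \<Rightarrow> ('a \<Rightarrow> complex) set \<Rightarrow> bool" where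
  "two_basic_set G B \<longleftrightarrow>
     B \<subseteq> Irr G \<and>
     inj_on (cut (two_regular G)) B \<and>
     zfun.independent (cut (two_regular G) ` B) \<and>
     zfun.span (cut (two_regular G) ` B) = zfun.span (cut (two_regular G) ` Irr G)"


section \<open>Partitions\<close>

definition is_partition :: "nat list \<Rightarrow> nat \<Rightarrow> bool" where
  "is_partition \<mu> n \<longleftrightarrow> sorted_wrt (\<ge>) \<mu> \<and> 0 \<notin> set \<mu> \<and> sum_list \<mu> = n"

definition conj_partition :: "nat list \<Rightarrow> nat list" where
  "conj_partition \<mu> =
     map (\<lambda>j. length (filter (\<lambda>k. j < k) \<mu>)) [0..<(if \<mu> = [] then 0 else hd \<mu>)]"

definition young_diagram :: "nat list \<Rightarrow> (nat \<times> nat) set" where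
  "young_diagram \<mu> = {(i, j). i < length \<mu> \<and> j < \<mu> ! i}"

text \<open>The tableau filled with \<open>1, ..., n\<close> row by row.\<close>

definition tableau :: "nat list \<Rightarrow> nat \<times> nat \<Rightarrow> nat" where
  "tableau \<mu> = (\<lambda>(i, j). sum_list (take i \<mu>) + j + 1)"

definition row_stabilizer :: "nat list \<Rightarrow> (nat \<Rightarrow> nat) set" where
  "row_stabilizer \<mu> = {p. p permutes {1..sum_list \<mu>} \<and>
     (\<forall>i j. (i, j) \<in> young_diagram \<mu> \<longrightarrow>
        (\<exists>j'. (i, j') \<in> young_diagram \<mu> \<and> p (tableau \<mu> (i, j)) = tableau \<mu> (i, j')))}"

definition column_stabilizer :: "nat list \<Rightarrow> (nat \<Rightarrow> nat) set" where
  "column_stabilizer \<mu> = {p. p permutes {1..sum_list \<mu>} \<and>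
     (\<forall>i j. (i, j) \<in> young_diagram \<mu> \<longrightarrow>
        (\<exists>i'. (i', j) \<in> young_diagram \<mu> \<and> p (tableau \<mu> (i, j)) = tableau \<mu> (i', j)))}"


section \<open>The irreducible character labelled by a partition\<close>

text \<open>Elements of the group algebra of the symmetric group of degree \<open>n\<close> are functions
  supported on the permutations of \<open>{1..n}\<close>; their product is convolution.\<close>

definition group_algebra :: "nat \<Rightarrow> ((nat \<Rightarrow> nat) \<Rightarrow> complex) set" where
  "group_algebra n = {f. \<forall>x. \<not> x permutes {1..n} \<longrightarrow> f x = 0}"

definition convolution ::
    "nat \<Rightarrow> ((nat \<Rightarrow> nat) \<Rightarrow> complex) \<Rightarrow> ((nat \<Rightarrow> nat) \<Rightarrow> complex) \<Rightarrow> (nat \<Rightarrow> nat) \<Rightarrow> complex"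
  where
  "convolution n f g =
     cut {x. x permutes {1..n}} (\<lambda>x. \<Sum>y | y permutes {1..n}. f y * g (inv' y \<circ> x))"

definition young_symmetrizer :: "nat list \<Rightarrow> (nat \<Rightarrow> nat) \<Rightarrow> complex" where
  "young_symmetrizer \<mu> = convolution (sum_list \<mu>)
     (cut (row_stabilizer \<mu>) (\<lambda>p. 1))
     (cut (column_stabilizer \<mu>) (\<lambda>q. of_int (sign q)))"

definition specht_module :: "nat list \<Rightarrow> ((nat \<Rightarrow> nat) \<Rightarrow> complex) set" where
  "specht_module \<mu> =
     (\<lambda>f. convolution (sum_list \<mu>) f (young_symmetrizer \<mu>)) ` group_algebra (sum_list \<mu>)"

text \<open>The trace of a linear map \<open>T\<close> on a finite-dimensional subspace \<open>V\<close> with \<open>T ` V \<subseteq> V\<close>.\<close>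

definition lin_trace ::
    "('a \<Rightarrow> complex) set \<Rightarrow> (('a \<Rightarrow> complex) \<Rightarrow> 'a \<Rightarrow> complex) \<Rightarrow> complex" where
  "lin_trace V T =
     (let b = (SOME b. cfun.independent b \<and> cfun.span b = V)
      in \<Sum>v\<in>b. cfun.representation b (T v) v)"

text \<open>In the convention used here the partition with a single part labels the trivial character
  and the partition with all parts 1 labels the sign character.\<close>

definition specht_char :: "nat list \<Rightarrow> (nat \<Rightarrow> nat) \<Rightarrow> complex" where
  "specht_char \<mu> = cut (carrier (sym_group (sum_list \<mu>)))
     (\<lambda>g. lin_trace (specht_module \<mu>) (convolution (sum_list \<mu>) (cut {g} (\<lambda>x. 1))))"

end

theory Submission
  imports
    Defs
    "Jordan_Normal_Form.Char_Poly"
    "HOL-Computational_Algebra.Fundamental_Theorem_Algebra"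
begin

text \<open>Write \<open>N\<close> for the alternating group and twist characters of \<open>N\<close> by an odd permutation. By
  Clifford theory, \<open>\<chi>\<close> restricts to an irreducible character of \<open>N\<close> unless \<open>\<chi> = \<chi> \<cdot> sgn\<close>, in which
  case it restricts to a sum of two twisted forms of one character. The irreducible characters
  with \<open>\<chi> = \<chi> \<cdot> sgn\<close> are those labelled by self-conjugate partitions and so lie in \<open>B\<close>;
  hence the restrictions of the remaining irreducible characters of \<open>N\<close> are integral combinations
  of restrictions of elements of \<open>B\<close>.

  For independence, let \<open>f = \<Sum> u\<^sub>\<psi> \<psi>\<close> vanish on the 2-regular elements. Adding its twist gives
  a relation between elements of \<open>B\<close>, so \<open>f\<close> is antisymmetric under the twist. An element
  of \<open>N\<close> that is not 2-regular has a cycle of even length, which is an odd permutation commuting with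
  it; therefore \<open>f\<close> vanishes there as well, and \<open>f = 0\<close> forces all \<open>u\<^sub>\<psi> = 0\<close>.\<close>

section \<open>Orthogonality of irreducible characters\<close>

text \<open>Two facts about symmetric groups are needed beyond Clifford theory. The label of a
  self-associated character must be shown to be self-conjugate: the trace on a Specht module
  vanishes on products led by the row sum of a diagram not dominated by its own, or by the column
  sum of a diagram not dominating its own. Since multiplication by the sign exchanges row and column
  sums, the diagram and its transpose dominate each other. Moreover, every irreducible character of
  \<open>N\<close> must lie below one of the whole group; this rests on the completeness of the
  Specht characters, obtained by counting: they are pairwise distinct, one for each partition, and
  permutations of equal cycle type are conjugate. The independence argument needs the constituents
  of different members of \<open>B\<close> to be disjoint. A common constituent would make them
  differ by the sign; as elements of odd order are even permutations, the two would then agree on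
  the 2-regular elements, which the indexing of the basis as a family excludes.\<close>

lemma trace_eq: "A \<in> carrier_mat d d' \<Longrightarrow> trace A = (\<Sum>i<d. A $$ (i, i))"
  by (simp add: trace_def)

lemma trace_mult_comm:
  assumes "A \<in> carrier_mat m k" "B \<in> carrier_mat k m"
  shows "trace (A * B) = trace (B * A)"
proof -
  have "trace (A * B) = (\<Sum>i<m. \<Sum>j<k. A $$ (i, j) * B $$ (j, i))"
    using assms by (simp add: trace_def scalar_prod_def atLeast0LessThan)
  also have "\<dots> = (\<Sum>j<k. \<Sum>i<m. B $$ (j, i) * A $$ (i, j))"
    by (subst sum.swap) (simp add: mult.commute)
  also have "\<dots> = trace (B * A)"
    using assms by (simp add: trace_def scalar_prod_def atLeast0LessThan)
  finally show ?thesis .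
qed

lemma index_mult_mat_sum:
  assumes "A \<in> carrier_mat m k" "B \<in> carrier_mat k l" "i < m" "j < l"
  shows "(A * B) $$ (i, j) = (\<Sum>p<k. A $$ (i, p) * B $$ (p, j))"
  using assms by (simp add: scalar_prod_def atLeast0LessThan)

lemma index_mult_mat_vec_sum:
  assumes "A \<in> carrier_mat m k" "v \<in> carrier_vec k" "i < m"
  shows "(A *\<^sub>v v) $ i = (\<Sum>p<k. A $$ (i, p) * v $ p)"
  using assms by (simp add: scalar_prod_def atLeast0LessThan)

text \<open>Invertibility is automatic: \<open>\<rho> (inv g)\<close> is a two-sided inverse of
  \<open>\<rho> g\<close> once the identity goes to the identity matrix. The unit group thus reduces
  to plain matrix equations.\<close>

lemma hom_GL_iff:
  assumes "group G"
  shows "\<rho> \<in> hom G (GL d) \<longleftrightarrow>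
    (\<forall>g\<in>carrier G. \<rho> g \<in> carrier_mat d d) \<and>
    (\<forall>g\<in>carrier G. \<forall>h\<in>carrier G. \<rho> (g \<otimes>\<^bsub>G\<^esub> h) = \<rho> g * \<rho> h) \<and> \<rho> \<one>\<^bsub>G\<^esub> = 1\<^sub>m d"
proof -
  interpret G: group G by fact
  interpret M: monoid "ring_mat TYPE(complex) d ()"
    by (simp add: ring_mat ring.is_monoid)
  interpret H: group "GL d" unfolding GL_def by (rule M.units_group)
  have mult: "x \<otimes>\<^bsub>GL d\<^esub> y = x * y" and one: "\<one>\<^bsub>GL d\<^esub> = 1\<^sub>m d" for x y
    by (simp_all add: GL_def units_of_def ring_mat_def)
  have carr: "carrier (GL d) = Units (ring_mat TYPE(complex) d ())"
    by (simp add: GL_def units_of_def)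
  show ?thesis
  proof
    assume h: "\<rho> \<in> hom G (GL d)"
    then interpret h: group_hom G "GL d" \<rho> by unfold_locales
    have "\<rho> g \<in> carrier_mat d d" if "g \<in> carrier G" for g
      using h.hom_closed[OF that] by (simp add: carr Units_def ring_mat_def)
    then show "(\<forall>g\<in>carrier G. \<rho> g \<in> carrier_mat d d) \<and>
      (\<forall>g\<in>carrier G. \<forall>h\<in>carrier G. \<rho> (g \<otimes>\<^bsub>G\<^esub> h) = \<rho> g * \<rho> h) \<and> \<rho> \<one>\<^bsub>G\<^esub> = 1\<^sub>m d"
      using h.hom_one h.hom_mult by (simp add: mult one)
  next
    assume a: "(\<forall>g\<in>carrier G. \<rho> g \<in> carrier_mat d d) \<and>
      (\<forall>g\<in>carrier G. \<forall>h\<in>carrier G. \<rho> (g \<otimes>\<^bsub>G\<^esub> h) = \<rho> g * \<rho> h) \<and> \<rho> \<one>\<^bsub>G\<^esub> = 1\<^sub>m d"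
    have "\<rho> g \<in> carrier (GL d)" if g: "g \<in> carrier G" for g
    proof -
      have "\<rho> (inv\<^bsub>G\<^esub> g) * \<rho> g = 1\<^sub>m d" "\<rho> g * \<rho> (inv\<^bsub>G\<^esub> g) = 1\<^sub>m d"
        using a g G.l_inv[OF g] G.r_inv[OF g] G.inv_closed[OF g] by metis+
      then show ?thesis
        using a g unfolding carr Units_def by (auto simp: ring_mat_def)
    qed
    then show "\<rho> \<in> hom G (GL d)"
      using a by (auto simp: hom_def mult)
  qed
qed

lemma vec_subspace_iff:
  "VectorSpace.subspace class_ring W (module_vec TYPE(complex) d) \<longleftrightarrow>
    W \<subseteq> carrier_vec d \<and> 0\<^sub>v d \<in> W \<and> (\<forall>v\<in>W. \<forall>w\<in>W. v + w \<in> W) \<and> (\<forall>c. \<forall>v\<in>W. c \<cdot>\<^sub>v v \<in> W)"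
proof -
  interpret vec_space "TYPE(complex)" d .
  have "VectorSpace.subspace class_ring W (module_vec TYPE(complex) d) \<longleftrightarrow> submodule class_ring W (module_vec TYPE(complex) d)"
    unfolding VectorSpace.subspace_def using vectorspace_axioms by blast
  also have "\<dots> \<longleftrightarrow> W \<subseteq> carrier_vec d \<and> 0\<^sub>v d \<in> W \<and> (\<forall>v\<in>W. \<forall>w\<in>W. v + w \<in> W) \<and> (\<forall>c. \<forall>v\<in>W. c \<cdot>\<^sub>v v \<in> W)"
    unfolding submodule_def using module_axioms
    by (simp add: module_vec_def) blast
  finally show ?thesis .
qed

lemma irreducible_repE:
  assumes "group G" "irreducible_rep G d \<rho>"
  shows "d > 0"
    and "\<And>g. g \<in> carrier G \<Longrightarrow> \<rho> g \<in> carrier_mat d d"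
    and "\<And>g h. g \<in> carrier G \<Longrightarrow> h \<in> carrier G \<Longrightarrow> \<rho> (g \<otimes>\<^bsub>G\<^esub> h) = \<rho> g * \<rho> h"
    and "\<rho> \<one>\<^bsub>G\<^esub> = 1\<^sub>m d"
    and "\<And>W. W \<subseteq> carrier_vec d \<Longrightarrow> 0\<^sub>v d \<in> W \<Longrightarrow> (\<And>v w. v \<in> W \<Longrightarrow> w \<in> W \<Longrightarrow> v + w \<in> W) \<Longrightarrow>
          (\<And>c v. v \<in> W \<Longrightarrow> c \<cdot>\<^sub>v v \<in> W) \<Longrightarrow>
          (\<And>g w. g \<in> carrier G \<Longrightarrow> w \<in> W \<Longrightarrow> \<rho> g *\<^sub>v w \<in> W) \<Longrightarrow> W = {0\<^sub>v d} \<or> W = carrier_vec d"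
  using assms(2) unfolding irreducible_rep_def hom_GL_iff[OF assms(1)] vec_subspace_iff by simp_all

section \<open>Schur's lemma for matrix representations\<close>

lemma zero_mat_if_mult_vec_zero:
  assumes "(A :: complex mat) \<in> carrier_mat m k" "\<And>v. v \<in> carrier_vec k \<Longrightarrow> A *\<^sub>v v = 0\<^sub>v m"
  shows "A = 0\<^sub>m m k"
proof (rule eq_matI)
  fix i j assume ij: "i < dim_row (0\<^sub>m m k)" "j < dim_col (0\<^sub>m m k)"
  then have "(A *\<^sub>v unit_vec k j) $ i = A $$ (i, j)"
    using assms(1) by (simp add: scalar_prod_def unit_vec_def if_distrib cong: if_cong)
  then show "A $$ (i, j) = 0\<^sub>m m k $$ (i, j)"
    using assms(2)[of "unit_vec k j"] ij by simp
qed (use assms in auto)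

text \<open>The dimensions \<open>m\<close> and \<open>k\<close> are kept apart because Schur's
  lemma compares representations of a priori different degrees. The columns of \<open>S\<close> are
  preimages of the unit vectors.\<close>

lemma invertible_if_bijective:
  assumes T: "(T :: complex mat) \<in> carrier_mat m k"
    and inj: "\<And>v. v \<in> carrier_vec k \<Longrightarrow> T *\<^sub>v v = 0\<^sub>v m \<Longrightarrow> v = 0\<^sub>v k"
    and surj: "\<And>w. w \<in> carrier_vec m \<Longrightarrow> \<exists>v\<in>carrier_vec k. T *\<^sub>v v = w"
  obtains S where "S \<in> carrier_mat k m" "T * S = 1\<^sub>m m" "S * T = 1\<^sub>m k"
proof -
  have "\<exists>v. v \<in> carrier_vec k \<and> T *\<^sub>v v = unit_vec m j" for j
    using surj[OF unit_vec_carrier[of m j]] by blast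
  then obtain f where f: "\<And>j. f j \<in> carrier_vec k \<and> T *\<^sub>v f j = unit_vec m j"
    by metis
  define S where "S = mat k m (\<lambda>(i, j). f j $ i)"
  have S: "S \<in> carrier_mat k m" by (simp add: S_def)
  have TS: "T * S = 1\<^sub>m m"
  proof (rule eq_matI)
    fix i j assume ij: "i < dim_row (1\<^sub>m m)" "j < dim_col (1\<^sub>m m)"
    have "(T * S) $$ (i, j) = (T *\<^sub>v f j) $ i"
      using ij T f[of j, THEN conjunct1] by (simp add: S_def scalar_prod_def)
    then show "(T * S) $$ (i, j) = 1\<^sub>m m $$ (i, j)"
      using f[of j] ij by (simp add: unit_vec_def)
  qed (use T S in auto)
  \<comment> \<open>\<open>T\<close> annihilates every value of this difference, since
    \<open>T * S\<close> is the identity; injectivity of \<open>T\<close> does the rest.\<close>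
  have "S * T - 1\<^sub>m k = 0\<^sub>m k k"
  proof (rule zero_mat_if_mult_vec_zero)
    fix v :: "complex vec" assume v: "v \<in> carrier_vec k"
    have Tv: "T *\<^sub>v v \<in> carrier_vec m" using T v by simp
    have "T *\<^sub>v ((S * T - 1\<^sub>m k) *\<^sub>v v) = T *\<^sub>v (S *\<^sub>v (T *\<^sub>v v) - v)"
      using T S v by (simp add: minus_mult_distrib_mat_vec[of _ k k] assoc_mult_mat_vec[of _ k m _ k])
    also have "\<dots> = T *\<^sub>v (S *\<^sub>v (T *\<^sub>v v)) - T *\<^sub>v v"
      using T S v by (simp add: mult_minus_distrib_mat_vec[of _ m k])
    also have "T *\<^sub>v (S *\<^sub>v (T *\<^sub>v v)) = (T * S) *\<^sub>v (T *\<^sub>v v)"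
      using T S v Tv by (simp add: assoc_mult_mat_vec[of _ m k _ m])
    finally have "T *\<^sub>v ((S * T - 1\<^sub>m k) *\<^sub>v v) = 0\<^sub>v m" using TS T v Tv by simp
    then show "(S * T - 1\<^sub>m k) *\<^sub>v v = 0\<^sub>v k"
      by (intro inj mult_mat_vec_carrier[OF minus_carrier_mat[OF one_carrier_mat] v])
  qed (use T S in auto)
  have "S * T = 1\<^sub>m k"
  proof (rule eq_matI)
    fix i j assume "i < dim_row (1\<^sub>m k)" "j < dim_col (1\<^sub>m k)"
    then show "(S * T) $$ (i, j) = 1\<^sub>m k $$ (i, j)"
      using arg_cong[OF \<open>S * T - 1\<^sub>m k = 0\<^sub>m k k\<close>, of "\<lambda>M. M $$ (i, j)"] S T by simp
  qed (use T S in auto)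
  then show ?thesis using that S TS by blast
qed

text \<open>Kernel and image of \<open>T\<close> are invariant, so a nonzero \<open>T\<close> is
  bijective and \<open>\<rho> g\<close> is similar to \<open>\<rho>' g\<close>. Only equality of
  traces is recorded, because members of \<open>Irr\<close> are functions and not classes of
  representations.\<close>

lemma schur_intertwiner:
  assumes G: "group G" and irr: "irreducible_rep G d \<rho>" "irreducible_rep G d' \<rho>'"
    and T: "T \<in> carrier_mat d d'"
    and comm: "\<And>g. g \<in> carrier G \<Longrightarrow> \<rho> g * T = T * \<rho>' g"
    and nz: "T \<noteq> 0\<^sub>m d d'"
  shows "\<And>g. g \<in> carrier G \<Longrightarrow> trace (\<rho> g) = trace (\<rho>' g)"
proof -
  note r = irreducible_repE[OF G irr(1)] and r' = irreducible_repE[OF G irr(2)]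
  have ker: "{v \<in> carrier_vec d'. T *\<^sub>v v = 0\<^sub>v d} = {0\<^sub>v d'} \<or>
      {v \<in> carrier_vec d'. T *\<^sub>v v = 0\<^sub>v d} = carrier_vec d'"
  proof (rule r'(5))
    fix g w assume g: "g \<in> carrier G" and w: "w \<in> {v \<in> carrier_vec d'. T *\<^sub>v v = 0\<^sub>v d}"
    have "T *\<^sub>v (\<rho>' g *\<^sub>v w) = (\<rho> g * T) *\<^sub>v w"
      using T r'(2)[OF g] w comm[OF g] by (simp add: assoc_mult_mat_vec[of _ d d' _ d'])
    also have "\<dots> = 0\<^sub>v d"
      using T r(2)[OF g] w by (auto simp: assoc_mult_mat_vec[of _ d d _ d'])
    finally show "\<rho>' g *\<^sub>v w \<in> {v \<in> carrier_vec d'. T *\<^sub>v v = 0\<^sub>v d}"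
      using r'(2)[OF g] w by simp
  qed (use T in \<open>auto simp: mult_add_distrib_mat_vec[of _ d d'] mult_mat_vec[of _ d d']\<close>)
  have im: "(\<lambda>v. T *\<^sub>v v) ` carrier_vec d' = {0\<^sub>v d} \<or> (\<lambda>v. T *\<^sub>v v) ` carrier_vec d' = carrier_vec d"
  proof (rule r(5))
    show "0\<^sub>v d \<in> (\<lambda>v. T *\<^sub>v v) ` carrier_vec d'"
      using T by (intro image_eqI[of _ _ "0\<^sub>v d'"]) auto
  next
    fix v w assume "v \<in> (\<lambda>v. T *\<^sub>v v) ` carrier_vec d'" "w \<in> (\<lambda>v. T *\<^sub>v v) ` carrier_vec d'"
    then obtain x y where "x \<in> carrier_vec d'" "y \<in> carrier_vec d'" "v = T *\<^sub>v x" "w = T *\<^sub>v y" by auto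
    then show "v + w \<in> (\<lambda>v. T *\<^sub>v v) ` carrier_vec d'"
      using T by (intro image_eqI[of _ _ "x + y"]) (auto simp: mult_add_distrib_mat_vec[of _ d d'])
  next
    fix c v assume "v \<in> (\<lambda>v. T *\<^sub>v v) ` carrier_vec d'"
    then obtain x where "x \<in> carrier_vec d'" "v = T *\<^sub>v x" by auto
    then show "c \<cdot>\<^sub>v v \<in> (\<lambda>v. T *\<^sub>v v) ` carrier_vec d'"
      using T by (intro image_eqI[of _ _ "c \<cdot>\<^sub>v x"]) (auto simp: mult_mat_vec[of _ d d'])
  next
    fix g w assume g: "g \<in> carrier G" and "w \<in> (\<lambda>v. T *\<^sub>v v) ` carrier_vec d'"
    then obtain x where x: "x \<in> carrier_vec d'" "w = T *\<^sub>v x" by auto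
    have "\<rho> g *\<^sub>v w = (\<rho> g * T) *\<^sub>v x"
      using T r(2)[OF g] x by (simp add: assoc_mult_mat_vec[of _ d d _ d'])
    also have "\<dots> = T *\<^sub>v (\<rho>' g *\<^sub>v x)"
      using T r'(2)[OF g] x comm[OF g] by (simp add: assoc_mult_mat_vec[of _ d d' _ d'])
    finally show "\<rho> g *\<^sub>v w \<in> (\<lambda>v. T *\<^sub>v v) ` carrier_vec d'"
      using r'(2)[OF g] x by auto
  qed (use T in auto)
  obtain v where v: "v \<in> carrier_vec d'" "T *\<^sub>v v \<noteq> 0\<^sub>v d"
    using zero_mat_if_mult_vec_zero[OF T] nz by blast
  have "{v \<in> carrier_vec d'. T *\<^sub>v v = 0\<^sub>v d} = {0\<^sub>v d'}" using ker v by blast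
  moreover have "(\<lambda>v. T *\<^sub>v v) ` carrier_vec d' = carrier_vec d" using im v by blast
  ultimately have "v = 0\<^sub>v d'" if "v \<in> carrier_vec d'" "T *\<^sub>v v = 0\<^sub>v d" for v
    using that by blast
  moreover have "\<exists>v\<in>carrier_vec d'. T *\<^sub>v v = w" if "w \<in> carrier_vec d" for w
    using that unfolding \<open>(\<lambda>v. T *\<^sub>v v) ` carrier_vec d' = carrier_vec d\<close>[symmetric] by auto
  ultimately obtain S where S: "S \<in> carrier_mat d' d" "T * S = 1\<^sub>m d" "S * T = 1\<^sub>m d'"
    by (rule invertible_if_bijective[OF T])
  fix g assume g: "g \<in> carrier G"
  have "trace (\<rho> g) = trace (\<rho> g * (T * S))" using r(2)[OF g] S by simp
  also have "\<dots> = trace ((T * \<rho>' g) * S)"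
    using assoc_mult_mat[OF r(2)[OF g] T S(1)] comm[OF g] by simp
  also have "\<dots> = trace (S * (T * \<rho>' g))"
    using T r'(2)[OF g] S by (intro trace_mult_comm[of _ d d']) auto
  also have "S * (T * \<rho>' g) = \<rho>' g"
    using assoc_mult_mat[OF S(1) T r'(2)[OF g]] S(3) r'(2)[OF g] by simp
  finally show "trace (\<rho> g) = trace (\<rho>' g)" .
qed

lemma eigenvector_exists:
  assumes "(A :: complex mat) \<in> carrier_mat d d" "d > 0"
  obtains c v where "v \<in> carrier_vec d" "v \<noteq> 0\<^sub>v d" "A *\<^sub>v v = c \<cdot>\<^sub>v v"
proof -
  have "degree (char_poly A) = d" using degree_monic_char_poly[OF assms(1)] by simp
  then obtain c where "poly (char_poly A) c = 0"
    using fundamental_theorem_of_algebra[of "char_poly A"] assms(2)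
    by (auto simp: constant_degree)
  then have "eigenvalue A c" using eigenvalue_root_char_poly[OF assms(1)] by simp
  then show ?thesis using that assms(1) by (auto simp: eigenvalue_def eigenvector_def)
qed

text \<open>An eigenspace of \<open>T\<close> is invariant and nonzero, hence the whole space; an
  eigenvalue exists over the complex numbers.\<close>

lemma schur_scalar:
  assumes G: "group G" and irr: "irreducible_rep G d \<rho>"
    and T: "T \<in> carrier_mat d d"
    and comm: "\<And>g. g \<in> carrier G \<Longrightarrow> \<rho> g * T = T * \<rho> g"
  obtains c where "T = c \<cdot>\<^sub>m 1\<^sub>m d"
proof -
  note r = irreducible_repE[OF G irr]
  obtain c v where v: "v \<in> carrier_vec d" "v \<noteq> 0\<^sub>v d" "T *\<^sub>v v = c \<cdot>\<^sub>v v"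
    using eigenvector_exists[OF T r(1)] by metis
  have "{w \<in> carrier_vec d. T *\<^sub>v w = c \<cdot>\<^sub>v w} = {0\<^sub>v d} \<or>
      {w \<in> carrier_vec d. T *\<^sub>v w = c \<cdot>\<^sub>v w} = carrier_vec d"
  proof (rule r(5))
    fix g w assume g: "g \<in> carrier G" and w: "w \<in> {w \<in> carrier_vec d. T *\<^sub>v w = c \<cdot>\<^sub>v w}"
    have "T *\<^sub>v (\<rho> g *\<^sub>v w) = (\<rho> g * T) *\<^sub>v w"
      using T r(2)[OF g] w comm[OF g] by (simp add: assoc_mult_mat_vec[of _ d d _ d])
    also have "\<dots> = c \<cdot>\<^sub>v (\<rho> g *\<^sub>v w)"
      using T r(2)[OF g] w by (simp add: assoc_mult_mat_vec[of _ d d _ d] mult_mat_vec[of _ d d])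
    finally show "\<rho> g *\<^sub>v w \<in> {w \<in> carrier_vec d. T *\<^sub>v w = c \<cdot>\<^sub>v w}"
      using r(2)[OF g] w by simp
  qed (use T in \<open>auto simp: mult_add_distrib_mat_vec[of _ d d] mult_mat_vec[of _ d d]
        smult_add_distrib_vec[of _ d] smult_smult_assoc mult.commute\<close>)
  then have all: "T *\<^sub>v w = c \<cdot>\<^sub>v w" if "w \<in> carrier_vec d" for w using v that by blast
  have "T = c \<cdot>\<^sub>m 1\<^sub>m d"
  proof (rule eq_matI)
    fix i j assume ij: "i < dim_row (c \<cdot>\<^sub>m 1\<^sub>m d)" "j < dim_col (c \<cdot>\<^sub>m 1\<^sub>m d)"
    then have "(T *\<^sub>v unit_vec d j) $ i = T $$ (i, j)"
      using T by (simp add: scalar_prod_def unit_vec_def if_distrib cong: if_cong)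
    then show "T $$ (i, j) = (c \<cdot>\<^sub>m 1\<^sub>m d) $$ (i, j)"
      using all[of "unit_vec d j"] ij by (simp add: unit_vec_def)
  qed (use T in auto)
  then show ?thesis using that by blast
qed


section \<open>Averaging over the group and the orthogonality relations\<close>

lemma irreducible_rep_index_mult:
  assumes "group G" "irreducible_rep G d \<rho>" "g \<in> carrier G" "h \<in> carrier G" "i < d" "j < d"
  shows "\<rho> (g \<otimes>\<^bsub>G\<^esub> h) $$ (i, j) = (\<Sum>p<d. \<rho> g $$ (i, p) * \<rho> h $$ (p, j))"
  using irreducible_repE(2,3)[OF assms(1,2)] assms(3-) by (simp add: index_mult_mat_sum[of _ d d _ d] del: index_mult_mat)

lemma sum_rotate:
  fixes f :: "'a \<Rightarrow> 'b \<Rightarrow> 'c \<Rightarrow> 'd :: comm_monoid_add"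
  shows "(\<Sum>i\<in>A. \<Sum>j\<in>B. \<Sum>k\<in>C. f i j k) = (\<Sum>j\<in>B. \<Sum>k\<in>C. \<Sum>i\<in>A. f i j k)"
proof -
  have "(\<Sum>i\<in>A. \<Sum>j\<in>B. \<Sum>k\<in>C. f i j k) = (\<Sum>j\<in>B. \<Sum>i\<in>A. \<Sum>k\<in>C. f i j k)"
    by (rule sum.swap)
  also have "\<dots> = (\<Sum>j\<in>B. \<Sum>k\<in>C. \<Sum>i\<in>A. f i j k)"
    by (rule sum.cong[OF refl], rule sum.swap)
  finally show ?thesis .
qed

lemma sum_swap_pairs:
  fixes f :: "'a \<Rightarrow> 'b \<Rightarrow> 'c \<Rightarrow> 'd \<Rightarrow> 'e :: comm_monoid_add"
  shows "(\<Sum>i\<in>A. \<Sum>j\<in>B. \<Sum>k\<in>C. \<Sum>l\<in>D. f i j k l) = (\<Sum>k\<in>C. \<Sum>l\<in>D. \<Sum>i\<in>A. \<Sum>j\<in>B. f i j k l)"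
proof -
  have "(\<Sum>i\<in>A. \<Sum>j\<in>B. \<Sum>k\<in>C. \<Sum>l\<in>D. f i j k l) = (\<Sum>i\<in>A. \<Sum>k\<in>C. \<Sum>j\<in>B. \<Sum>l\<in>D. f i j k l)"
    by (rule sum.cong[OF refl], rule sum.swap)
  also have "\<dots> = (\<Sum>k\<in>C. \<Sum>i\<in>A. \<Sum>j\<in>B. \<Sum>l\<in>D. f i j k l)"
    by (rule sum.swap)
  also have "\<dots> = (\<Sum>k\<in>C. \<Sum>i\<in>A. \<Sum>l\<in>D. \<Sum>j\<in>B. f i j k l)"
    by (rule sum.cong[OF refl], rule sum.cong[OF refl], rule sum.swap)
  also have "\<dots> = (\<Sum>k\<in>C. \<Sum>l\<in>D. \<Sum>i\<in>A. \<Sum>j\<in>B. f i j k l)"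
    by (rule sum.cong[OF refl], rule sum.swap)
  finally show ?thesis .
qed

lemma (in group) sum_reindex_mult:
  assumes "h \<in> carrier G"
  shows "(\<Sum>g\<in>carrier G. f (h \<otimes> g)) = (\<Sum>g\<in>carrier G. f g)"
  by (rule sum.reindex_bij_witness[of _ "\<lambda>g. inv h \<otimes> g" "\<lambda>g. h \<otimes> g"])
    (use assms in \<open>auto simp: m_assoc[symmetric]\<close>)

text \<open>\<open>T j k\<close> is the average of the matrix unit \<open>E j k\<close> over the group, to which Schur's lemma applies.\<close>

lemma sum_trace_mult_trace_inv:
  fixes G (structure)
  assumes G: "group G" and irr: "irreducible_rep G d \<rho>" "irreducible_rep G d' \<rho>'"
  shows "(\<Sum>g\<in>carrier G. trace (\<rho> g) * trace (\<rho>' (inv\<^bsub>G\<^esub> g))) =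
    (if \<forall>g\<in>carrier G. trace (\<rho> g) = trace (\<rho>' g) then of_nat (card (carrier G)) else 0)"
    (is "?S \<rho>' = _")
proof -
  interpret group G by fact
  note r = irreducible_repE[OF G irr(1)]
  define T where "T \<rho>' d' j k = mat d d' (\<lambda>(i, l). \<Sum>g\<in>carrier G. \<rho> g $$ (i, j) * \<rho>' (inv g) $$ (k, l))"
    for \<rho>' :: "'a \<Rightarrow> complex mat" and d' j k
  have comm: "\<rho> h * T \<rho>' d' j k = T \<rho>' d' j k * \<rho>' h"
    if irr': "irreducible_rep G d' \<rho>'" and h: "h \<in> carrier G" and jk: "j < d" "k < d'" for \<rho>' d' j k h
  proof (rule eq_matI)
    note r' = irreducible_repE[OF G irr']
    have T: "T \<rho>' d' j k \<in> carrier_mat d d'" by (simp add: T_def)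
    fix i l assume "i < dim_row (T \<rho>' d' j k * \<rho>' h)" "l < dim_col (T \<rho>' d' j k * \<rho>' h)"
    then have il: "i < d" "l < d'" using T r'(2)[OF h] by auto
    have "(\<rho> h * T \<rho>' d' j k) $$ (i, l) =
        (\<Sum>p<d. \<Sum>g\<in>carrier G. \<rho> h $$ (i, p) * \<rho> g $$ (p, j) * \<rho>' (inv g) $$ (k, l))"
      unfolding index_mult_mat_sum[OF r(2)[OF h] T il]
      by (intro sum.cong) (use il in \<open>auto simp: T_def sum_distrib_left mult.assoc\<close>)
    also have "\<dots> = (\<Sum>g\<in>carrier G. \<rho> (h \<otimes> g) $$ (i, j) * \<rho>' (inv g) $$ (k, l))"
      by (subst sum.swap, intro sum.cong)
        (use h jk il in \<open>auto simp: irreducible_rep_index_mult[OF G irr(1)] sum_distrib_right\<close>)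
    \<comment> \<open>\<open>inv g\<close> is written as
      \<open>inv (h \<otimes> g) \<otimes> h\<close>, so that the summand depends on
      \<open>h \<otimes> g\<close> alone and the sum can be reindexed.\<close>
    also have "\<dots> = (\<Sum>g\<in>carrier G. \<rho> (h \<otimes> g) $$ (i, j) * \<rho>' (inv (h \<otimes> g) \<otimes> h) $$ (k, l))"
      by (intro sum.cong) (use h in \<open>auto simp: inv_mult_group m_assoc\<close>)
    also have "\<dots> = (\<Sum>g\<in>carrier G. \<rho> g $$ (i, j) * \<rho>' (inv g \<otimes> h) $$ (k, l))"
      by (rule sum_reindex_mult[OF h])
    also have "\<dots> = (\<Sum>p<d'. \<Sum>g\<in>carrier G. \<rho> g $$ (i, j) * \<rho>' (inv g) $$ (k, p) * \<rho>' h $$ (p, l))"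
      by (subst sum.swap, intro sum.cong)
        (use h jk il in \<open>auto simp: irreducible_rep_index_mult[OF G irr'] sum_distrib_left mult.assoc\<close>)
    also have "\<dots> = (T \<rho>' d' j k * \<rho>' h) $$ (i, l)"
      unfolding index_mult_mat_sum[OF T r'(2)[OF h] il]
      by (intro sum.cong) (use il in \<open>auto simp: T_def sum_distrib_right mult.assoc\<close>)
    finally show "(\<rho> h * T \<rho>' d' j k) $$ (i, l) = (T \<rho>' d' j k * \<rho>' h) $$ (i, l)" .
  qed (use r(2)[OF h] irreducible_repE(2)[OF G irr' h] in \<open>auto simp: T_def\<close>)
  have S: "(\<Sum>g\<in>carrier G. trace (\<rho> g) * trace (\<rho>' (inv g))) = (\<Sum>j<d. \<Sum>k<d'. T \<rho>' d' j k $$ (j, k))"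
    if irr': "irreducible_rep G d' \<rho>'" for \<rho>' d'
  proof -
    note r' = irreducible_repE[OF G irr']
    have "(\<Sum>g\<in>carrier G. trace (\<rho> g) * trace (\<rho>' (inv g))) =
        (\<Sum>g\<in>carrier G. \<Sum>j<d. \<Sum>k<d'. \<rho> g $$ (j, j) * \<rho>' (inv g) $$ (k, k))"
      by (intro sum.cong) (use r r' in \<open>auto simp: trace_eq[of _ d d] trace_eq[of _ d' d'] sum_product\<close>)
    also have "\<dots> = (\<Sum>j<d. \<Sum>k<d'. \<Sum>g\<in>carrier G. \<rho> g $$ (j, j) * \<rho>' (inv g) $$ (k, k))"
      by (subst sum.swap, intro sum.cong refl, subst sum.swap, rule refl)
    also have "\<dots> = (\<Sum>j<d. \<Sum>k<d'. T \<rho>' d' j k $$ (j, k))"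
      by (intro sum.cong) (auto simp: T_def)
    finally show ?thesis .
  qed
  show ?thesis
  proof (cases "\<forall>g\<in>carrier G. trace (\<rho> g) = trace (\<rho>' g)")
    case False
    have "T \<rho>' d' j k = 0\<^sub>m d d'" if "j < d" "k < d'" for j k
      using schur_intertwiner[OF G irr, of "T \<rho>' d' j k"] comm[OF irr(2) _ that] False
      by (auto simp: T_def)
    then show ?thesis unfolding if_not_P[OF False] using S[OF irr(2)] by simp
  next
    case True
    have diag: "T \<rho> d j k $$ (j, k) = (if j = k then of_nat (card (carrier G)) / of_nat d else 0)"
      if jk: "j < d" "k < d" for j k
    proof -
      have Tc: "T \<rho> d j k \<in> carrier_mat d d" by (simp add: T_def)
      obtain c where c: "T \<rho> d j k = c \<cdot>\<^sub>m 1\<^sub>m d"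
        using schur_scalar[OF G irr(1) Tc] comm[OF irr(1) _ jk] by blast
      \<comment> \<open>The scalar \<open>c\<close> is found by taking the trace of the scalar
        matrix; the matrix product over \<open>i\<close> then collapses to
        \<open>\<rho> (inv g \<otimes> g)\<close>, the identity matrix.\<close>
      have "of_nat d * c = (\<Sum>i<d. \<Sum>g\<in>carrier G. \<rho> (inv g) $$ (k, i) * \<rho> g $$ (i, j))"
      proof -
        have "of_nat d * c = (\<Sum>i<d. T \<rho> d j k $$ (i, i))" by (simp add: c)
        also have "\<dots> = (\<Sum>i<d. \<Sum>g\<in>carrier G. \<rho> (inv g) $$ (k, i) * \<rho> g $$ (i, j))"
          by (simp add: T_def mult.commute)
        finally show ?thesis .
      qed
      also have "\<dots> = (\<Sum>g\<in>carrier G. \<rho> (inv g \<otimes> g) $$ (k, j))"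
        by (subst sum.swap, intro sum.cong) (use jk in \<open>auto simp: irreducible_rep_index_mult[OF G irr(1), symmetric]\<close>)
      also have "\<dots> = (if j = k then of_nat (card (carrier G)) else 0)"
        using r(4) jk by simp
      finally have "c = (if j = k then of_nat (card (carrier G)) else 0) / of_nat d"
        using r(1) by (simp add: field_simps)
      then show ?thesis using jk by (simp add: c)
    qed
    \<comment> \<open>Only the traces of \<open>\<rho>'\<close> enter the sum, so
      \<open>\<rho>\<close> can replace \<open>\<rho>'\<close> without an equivalence between the
      two.\<close>
    have "(\<Sum>g\<in>carrier G. trace (\<rho> g) * trace (\<rho>' (inv g))) = (\<Sum>g\<in>carrier G. trace (\<rho> g) * trace (\<rho> (inv g)))"
      using True by simp
    also have "\<dots> = (\<Sum>j<d. \<Sum>k<d. if j = k then of_nat (card (carrier G)) / of_nat d else 0)"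
      unfolding S[OF irr(1)] by (intro sum.cong refl) (simp add: diag)
    also have "\<dots> = of_nat (card (carrier G))" using r(1) by simp
    finally show ?thesis using True by simp
  qed
qed

text \<open>The averaged form \<open>H = \<Sum> \<rho>(g)\<^sup>* \<rho>(g)\<close> is invertible and satisfies
  \<open>\<rho>(h)\<^sup>* H = H \<rho>(h)\<^sup>-\<^sup>1\<close>, so \<open>\<rho>(h)\<^sup>*\<close> is similar to \<open>\<rho>(h)\<^sup>-\<^sup>1\<close>.\<close>

lemma trace_inv_eq_cnj:
  fixes G (structure)
  assumes G: "group G" "finite (carrier G)" and irr: "irreducible_rep G d \<rho>" and h: "h \<in> carrier G"
  shows "trace (\<rho> (inv\<^bsub>G\<^esub> h)) = cnj (trace (\<rho> h))"
proof -
  interpret group G by fact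
  note r = irreducible_repE[OF G(1) irr]
  define H where "H = mat d d (\<lambda>(i, j). \<Sum>g\<in>carrier G. \<Sum>k<d. cnj (\<rho> g $$ (k, i)) * \<rho> g $$ (k, j))"
  define S where "S = mat d d (\<lambda>(i, j). cnj (\<rho> h $$ (j, i)))"
  have H: "H \<in> carrier_mat d d" and S: "S \<in> carrier_mat d d" by (simp_all add: H_def S_def)
  note rh = r(2)[OF h] and rh' = r(2)[OF inv_closed[OF h]]
  have "det H \<noteq> 0"
  proof
    assume "det H = 0"
    then obtain v where v: "v \<in> carrier_vec d" "v \<noteq> 0\<^sub>v d" "H *\<^sub>v v = 0\<^sub>v d"
      using det_0_iff_vec_prod_zero_field[OF H] by blast
    have "0 = (\<Sum>i<d. cnj (v $ i) * (H *\<^sub>v v) $ i)" unfolding v(3) by simp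
    also have "\<dots> = (\<Sum>i<d. \<Sum>j<d. \<Sum>g\<in>carrier G. \<Sum>k<d.
        cnj (v $ i) * cnj (\<rho> g $$ (k, i)) * (\<rho> g $$ (k, j) * v $ j))"
    proof (intro sum.cong refl)
      fix i assume "i \<in> {..<d}"
      then have i: "i < d" by simp
      show "cnj (v $ i) * (H *\<^sub>v v) $ i = (\<Sum>j<d. \<Sum>g\<in>carrier G. \<Sum>k<d.
          cnj (v $ i) * cnj (\<rho> g $$ (k, i)) * (\<rho> g $$ (k, j) * v $ j))"
        unfolding index_mult_mat_vec_sum[OF H v(1) i] sum_distrib_left
      proof (intro sum.cong refl)
        fix j assume "j \<in> {..<d}"
        then have Hij: "H $$ (i, j) = (\<Sum>g\<in>carrier G. \<Sum>k<d. cnj (\<rho> g $$ (k, i)) * \<rho> g $$ (k, j))"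
          using i by (simp add: H_def)
        show "cnj (v $ i) * (H $$ (i, j) * v $ j) = (\<Sum>g\<in>carrier G. \<Sum>k<d.
            cnj (v $ i) * cnj (\<rho> g $$ (k, i)) * (\<rho> g $$ (k, j) * v $ j))"
          unfolding Hij sum_distrib_left sum_distrib_right by (simp only: mult.assoc)
      qed
    qed
    also have "\<dots> = (\<Sum>g\<in>carrier G. \<Sum>k<d. \<Sum>i<d. \<Sum>j<d.
        cnj (v $ i) * cnj (\<rho> g $$ (k, i)) * (\<rho> g $$ (k, j) * v $ j))"
      by (rule sum_swap_pairs)
    also have "\<dots> = (\<Sum>g\<in>carrier G. \<Sum>k<d. cnj ((\<rho> g *\<^sub>v v) $ k) * ((\<rho> g *\<^sub>v v) $ k))"
    proof (intro sum.cong refl)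
      fix g k assume "g \<in> carrier G" "k \<in> {..<d}"
      then have k: "k < d" and g: "\<rho> g \<in> carrier_mat d d" using r(2) by auto
      show "(\<Sum>i<d. \<Sum>j<d. cnj (v $ i) * cnj (\<rho> g $$ (k, i)) * (\<rho> g $$ (k, j) * v $ j)) =
          cnj ((\<rho> g *\<^sub>v v) $ k) * ((\<rho> g *\<^sub>v v) $ k)"
        unfolding index_mult_mat_vec_sum[OF g v(1) k] cnj_sum sum_product complex_cnj_mult
          by (simp only: mult_ac)
    qed
    also have "\<dots> = (\<Sum>g\<in>carrier G. \<Sum>k<d. of_real ((cmod ((\<rho> g *\<^sub>v v) $ k))\<^sup>2))"
      by (intro sum.cong refl) (simp only: complex_norm_square mult.commute)
    also have "\<dots> = of_real (\<Sum>g\<in>carrier G. \<Sum>k<d. (cmod ((\<rho> g *\<^sub>v v) $ k))\<^sup>2)"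
      by (simp only: of_real_sum)
    finally have "complex_of_real (\<Sum>g\<in>carrier G. \<Sum>k<d. (cmod ((\<rho> g *\<^sub>v v) $ k))\<^sup>2) = 0"
      by (rule sym)
    then have "(\<Sum>g\<in>carrier G. \<Sum>k<d. (cmod ((\<rho> g *\<^sub>v v) $ k))\<^sup>2) = 0"
      by (simp only: of_real_eq_0_iff)
    \<comment> \<open>A vanishing sum of nonnegative terms has vanishing terms; the term of the
      identity element is the squared norm of \<open>v\<close>.\<close>
    then have "(\<Sum>k<d. (cmod ((\<rho> \<one> *\<^sub>v v) $ k))\<^sup>2) = 0"
      using G(2) by (simp add: sum_nonneg_eq_0_iff sum_nonneg)
    then have "v $ k = 0" if "k < d" for k
      using that v(1) by (simp add: sum_nonneg_eq_0_iff r(4))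
    then have "v = 0\<^sub>v d" using v(1) by auto
    then show False using v(2) by simp
  qed
  then obtain K where K: "K \<in> carrier_mat d d" "H * K = 1\<^sub>m d" "K * H = 1\<^sub>m d"
    using det_non_zero_imp_unit[OF H] unfolding Units_def ring_mat_def by auto
  have SH: "S * H = H * \<rho> (inv h)"
  proof (rule eq_matI)
    fix i j assume "i < dim_row (H * \<rho> (inv h))" "j < dim_col (H * \<rho> (inv h))"
    then have ij: "i < d" "j < d" using H rh' by auto
    have "(S * H) $$ (i, j) = (\<Sum>p<d. \<Sum>g\<in>carrier G. \<Sum>k<d.
        cnj (\<rho> h $$ (p, i)) * (cnj (\<rho> g $$ (k, p)) * \<rho> g $$ (k, j)))"
      unfolding index_mult_mat_sum[OF S H ij]
      by (intro sum.cong) (use ij in \<open>auto simp: S_def H_def sum_distrib_left\<close>)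
    also have "\<dots> = (\<Sum>g\<in>carrier G. \<Sum>k<d. \<Sum>p<d.
        cnj (\<rho> h $$ (p, i)) * (cnj (\<rho> g $$ (k, p)) * \<rho> g $$ (k, j)))"
      by (rule sum_rotate)
    also have "\<dots> = (\<Sum>g\<in>carrier G. \<Sum>k<d. cnj (\<rho> (g \<otimes> h) $$ (k, i)) * \<rho> g $$ (k, j))"
      by (intro sum.cong refl)
        (use h ij in \<open>auto simp: irreducible_rep_index_mult[OF G(1) irr] sum_distrib_right sum_distrib_left mult_ac\<close>)
    also have "\<dots> = (\<Sum>g\<in>carrier G. \<Sum>k<d. cnj (\<rho> g $$ (k, i)) * \<rho> (g \<otimes> inv h) $$ (k, j))"
      by (rule sum.reindex_bij_witness[of _ "\<lambda>g. g \<otimes> inv h" "\<lambda>g. g \<otimes> h"])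
        (use h in \<open>auto simp: m_assoc\<close>)
    also have "\<dots> = (\<Sum>g\<in>carrier G. \<Sum>k<d. \<Sum>p<d.
        (cnj (\<rho> g $$ (k, i)) * \<rho> g $$ (k, p)) * \<rho> (inv h) $$ (p, j))"
      by (intro sum.cong refl)
        (use h ij in \<open>auto simp: irreducible_rep_index_mult[OF G(1) irr] sum_distrib_right sum_distrib_left mult_ac\<close>)
    also have "\<dots> = (\<Sum>p<d. \<Sum>g\<in>carrier G. \<Sum>k<d.
        (cnj (\<rho> g $$ (k, i)) * \<rho> g $$ (k, p)) * \<rho> (inv h) $$ (p, j))"
      by (rule sum_rotate[symmetric])
    also have "\<dots> = (H * \<rho> (inv h)) $$ (i, j)"
      unfolding index_mult_mat_sum[OF H rh' ij]
      by (intro sum.cong) (use ij in \<open>auto simp: H_def sum_distrib_right\<close>)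
    finally show "(S * H) $$ (i, j) = (H * \<rho> (inv h)) $$ (i, j)" .
  qed (use S H rh' in auto)
  have "cnj (trace (\<rho> h)) = trace S" unfolding trace_eq[OF rh] trace_eq[OF S] by (simp add: S_def)
  also have "\<dots> = trace ((S * H) * K)"
    unfolding assoc_mult_mat[OF S H K(1)] K(2) using S by simp
  also have "\<dots> = trace (K * (H * \<rho> (inv h)))"
    unfolding SH using H K rh' by (intro trace_mult_comm[of _ d d]) auto
  also have "K * (H * \<rho> (inv h)) = \<rho> (inv h)"
    unfolding assoc_mult_mat[OF K(1) H rh', symmetric] K(3) using rh' by simp
  finally show ?thesis by (rule sym)
qed

theorem Irr_orthonormal:
  fixes G (structure)
  assumes G: "group G" "finite (carrier G)" and "\<phi> \<in> Irr G" "\<psi> \<in> Irr G"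
  shows "char_inner G \<phi> \<psi> = (if \<phi> = \<psi> then 1 else 0)"
proof -
  interpret group G by fact
  obtain d \<rho> where \<phi>: "\<phi> = cut (carrier G) (\<lambda>g. trace (\<rho> g))" "irreducible_rep G d \<rho>"
    using assms(3) by (auto simp: Irr_def)
  obtain d' \<rho>' where \<psi>: "\<psi> = cut (carrier G) (\<lambda>g. trace (\<rho>' g))" "irreducible_rep G d' \<rho>'"
    using assms(4) by (auto simp: Irr_def)
  note irr = \<phi>(2) \<psi>(2)
  have "(\<Sum>g\<in>carrier G. \<phi> g * cnj (\<psi> g)) = (\<Sum>g\<in>carrier G. trace (\<rho> g) * trace (\<rho>' (inv g)))"
    by (intro sum.cong) (auto simp: \<phi>(1) \<psi>(1) cut_def trace_inv_eq_cnj[OF G irr(2)])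
  moreover have "\<phi> = \<psi> \<longleftrightarrow> (\<forall>g\<in>carrier G. trace (\<rho> g) = trace (\<rho>' g))"
    unfolding \<phi>(1) \<psi>(1) cut_def by (auto simp: fun_eq_iff split: if_splits)
  moreover have "card (carrier G) \<noteq> 0" using G(2) by auto
  ultimately show ?thesis
    unfolding char_inner_def sum_trace_mult_trace_inv[OF G(1) irr] by simp
qed

section \<open>Representations on spaces of functions\<close>

abbreviation clinear :: "(('a \<Rightarrow> complex) \<Rightarrow> 'b \<Rightarrow> complex) \<Rightarrow> bool" where
  "clinear \<equiv> Vector_Spaces.linear cscale cscale"

lemma clinear_iff:
  "clinear T \<longleftrightarrow> (\<forall>x y. T (x + y) = T x + T y) \<and> (\<forall>c x. T (cscale c x) = cscale c (T x))"
  by (simp add: Vector_Spaces.linear_iff cfun.vector_space_axioms)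

lemma clinear_scale: "clinear T \<Longrightarrow> T (cscale c x) = cscale c (T x)"
  by (simp add: clinear_iff)

lemma clinear_add: "clinear T \<Longrightarrow> T (x + y) = T x + T y"
  by (simp add: clinear_iff)

lemma clinear_zero: "clinear T \<Longrightarrow> T 0 = 0"
  using clinear_scale[of T 0 0] by (simp add: cscale_def zero_fun_def)

lemma clinear_sum: "clinear T \<Longrightarrow> T (\<Sum>i\<in>I. f i) = (\<Sum>i\<in>I. T (f i))"
  by (induction I rule: infinite_finite_induct)
    (simp_all only: sum.infinite sum.empty sum.insert clinear_zero clinear_add simp_thms)

lemma sum_fun_apply: "(\<Sum>i\<in>I. f i) x = (\<Sum>i\<in>I. f i x)"
  by (induction I rule: infinite_finite_induct) simp_all

text \<open>The basis is a parameter here, where \<open>lin_trace\<close> chooses one, so that bases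
  adapted to a decomposition of the space can be used.\<close>

definition basis_trace :: "('a \<Rightarrow> complex) set \<Rightarrow> (('a \<Rightarrow> complex) \<Rightarrow> 'a \<Rightarrow> complex) \<Rightarrow> complex" where
  "basis_trace b T = (\<Sum>v\<in>b. cfun.representation b (T v) v)"

lemma representation_image:
  assumes b: "cfun.independent b" and c: "finite c" "cfun.independent c" and T: "clinear T"
    and im: "\<And>w. w \<in> c \<Longrightarrow> T w \<in> cfun.span b" and x: "x \<in> cfun.span c"
  shows "cfun.representation b (T x) v = (\<Sum>w\<in>c. cfun.representation c x w * cfun.representation b (T w) v)"
proof -
  have "T x = T (\<Sum>w\<in>c. cscale (cfun.representation c x w) w)"
    using cfun.sum_representation_eq[OF c(2) x c(1)] by simp
  also have "\<dots> = (\<Sum>w\<in>c. cscale (cfun.representation c x w) (T w))"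
    by (simp add: clinear_sum[OF T] clinear_scale[OF T])
  finally have "cfun.representation b (T x) = cfun.representation b (\<Sum>w\<in>c. cscale (cfun.representation c x w) (T w))"
    by simp
  also have "\<dots> = (\<lambda>v. \<Sum>w\<in>c. cfun.representation b (cscale (cfun.representation c x w) (T w)) v)"
    by (rule cfun.representation_sum[OF b]) (simp add: im cfun.span_scale)
  finally show ?thesis
    using im by (simp add: cfun.representation_scale[OF b])
qed

text \<open>Both traces are the double sum over \<open>v\<close> in \<open>b\<close> and
  \<open>w\<close> in \<open>c\<close> of the coordinate of \<open>v\<close> at \<open>w\<close>
  times the coordinate of \<open>T w\<close> at \<open>v\<close>: summing over \<open>w\<close>
  first gives the trace for \<open>b\<close>, summing over \<open>v\<close> first the trace for
  \<open>c\<close>.\<close>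

lemma basis_trace_unique:
  assumes b: "finite b" "cfun.independent b" and c: "finite c" "cfun.independent c"
    and eq: "cfun.span b = cfun.span c" and T: "clinear T"
    and im: "\<And>x. x \<in> cfun.span b \<Longrightarrow> T x \<in> cfun.span b"
  shows "basis_trace b T = basis_trace c T"
proof -
  have bc: "v \<in> cfun.span c" if "v \<in> b" for v using eq that cfun.span_base by blast
  have cb: "v \<in> cfun.span b" if "v \<in> c" for v using eq that cfun.span_base by blast
  have "basis_trace b T = (\<Sum>v\<in>b. \<Sum>w\<in>c. cfun.representation c v w * cfun.representation b (T w) v)"
    unfolding basis_trace_def
    by (intro sum.cong refl representation_image[OF b(2) c T]) (auto intro: im bc cb)
  also have "\<dots> = (\<Sum>w\<in>c. \<Sum>v\<in>b. cfun.representation b (T w) v * cfun.representation c v w)"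
    by (subst sum.swap) (simp add: mult.commute)
  also have "\<dots> = (\<Sum>w\<in>c. cfun.representation c (T w) w)"
    by (intro sum.cong refl representation_image[OF c(2) b, of id, simplified, symmetric])
      (auto simp: clinear_iff id_def intro: im bc cb)
  finally show ?thesis by (simp add: basis_trace_def)
qed

text \<open>The basis that \<open>SOME\<close> picks is finite because it is an independent set in a
  finitely spanned space, so the comparison of bases applies to it.\<close>

lemma lin_trace_eq_basis_trace:
  assumes b: "finite b" "cfun.independent b" "cfun.span b = V" and T: "clinear T"
    and im: "\<And>x. x \<in> V \<Longrightarrow> T x \<in> V"
  shows "lin_trace V T = basis_trace b T"
proof -
  define c where "c = (SOME b. cfun.independent b \<and> cfun.span b = V)"
  have c: "cfun.independent c \<and> cfun.span c = V"
    unfolding c_def by (rule someI[of _ b]) (use b in auto)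
  then have "finite c"
    using cfun.independent_span_bound[OF b(1), of c] cfun.span_superset[of c] b(3) by auto
  then show ?thesis
    using basis_trace_unique[of c b T] b c T im unfolding lin_trace_def Let_def c_def[symmetric] basis_trace_def
    by auto
qed

text \<open>A coordinate-free substitute for the matrix representations in the definition of
  \<^const>\<open>Irr\<close>: it allows passing to invariant subspaces without choosing bases.\<close>

definition fun_rep ::
    "('a, 'b) monoid_scheme \<Rightarrow> ('c \<Rightarrow> complex) set \<Rightarrow> ('a \<Rightarrow> ('c \<Rightarrow> complex) \<Rightarrow> 'c \<Rightarrow> complex) \<Rightarrow> bool" where
  "fun_rep G V R \<longleftrightarrow> cfun.subspace V \<and>
     (\<forall>g\<in>carrier G. clinear (R g) \<and> (\<forall>v\<in>V. R g v \<in> V)) \<and>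
     (\<forall>g\<in>carrier G. \<forall>h\<in>carrier G. \<forall>v\<in>V. R (g \<otimes>\<^bsub>G\<^esub> h) v = R g (R h v)) \<and>
     (\<forall>v\<in>V. R \<one>\<^bsub>G\<^esub> v = v)"

definition invariant_subspace ::
    "('a, 'b) monoid_scheme \<Rightarrow> ('c \<Rightarrow> complex) set \<Rightarrow> ('a \<Rightarrow> ('c \<Rightarrow> complex) \<Rightarrow> 'c \<Rightarrow> complex) \<Rightarrow>
      ('c \<Rightarrow> complex) set \<Rightarrow> bool" where
  "invariant_subspace G V R U \<longleftrightarrow> cfun.subspace U \<and> U \<subseteq> V \<and> (\<forall>g\<in>carrier G. \<forall>u\<in>U. R g u \<in> U)"

definition irreducible_fun_rep ::
    "('a, 'b) monoid_scheme \<Rightarrow> ('c \<Rightarrow> complex) set \<Rightarrow> ('a \<Rightarrow> ('c \<Rightarrow> complex) \<Rightarrow> 'c \<Rightarrow> complex) \<Rightarrow> bool" where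
  "irreducible_fun_rep G V R \<longleftrightarrow> fun_rep G V R \<and> V \<noteq> {0} \<and>
     (\<forall>U. invariant_subspace G V R U \<longrightarrow> U = {0} \<or> U = V)"

text \<open>An enumeration \<open>e\<close> of the basis turns \<open>R g\<close> into a matrix, and
  the coordinate map \<open>\<phi>\<close> intertwines the two actions. An invariant set of vectors
  pulls back along \<open>\<phi>\<close> to an invariant subspace of \<open>V\<close>; surjectivity
  of \<open>\<phi>\<close> carries the dichotomy back.\<close>

lemma irreducible_fun_rep_char:
  assumes G: "group G" and irr: "irreducible_fun_rep G V R"
    and b: "finite b" "cfun.independent b" "cfun.span b = V"
  shows "cut (carrier G) (\<lambda>g. basis_trace b (R g)) \<in> Irr G"
proof -
  interpret group G by fact
  have lin: "clinear (R g)" and RV: "\<And>v. v \<in> V \<Longrightarrow> R g v \<in> V" if "g \<in> carrier G" for g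
    using irr that by (auto simp: irreducible_fun_rep_def fun_rep_def)
  have hom: "R (g \<otimes>\<^bsub>G\<^esub> h) v = R g (R h v)" if "g \<in> carrier G" "h \<in> carrier G" "v \<in> V" for g h v
    using irr that by (auto simp: irreducible_fun_rep_def fun_rep_def)
  have one: "R \<one>\<^bsub>G\<^esub> v = v" if "v \<in> V" for v
    using irr that by (auto simp: irreducible_fun_rep_def fun_rep_def)
  have sV: "cfun.subspace V" using b(3) cfun.subspace_span by blast
  define d where "d = card b"
  obtain e where e: "bij_betw e {..<d} b"
    using ex_bij_betw_nat_finite[OF b(1)] by (auto simp: d_def atLeast0LessThan)
  have eb: "e i \<in> b" if "i < d" for i using e that by (auto simp: bij_betw_def)
  have eV: "e i \<in> V" if "i < d" for i using eb[OF that] b(3) cfun.span_base by blast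
  have e_inj: "e i = e j \<longleftrightarrow> i = j" if "i < d" "j < d" for i j
    using e that by (auto simp: bij_betw_def inj_on_def)
  have sum_b: "(\<Sum>v\<in>b. f v) = (\<Sum>i<d. f (e i))" for f :: "_ \<Rightarrow> 'z :: comm_monoid_add"
    by (rule sum.reindex_bij_betw[OF e, symmetric])
  let ?r = "cfun.representation b"
  define \<rho> where "\<rho> g = mat d d (\<lambda>(i, j). ?r (R g (e j)) (e i))" for g
  define \<phi> where "\<phi> x = vec d (\<lambda>i. ?r x (e i))" for x
  have \<rho>: "\<rho> g \<in> carrier_mat d d" for g by (simp add: \<rho>_def)
  have \<phi>: "\<phi> x \<in> carrier_vec d" for x by (simp add: \<phi>_def)
  have rep_R: "?r (R g x) v = (\<Sum>k<d. ?r x (e k) * ?r (R g (e k)) v)" if "g \<in> carrier G" "x \<in> V" for g x v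
    using representation_image[OF b(2) b(1,2) lin[OF that(1)], of x v] RV[OF that(1)] that(2) b(3)
      cfun.span_base by (auto simp: sum_b)
  have \<phi>_R: "\<phi> (R g x) = \<rho> g *\<^sub>v \<phi> x" if "g \<in> carrier G" "x \<in> V" for g x
  proof (rule eq_vecI)
    fix i assume "i < dim_vec (\<rho> g *\<^sub>v \<phi> x)"
    then have i: "i < d" by (simp add: \<rho>_def)
    show "\<phi> (R g x) $ i = (\<rho> g *\<^sub>v \<phi> x) $ i"
      unfolding index_mult_mat_vec_sum[OF \<rho> \<phi> i]
      using i by (simp add: \<phi>_def \<rho>_def rep_R[OF that] mult.commute)
  qed (simp add: \<phi>_def \<rho>_def)
  have \<phi>_add: "\<phi> (x + y) = \<phi> x + \<phi> y" if "x \<in> V" "y \<in> V" for x y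
    by (rule eq_vecI) (use cfun.representation_add[OF b(2)] that b(3) in \<open>auto simp: \<phi>_def\<close>)
  have \<phi>_scale: "\<phi> (cscale c x) = c \<cdot>\<^sub>v \<phi> x" if "x \<in> V" for c x
    by (rule eq_vecI) (use cfun.representation_scale[OF b(2)] that b(3) in \<open>auto simp: \<phi>_def\<close>)
  have \<phi>_zero: "\<phi> 0 = 0\<^sub>v d"
    by (rule eq_vecI) (auto simp: \<phi>_def cfun.representation_zero)
  have surj: "\<exists>x\<in>V. \<phi> x = w" if w: "w \<in> carrier_vec d" for w
  proof
    let ?x = "\<Sum>j<d. cscale (w $ j) (e j)"
    show "?x \<in> V"
      using sV eV by (intro cfun.subspace_sum cfun.subspace_scale) auto
    have "?r ?x = (\<lambda>v. \<Sum>j<d. ?r (cscale (w $ j) (e j)) v)"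
      by (rule cfun.representation_sum[OF b(2)]) (use eV b(3) in \<open>auto intro: cfun.span_scale\<close>)
    then have "?r ?x v = (\<Sum>j<d. w $ j * (if v = e j then 1 else 0))" for v
      using eV eb b(3) by (simp add: cfun.representation_scale[OF b(2)] cfun.representation_basis[OF b(2)])
    then show "\<phi> ?x = w"
      by (intro eq_vecI) (use w in \<open>auto simp: \<phi>_def e_inj if_distrib cong: if_cong\<close>)
  qed
  have "b \<noteq> {}"
    using irr b(3) by (auto simp: irreducible_fun_rep_def)
  then have d: "d > 0" using b(1) by (auto simp: d_def card_gt_0_iff)
  have hom': "\<rho> \<in> hom G (GL d)"
    unfolding hom_GL_iff[OF G]
  proof (intro conjI ballI)
    fix g h assume g: "g \<in> carrier G" and h: "h \<in> carrier G"
    show "\<rho> (g \<otimes>\<^bsub>G\<^esub> h) = \<rho> g * \<rho> h"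
    proof (rule eq_matI)
      fix i j assume "i < dim_row (\<rho> g * \<rho> h)" "j < dim_col (\<rho> g * \<rho> h)"
      then have ij: "i < d" "j < d" by (auto simp: \<rho>_def)
      show "\<rho> (g \<otimes>\<^bsub>G\<^esub> h) $$ (i, j) = (\<rho> g * \<rho> h) $$ (i, j)"
        unfolding index_mult_mat_sum[OF \<rho> \<rho> ij]
        using ij by (simp add: \<rho>_def hom[OF g h eV] rep_R[OF g RV[OF h eV]] mult.commute)
    qed (auto simp: \<rho>_def)
  next
    show "\<rho> \<one>\<^bsub>G\<^esub> = 1\<^sub>m d"
      by (rule eq_matI) (auto simp: \<rho>_def one eV cfun.representation_basis[OF b(2) eb] e_inj)
  qed (rule \<rho>)
  have irr': "W = {0\<^sub>v d} \<or> W = carrier_vec d"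
    if W: "W \<subseteq> carrier_vec d" "0\<^sub>v d \<in> W" "\<And>v w. v \<in> W \<Longrightarrow> w \<in> W \<Longrightarrow> v + w \<in> W"
      "\<And>c v. v \<in> W \<Longrightarrow> c \<cdot>\<^sub>v v \<in> W" "\<And>g w. g \<in> carrier G \<Longrightarrow> w \<in> W \<Longrightarrow> \<rho> g *\<^sub>v w \<in> W" for W
  proof -
    define U where "U = {x \<in> V. \<phi> x \<in> W}"
    have "invariant_subspace G V R U"
      unfolding invariant_subspace_def cfun.subspace_def
      using W sV RV by (auto simp: U_def \<phi>_add \<phi>_scale \<phi>_zero \<phi>_R cfun.subspace_def)
    then have "U = {0} \<or> U = V" using irr by (auto simp: irreducible_fun_rep_def)
    then show ?thesis
    proof
      assume U: "U = {0}"
      have "w = 0\<^sub>v d" if w: "w \<in> W" for w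
      proof -
        obtain x where x: "x \<in> V" "\<phi> x = w" using surj[of w] w W(1) by auto
        then have "x \<in> U" using w by (auto simp: U_def)
        then show ?thesis using U x \<phi>_zero by auto
      qed
      then show ?thesis using W(2) by blast
    next
      assume U: "U = V"
      then show ?thesis using surj W(1) by (auto simp: U_def)
    qed
  qed
  have "irreducible_rep G d \<rho>"
    unfolding irreducible_rep_def vec_subspace_iff using d hom' irr' by simp
  moreover have "trace (\<rho> g) = basis_trace b (R g)" for g
    unfolding trace_eq[OF \<rho>] basis_trace_def sum_b by (simp add: \<rho>_def)
  ultimately show ?thesis unfolding Irr_def by (auto intro!: exI[of _ d] exI[of _ \<rho>])
qed

text \<open>Column vectors of length \<open>d\<close> become functions vanishing from
  \<open>d\<close> on, which places them in the vector space \<open>cfun\<close> with its spans,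
  bases and dimensions.\<close>

definition vec_funs :: "nat \<Rightarrow> (nat \<Rightarrow> complex) set" where
  "vec_funs d = {f. \<forall>i\<ge>d. f i = 0}"

definition mat_act :: "nat \<Rightarrow> complex mat \<Rightarrow> (nat \<Rightarrow> complex) \<Rightarrow> nat \<Rightarrow> complex" where
  "mat_act d A f = (\<lambda>i. if i < d then \<Sum>j<d. A $$ (i, j) * f j else 0)"

definition unit_fun :: "nat \<Rightarrow> nat \<Rightarrow> complex" where
  "unit_fun j = (\<lambda>i. if i = j then 1 else 0)"

lemma vec_mat_act:
  assumes "A \<in> carrier_mat d d"
  shows "vec d (mat_act d A f) = A *\<^sub>v vec d f"
proof (rule eq_vecI)
  fix i assume "i < dim_vec (A *\<^sub>v vec d f)"
  then have i: "i < d" using assms by simp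
  show "vec d (mat_act d A f) $ i = (A *\<^sub>v vec d f) $ i"
    unfolding index_mult_mat_vec_sum[OF assms vec_carrier i] using i by (simp add: mat_act_def)
qed (use assms in simp)

lemma vec_funs_eqI: "f \<in> vec_funs d \<Longrightarrow> g \<in> vec_funs d \<Longrightarrow> vec d f = vec d g \<Longrightarrow> f = g"
proof
  fix i assume *: "f \<in> vec_funs d" "g \<in> vec_funs d" "vec d f = vec d g"
  have "vec d f $ i = vec d g $ i" using *(3) by simp
  then show "f i = g i"
    using *(1,2) by (cases "i < d") (auto simp: vec_funs_def)
qed

lemma clinear_mat_act: "clinear (mat_act d A)"
  by (auto simp: clinear_iff mat_act_def cscale_def fun_eq_iff distrib_left distrib_right sum.distrib sum_distrib_left mult_ac)

lemma subspace_vec_funs: "cfun.subspace (vec_funs d)"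
  by (auto simp: cfun.subspace_def vec_funs_def cscale_def)

lemma mat_act_closed: "mat_act d A f \<in> vec_funs d"
  by (simp add: mat_act_def vec_funs_def)

lemma vec_funs_expand: "f \<in> vec_funs d \<Longrightarrow> f = (\<Sum>j<d. cscale (f j) (unit_fun j))"
proof
  fix i assume f: "f \<in> vec_funs d"
  have "(\<Sum>j<d. cscale (f j) (unit_fun j)) i = (\<Sum>j<d. if i = j then f j else 0)"
    unfolding sum_fun_apply by (intro sum.cong) (auto simp: unit_fun_def cscale_def)
  then show "f i = (\<Sum>j<d. cscale (f j) (unit_fun j)) i"
    using f by (auto simp: vec_funs_def)
qed


lemma unit_fun_in: "j < d \<Longrightarrow> unit_fun j \<in> vec_funs d"
  by (simp add: unit_fun_def vec_funs_def)

lemma inj_unit_fun: "unit_fun i = unit_fun j \<longleftrightarrow> i = j"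
  by (auto simp: unit_fun_def fun_eq_iff split: if_splits)

lemma span_unit_funs: "cfun.span (unit_fun ` {..<d}) = vec_funs d"
proof
  show "cfun.span (unit_fun ` {..<d}) \<subseteq> vec_funs d"
    by (rule cfun.span_minimal[OF _ subspace_vec_funs]) (auto intro: unit_fun_in)
  show "vec_funs d \<subseteq> cfun.span (unit_fun ` {..<d})"
  proof
    fix f assume "f \<in> vec_funs d"
    then have "f = (\<Sum>j<d. cscale (f j) (unit_fun j))" by (rule vec_funs_expand)
    also have "\<dots> \<in> cfun.span (unit_fun ` {..<d})"
      by (intro cfun.span_sum cfun.span_scale cfun.span_base) auto
    finally show "f \<in> cfun.span (unit_fun ` {..<d})" .
  qed
qed

lemma independent_unit_funs: "cfun.independent (unit_fun ` {..<d})"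
proof
  assume "cfun.dependent (unit_fun ` {..<d})"
  then obtain u v where uv: "v \<in> unit_fun ` {..<d}" "u v \<noteq> 0" "(\<Sum>v\<in>unit_fun ` {..<d}. cscale (u v) v) = 0"
    using cfun.dependent_finite[of "unit_fun ` {..<d}"] by auto
  then obtain j where j: "j < d" "v = unit_fun j" by auto
  have "0 = (\<Sum>v\<in>unit_fun ` {..<d}. cscale (u v) v) j" using uv(3) by simp
  also have "\<dots> = (\<Sum>i<d. u (unit_fun i) * unit_fun i j)"
    by (subst sum.reindex) (auto simp: inj_on_def inj_unit_fun sum_fun_apply cscale_def)
  also have "\<dots> = u (unit_fun j)"
    using j by (simp add: unit_fun_def if_distrib cong: if_cong)
  finally show False using uv(2) j by simp
qed

lemma basis_trace_mat_act:
  assumes A: "A \<in> carrier_mat d d" and b: "finite b" "cfun.independent b" "cfun.span b = vec_funs d"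
  shows "basis_trace b (mat_act d A) = trace A"
proof -
  let ?u = "unit_fun ` {..<d}"
  have "basis_trace b (mat_act d A) = basis_trace ?u (mat_act d A)"
    by (rule basis_trace_unique)
      (use b independent_unit_funs span_unit_funs clinear_mat_act mat_act_closed in auto)
  also have "\<dots> = (\<Sum>j<d. cfun.representation ?u (mat_act d A (unit_fun j)) (unit_fun j))"
    unfolding basis_trace_def by (subst sum.reindex) (auto simp: inj_on_def inj_unit_fun)
  also have "\<dots> = (\<Sum>j<d. A $$ (j, j))"
  proof (intro sum.cong refl)
    fix j assume "j \<in> {..<d}"
    then have j: "j < d" by simp
    let ?x = "mat_act d A (unit_fun j)"
    have uV: "unit_fun i \<in> cfun.span ?u" if "i < d" for i
      using that by (intro cfun.span_base) auto
    have "cfun.representation ?u ?x = cfun.representation ?u (\<Sum>i<d. cscale (?x i) (unit_fun i))"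
      using vec_funs_expand[OF mat_act_closed] by metis
    also have "\<dots> = (\<lambda>v. \<Sum>i<d. cfun.representation ?u (cscale (?x i) (unit_fun i)) v)"
      by (rule cfun.representation_sum[OF independent_unit_funs]) (auto intro!: cfun.span_scale uV)
    finally have "cfun.representation ?u ?x (unit_fun j) = (\<Sum>i<d. if i = j then ?x i else 0)"
      using uV by (auto simp: cfun.representation_scale[OF independent_unit_funs]
          cfun.representation_basis[OF independent_unit_funs] inj_unit_fun if_distrib cong: if_cong)
    also have "\<dots> = A $$ (j, j)"
      using j by (simp add: mat_act_def unit_fun_def if_distrib cong: if_cong)
    finally show "cfun.representation ?u ?x (unit_fun j) = A $$ (j, j)" .
  qed
  finally show ?thesis by (simp add: trace_eq[OF A])
qed

text \<open>The passage opposite to \<open>irreducible_fun_rep_char\<close>: the map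
  \<open>vec d\<close> matches invariant subspaces of \<open>vec_funs d\<close> with those of
  \<open>carrier_vec d\<close>.\<close>

lemma irreducible_rep_mat_act:
  assumes G: "group G" and irr: "irreducible_rep G d \<rho>"
  shows "irreducible_fun_rep G (vec_funs d) (\<lambda>g. mat_act d (\<rho> g))"
  unfolding irreducible_fun_rep_def
proof (intro conjI allI impI)
  note r = irreducible_repE[OF G irr]
  interpret group G by fact
  show "fun_rep G (vec_funs d) (\<lambda>g. mat_act d (\<rho> g))"
    unfolding fun_rep_def
  proof (intro conjI ballI)
    fix g h v assume g: "g \<in> carrier G" and h: "h \<in> carrier G" and v: "v \<in> vec_funs d"
    show "mat_act d (\<rho> (g \<otimes>\<^bsub>G\<^esub> h)) v = mat_act d (\<rho> g) (mat_act d (\<rho> h) v)"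
    proof (rule vec_funs_eqI[OF mat_act_closed mat_act_closed])
      note gh = r(2)[OF g] r(2)[OF h]
      show "vec d (mat_act d (\<rho> (g \<otimes>\<^bsub>G\<^esub> h)) v) = vec d (mat_act d (\<rho> g) (mat_act d (\<rho> h) v))"
        unfolding r(3)[OF g h] vec_mat_act[OF mult_carrier_mat[OF gh]] vec_mat_act[OF gh(1)] vec_mat_act[OF gh(2)]
        by (rule assoc_mult_mat_vec[OF gh vec_carrier])
    qed
  next
    fix v assume v: "v \<in> vec_funs d"
    show "mat_act d (\<rho> \<one>\<^bsub>G\<^esub>) v = v"
      by (rule vec_funs_eqI[where d = d]) (use r(4) v in \<open>auto simp: mat_act_closed vec_mat_act\<close>)
  qed (use subspace_vec_funs clinear_mat_act mat_act_closed in auto)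
  have "unit_fun 0 \<in> vec_funs d" "unit_fun 0 \<noteq> 0"
    using r(1) by (auto simp: vec_funs_def unit_fun_def fun_eq_iff)
  then show "vec_funs d \<noteq> {0}" by auto
  fix U assume "invariant_subspace G (vec_funs d) (\<lambda>g. mat_act d (\<rho> g)) U"
  then have U: "cfun.subspace U" "U \<subseteq> vec_funs d" "\<And>g u. g \<in> carrier G \<Longrightarrow> u \<in> U \<Longrightarrow> mat_act d (\<rho> g) u \<in> U"
    by (auto simp: invariant_subspace_def)
  have "vec d ` U = {0\<^sub>v d} \<or> vec d ` U = carrier_vec d"
  proof (rule r(5))
    show "0\<^sub>v d \<in> vec d ` U"
      using cfun.subspace_0[OF U(1)] by (intro image_eqI[of _ _ 0]) auto
  next
    fix v w assume "v \<in> vec d ` U" "w \<in> vec d ` U"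
    then obtain x y where "x \<in> U" "y \<in> U" "v = vec d x" "w = vec d y" by auto
    then show "v + w \<in> vec d ` U"
      using cfun.subspace_add[OF U(1)] by (intro image_eqI[of _ _ "x + y"]) auto
  next
    fix c v assume "v \<in> vec d ` U"
    then obtain x where "x \<in> U" "v = vec d x" by auto
    then show "c \<cdot>\<^sub>v v \<in> vec d ` U"
      using cfun.subspace_scale[OF U(1)] by (intro image_eqI[of _ _ "cscale c x"]) (auto simp: cscale_def)
  next
    fix g w assume g: "g \<in> carrier G" and "w \<in> vec d ` U"
    then obtain x where "x \<in> U" "w = vec d x" by auto
    then show "\<rho> g *\<^sub>v w \<in> vec d ` U"
      using U(3)[OF g] vec_mat_act[OF r(2)[OF g]] by (intro image_eqI[of _ _ "mat_act d (\<rho> g) x"]) auto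
  qed auto
  then show "U = {0} \<or> U = vec_funs d"
  proof
    assume 1: "vec d ` U = {0\<^sub>v d}"
    have "u = 0" if "u \<in> U" for u
    proof (rule vec_funs_eqI[where d = d])
      have "vec d u = 0\<^sub>v d" using 1 that by blast
      then show "vec d u = vec d 0" by auto
    qed (use that U(2) in \<open>auto simp: vec_funs_def\<close>)
    then show ?thesis using cfun.subspace_0[OF U(1)] by auto
  next
    assume 1: "vec d ` U = carrier_vec d"
    have "f \<in> U" if f: "f \<in> vec_funs d" for f
    proof -
      have "vec d f \<in> vec d ` U" using 1 by simp
      then obtain u where "u \<in> U" "vec d f = vec d u" by auto
      then show ?thesis using vec_funs_eqI[OF f, of u] U(2) by auto
    qed
    then show ?thesis using U(2) by auto
  qed
qed

lemma finite_basis_exists: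
  assumes "cfun.subspace W" "W \<subseteq> cfun.span c" "finite c"
  obtains b where "finite b" "cfun.independent b" "cfun.span b = W"
proof -
  obtain b where b: "b \<subseteq> W" "cfun.independent b" "W \<subseteq> cfun.span b"
    using cfun.basis_exists[of W] by metis
  have "finite b"
    using cfun.independent_span_bound[of c b] b assms(2,3) by blast
  moreover have "cfun.span b = W"
    using b cfun.span_minimal[OF b(1) assms(1)] by blast
  ultimately show ?thesis using that b(2) by blast
qed

lemma finite_basis_in_vec_funs:
  assumes "cfun.subspace W" "W \<subseteq> vec_funs d"
  obtains b where "finite b" "cfun.independent b" "cfun.span b = W"
  using finite_basis_exists[OF assms(1), of "unit_fun ` {..<d}"] assms(2) by (auto simp: span_unit_funs)

text \<open>A nonzero invariant subspace of \<open>U\<close> of least dimension is irreducible. A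
  smaller invariant subspace has smaller dimension because its basis stays independent after
  adjoining a vector \<open>x\<close> from outside.\<close>

lemma irreducible_subrep_exists:
  assumes V: "fun_rep G (vec_funs d) R" and U: "invariant_subspace G (vec_funs d) R U" "U \<noteq> {0}"
  obtains W where "W \<subseteq> U" "irreducible_fun_rep G W R"
proof -
  let ?P = "\<lambda>W. invariant_subspace G (vec_funs d) R W \<and> W \<noteq> {0} \<and> W \<subseteq> U"
  obtain W where W: "?P W" and min: "\<And>W'. ?P W' \<Longrightarrow> cfun.dim W \<le> cfun.dim W'"
    using ex_has_least_nat[of ?P U cfun.dim] U by blast
  have "irreducible_fun_rep G W R"
    unfolding irreducible_fun_rep_def
  proof (intro conjI allI impI)
    show "fun_rep G W R" using V W by (auto simp: fun_rep_def invariant_subspace_def subset_iff)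
    show "W \<noteq> {0}" using W by blast
    fix W' assume W': "invariant_subspace G W R W'"
    show "W' = {0} \<or> W' = W"
    proof (rule disjCI)
      assume "W' \<noteq> W"
      show "W' = {0}"
      proof (rule ccontr)
        assume nz: "W' \<noteq> {0}"
        have sub: "cfun.subspace W" "W \<subseteq> vec_funs d" "cfun.subspace W'" "W' \<subseteq> W"
          using W W' by (auto simp: invariant_subspace_def)
        have "?P W'" using W W' nz sub by (auto simp: invariant_subspace_def)
        then have le: "cfun.dim W \<le> cfun.dim W'" by (rule min)
        obtain b where b: "finite b" "cfun.independent b" "cfun.span b = W"
          using finite_basis_in_vec_funs[OF sub(1,2)] .
        obtain b' where b': "finite b'" "cfun.independent b'" "cfun.span b' = W'"
          using finite_basis_in_vec_funs[of W' d] sub by blast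
        obtain x where x: "x \<in> W" "x \<notin> W'" using sub \<open>W' \<noteq> W\<close> by blast
        have "cfun.independent (insert x b')"
          using b' x by (intro cfun.independent_insertI) auto
        moreover have "insert x b' \<subseteq> cfun.span b"
          using x b b' sub(4) cfun.span_superset[of b'] by auto
        ultimately have "card (insert x b') \<le> card b"
          using cfun.independent_span_bound[OF b(1)] by blast
        moreover have "x \<notin> b'" using x b'(3) cfun.span_base by blast
        ultimately have "card b' < card b" using b'(1) by simp
        moreover have "cfun.dim W = card b" "cfun.dim W' = card b'"
          using b b' cfun.dim_span_eq_card_independent by metis+
        ultimately show False using le by simp
      qed
    qed
  qed
  then show ?thesis using that W by blast
qed

section \<open>Restriction to a subgroup of index two\<close>

lemma Irr_support: "\<phi> \<in> Irr G \<Longrightarrow> x \<notin> carrier G \<Longrightarrow> \<phi> x = 0"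
  by (auto simp: Irr_def cut_def)

lemma Irr_conj:
  fixes G (structure)
  assumes G: "group G" and \<phi>: "\<phi> \<in> Irr G" and g: "g \<in> carrier G" and x: "x \<in> carrier G"
  shows "\<phi> (g \<otimes> x \<otimes> inv g) = \<phi> x"
proof -
  interpret group G by fact
  obtain d \<rho> where \<rho>: "\<phi> = cut (carrier G) (\<lambda>g. trace (\<rho> g))" "irreducible_rep G d \<rho>"
    using \<phi> by (auto simp: Irr_def)
  note r = irreducible_repE[OF G \<rho>(2)]
  have "trace (\<rho> (g \<otimes> x \<otimes> inv g)) = trace (\<rho> g * (\<rho> x * \<rho> (inv g)))"
    using g x by (simp add: r(3) m_assoc)
  also have "\<dots> = trace ((\<rho> x * \<rho> (inv g)) * \<rho> g)"
    using g x by (intro trace_mult_comm[of _ d d] mult_carrier_mat[of _ d d] r(2)) auto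
  also have "\<rho> x * \<rho> (inv g) * \<rho> g = \<rho> (x \<otimes> inv g \<otimes> g)"
    using g x by (simp only: r(3) m_closed inv_closed)
  also have "x \<otimes> inv g \<otimes> g = x" using g x by (simp add: m_assoc)
  finally show ?thesis using g x by (simp add: \<rho>(1) cut_def)
qed

lemma clinear_subspace_image: "clinear T \<Longrightarrow> cfun.subspace S \<Longrightarrow> cfun.subspace (T ` S)"
  unfolding cfun.subspace_def
proof (intro conjI ballI allI)
  assume T: "clinear T" and S: "0 \<in> S \<and> (\<forall>x\<in>S. \<forall>y\<in>S. x + y \<in> S) \<and> (\<forall>c. \<forall>x\<in>S. cscale c x \<in> S)"
  show "0 \<in> T ` S" using S clinear_zero[OF T] by (intro image_eqI[of _ _ 0]) auto
  fix x y assume "x \<in> T ` S" "y \<in> T ` S"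
  then obtain u v where "u \<in> S" "v \<in> S" "x = T u" "y = T v" by auto
  then show "x + y \<in> T ` S" using S by (intro image_eqI[of _ _ "u + v"]) (auto simp: clinear_add[OF T])
next
  fix c x
  assume T: "clinear T" and S: "0 \<in> S \<and> (\<forall>x\<in>S. \<forall>y\<in>S. x + y \<in> S) \<and> (\<forall>c. \<forall>x\<in>S. cscale c x \<in> S)"
    and "x \<in> T ` S"
  then obtain u where "u \<in> S" "x = T u" by auto
  then show "cscale c x \<in> T ` S" using S by (intro image_eqI[of _ _ "cscale c u"]) (auto simp: clinear_scale[OF T])
qed

lemma clinear_span_image: "clinear T \<Longrightarrow> cfun.span (T ` S) = T ` cfun.span S"
proof
  assume T: "clinear T"
  show "cfun.span (T ` S) \<subseteq> T ` cfun.span S"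
    by (intro cfun.span_minimal clinear_subspace_image[OF T] cfun.subspace_span) (auto intro: cfun.span_base)
  have "cfun.subspace {x. T x \<in> cfun.span (T ` S)}"
    unfolding cfun.subspace_def
    by (auto simp only: mem_Collect_eq clinear_add[OF T] clinear_scale[OF T] clinear_zero[OF T]
        intro: cfun.span_add cfun.span_scale cfun.span_zero)
  then have "cfun.span S \<subseteq> {x. T x \<in> cfun.span (T ` S)}"
    by (intro cfun.span_minimal) (auto intro: cfun.span_base)
  then show "T ` cfun.span S \<subseteq> cfun.span (T ` S)" by auto
qed

lemma independent_Un_if_disjoint_spans:
  assumes b: "finite b" "cfun.independent b" and c: "finite c" "cfun.independent c"
    and disj: "cfun.span b \<inter> cfun.span c = {0}"
  shows "cfun.independent (b \<union> c)" "b \<inter> c = {}"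
proof -
  show bc: "b \<inter> c = {}"
  proof (rule ccontr)
    assume "b \<inter> c \<noteq> {}"
    then obtain x where "x \<in> b" "x \<in> c" by blast
    then have "x = 0" using disj cfun.span_base by blast
    then show False using \<open>x \<in> b\<close> b(2) cfun.dependent_zero by blast
  qed
  show "cfun.independent (b \<union> c)"
  proof
    assume "cfun.dependent (b \<union> c)"
    then obtain u where u: "\<exists>v\<in>b \<union> c. u v \<noteq> 0" "(\<Sum>v\<in>b \<union> c. cscale (u v) v) = 0"
      using cfun.dependent_finite[of "b \<union> c"] b(1) c(1) by auto
    have *: "(\<Sum>v\<in>b. cscale (u v) v) + (\<Sum>v\<in>c. cscale (u v) v) = 0"
      using u(2) sum.union_disjoint[OF b(1) c(1) bc, of "\<lambda>v. cscale (u v) v"] by metis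
    have ib: "(\<Sum>v\<in>b. cscale (u v) v) \<in> cfun.span b" and ic: "(\<Sum>v\<in>c. cscale (u v) v) \<in> cfun.span c"
      by (intro cfun.span_sum cfun.span_scale cfun.span_base, assumption)+
    have "(\<Sum>v\<in>b. cscale (u v) v) = - (\<Sum>v\<in>c. cscale (u v) v)"
      by (rule eq_neg_iff_add_eq_0[THEN iffD2, OF *])
    then have "(\<Sum>v\<in>b. cscale (u v) v) \<in> cfun.span c" using cfun.span_neg[OF ic] by metis
    then have "(\<Sum>v\<in>b. cscale (u v) v) = 0" using ib disj by blast
    moreover then have "(\<Sum>v\<in>c. cscale (u v) v) = 0" using * by (metis add_0)
    ultimately have "\<forall>v\<in>b \<union> c. u v = 0"
      using cfun.independentD[OF b(2) b(1) subset_refl] cfun.independentD[OF c(2) c(1) subset_refl] by blast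
    then show False using u(1) by blast
  qed
qed

lemma char_inner_sum_left:
  "char_inner G (\<lambda>x. \<Sum>i\<in>I. c i * f i x) \<psi> = (\<Sum>i\<in>I. c i * char_inner G (f i) \<psi>)"
proof -
  have "(\<Sum>g\<in>carrier G. (\<Sum>i\<in>I. c i * f i g) * cnj (\<psi> g)) =
      (\<Sum>i\<in>I. c i * (\<Sum>g\<in>carrier G. f i g * cnj (\<psi> g)))"
    by (simp add: sum_distrib_left sum_distrib_right mult.assoc) (rule sum.swap)
  then show ?thesis
    by (simp add: char_inner_def sum_divide_distrib[where A = I])
qed

text \<open>Index two is expressed by elements: \<open>\<sigma>\<close> shows that \<open>N\<close>
  is proper, and \<open>outside_mult\<close> that there is only one other coset. Normality is
  derived in \<open>conj_in_N\<close>.\<close>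

locale index_two_subgroup = group G for G (structure) +
  fixes N and \<sigma>
  assumes finite_carrier: "finite (carrier G)"
    and subgroup: "subgroup N G"
    and \<sigma>: "\<sigma> \<in> carrier G" "\<sigma> \<notin> N"
    and outside_mult: "\<lbrakk>x \<in> carrier G; x \<notin> N; y \<in> carrier G; y \<notin> N\<rbrakk> \<Longrightarrow> x \<otimes> y \<in> N"
begin

abbreviation H where "H \<equiv> G\<lparr>carrier := N\<rparr>"

definition twist :: "('a \<Rightarrow> complex) \<Rightarrow> 'a \<Rightarrow> complex" where
  "twist \<phi> = cut N (\<lambda>x. \<phi> (inv \<sigma> \<otimes> x \<otimes> \<sigma>))"

text \<open>Multiplication by the linear character of \<open>G\<close> with kernel \<open>N\<close>;
  for the alternating group in the symmetric group this is the sign. It preserves vanishing outside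
  \<open>carrier G\<close>.\<close>

definition sgn_twist :: "('a \<Rightarrow> complex) \<Rightarrow> 'a \<Rightarrow> complex" where
  "sgn_twist \<phi> = (\<lambda>x. if x \<in> N then \<phi> x else - \<phi> x)"

lemma N_sub: "x \<in> N \<Longrightarrow> x \<in> carrier G"
  using subgroup.mem_carrier[OF subgroup] .

lemma N_closed: "x \<in> N \<Longrightarrow> y \<in> N \<Longrightarrow> x \<otimes> y \<in> N" "x \<in> N \<Longrightarrow> inv x \<in> N" "\<one> \<in> N"
  using subgroup by (simp_all add: subgroup.m_closed subgroup.m_inv_closed subgroup.one_closed)

lemma group_H: "group H"
  by (rule subgroup_imp_group[OF subgroup])

lemma finite_N: "finite N"
  using finite_carrier N_sub by (meson finite_subset subsetI)

lemma mult_in_N_iff: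
  assumes "x \<in> carrier G" "y \<in> carrier G"
  shows "x \<otimes> y \<in> N \<longleftrightarrow> (x \<in> N \<longleftrightarrow> y \<in> N)"
proof -
  have "y \<in> N" if "x \<in> N" "x \<otimes> y \<in> N"
    using N_closed(1)[OF N_closed(2)[OF that(1)] that(2)] assms by (simp add: m_assoc[symmetric])
  moreover have "x \<in> N" if "y \<in> N" "x \<otimes> y \<in> N"
    using N_closed(1)[OF that(2) N_closed(2)[OF that(1)]] assms by (simp add: m_assoc)
  ultimately show ?thesis using outside_mult assms N_closed(1) by blast
qed

lemma inv_in_N_iff: "x \<in> carrier G \<Longrightarrow> inv x \<in> N \<longleftrightarrow> x \<in> N"
  using N_closed(2) by (metis inv_inv)

lemma conj_in_N:
  "x \<in> N \<Longrightarrow> g \<in> carrier G \<Longrightarrow> inv g \<otimes> x \<otimes> g \<in> N" "x \<in> N \<Longrightarrow> g \<in> carrier G \<Longrightarrow> g \<otimes> x \<otimes> inv g \<in> N"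
  by (simp_all add: mult_in_N_iff inv_in_N_iff N_sub)

lemma carrier_split: "(\<Sum>x\<in>carrier G. f x) = (\<Sum>x\<in>N. f x) + (\<Sum>x\<in>carrier G - N. f x)"
  for f :: "'a \<Rightarrow> complex"
proof -
  have "carrier G = N \<union> (carrier G - N)" using N_sub by auto
  then show ?thesis using sum.union_disjoint[of N "carrier G - N" f] finite_N finite_carrier by simp
qed

lemma card_carrier: "card (carrier G) = 2 * card N"
proof -
  have "bij_betw (\<lambda>x. \<sigma> \<otimes> x) N (carrier G - N)"
  proof (rule bij_betw_byWitness[of _ "\<lambda>x. inv \<sigma> \<otimes> x"])
    show "\<forall>a\<in>N. inv \<sigma> \<otimes> (\<sigma> \<otimes> a) = a" "\<forall>a'\<in>carrier G - N. \<sigma> \<otimes> (inv \<sigma> \<otimes> a') = a'"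
      using \<sigma> N_sub by (auto simp: m_assoc[symmetric])
  qed (use \<sigma> N_sub in \<open>auto simp: mult_in_N_iff inv_in_N_iff\<close>)
  then have "card (carrier G - N) = card N" by (simp add: bij_betw_same_card)
  moreover have "card (carrier G - N) = card (carrier G) - card N"
    using finite_N N_sub by (intro card_Diff_subset) auto
  moreover have "card N \<le> card (carrier G)"
    using finite_carrier N_sub by (intro card_mono) auto
  ultimately show ?thesis by simp
qed

lemma card_N_nonzero: "card N \<noteq> 0"
  using finite_N N_closed(3) by auto

lemma twist_Irr:
  assumes "\<psi> \<in> Irr H"
  shows "twist \<psi> \<in> Irr H"
proof -
  obtain d \<rho> where \<rho>: "\<psi> = cut (carrier H) (\<lambda>g. trace (\<rho> g))" "irreducible_rep H d \<rho>"
    using assms by (auto simp: Irr_def)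
  note r = irreducible_repE[OF group_H \<rho>(2), simplified]
  let ?c = "\<lambda>x. inv \<sigma> \<otimes> x \<otimes> \<sigma>"
  have "irreducible_rep H d (\<lambda>x. \<rho> (?c x))"
    unfolding irreducible_rep_def hom_GL_iff[OF group_H] vec_subspace_iff
  proof (intro conjI ballI allI impI)
    show "d > 0" by (rule r(1))
    show "\<rho> (?c g) \<in> carrier_mat d d" if "g \<in> carrier H" for g
      using that \<sigma>(1) by (simp add: r(2) conj_in_N)
    show "\<rho> (?c (g \<otimes>\<^bsub>H\<^esub> h)) = \<rho> (?c g) * \<rho> (?c h)" if "g \<in> carrier H" "h \<in> carrier H" for g h
    proof -
      have gh: "g \<in> N" "h \<in> N" using that by auto
      have "?c (g \<otimes> h) = ?c g \<otimes> ?c h"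
      proof -
        have "?c g \<otimes> ?c h = inv \<sigma> \<otimes> g \<otimes> (\<sigma> \<otimes> inv \<sigma>) \<otimes> h \<otimes> \<sigma>"
          using gh N_sub \<sigma>(1) by (simp only: m_assoc m_closed inv_closed)
        then show ?thesis using gh N_sub \<sigma>(1) by (simp add: m_assoc)
      qed
      then show ?thesis using gh \<sigma>(1) by (simp add: r(3) conj_in_N)
    qed
    show "\<rho> (?c \<one>\<^bsub>H\<^esub>) = 1\<^sub>m d" using \<sigma>(1) r(4) by simp
    fix W assume W: "(W \<subseteq> carrier_vec d \<and> 0\<^sub>v d \<in> W \<and> (\<forall>v\<in>W. \<forall>w\<in>W. v + w \<in> W) \<and> (\<forall>c. \<forall>v\<in>W. c \<cdot>\<^sub>v v \<in> W)) \<and>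
      (\<forall>g\<in>carrier H. \<forall>w\<in>W. \<rho> (?c g) *\<^sub>v w \<in> W)"
    \<comment> \<open>Conjugation by \<open>\<sigma>\<close> maps \<open>N\<close> onto
      \<open>N\<close>, with \<open>\<sigma> \<otimes> g \<otimes> inv \<sigma>\<close> as preimage
      of \<open>g\<close>, so a subspace invariant under the conjugated action is invariant under
      \<open>\<rho>\<close>.\<close>
    have "\<rho> g *\<^sub>v w \<in> W" if "g \<in> N" "w \<in> W" for g w
    proof -
      have "?c (\<sigma> \<otimes> g \<otimes> inv \<sigma>) = (inv \<sigma> \<otimes> \<sigma>) \<otimes> g \<otimes> (inv \<sigma> \<otimes> \<sigma>)"
        using that(1) N_sub \<sigma>(1) by (simp only: m_assoc m_closed inv_closed)
      then have "?c (\<sigma> \<otimes> g \<otimes> inv \<sigma>) = g" using that(1) N_sub \<sigma>(1) by simp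
      moreover have "\<rho> (?c (\<sigma> \<otimes> g \<otimes> inv \<sigma>)) *\<^sub>v w \<in> W"
        using W that conj_in_N(2)[OF that(1) \<sigma>(1)] by auto
      ultimately show ?thesis by simp
    qed
    then show "W = {0\<^sub>v d} \<or> W = carrier_vec d" using W by (intro r(5)) auto
  qed
  moreover have "twist \<psi> = cut (carrier H) (\<lambda>x. trace (\<rho> (?c x)))"
    using \<rho>(1) conj_in_N(1)[OF _ \<sigma>(1)] by (auto simp: twist_def cut_def)
  ultimately show ?thesis unfolding Irr_def by (auto intro!: exI[of _ d])
qed

text \<open>Twisting twice is conjugation by \<open>inv \<sigma> \<otimes> inv \<sigma>\<close>,
  which lies in \<open>N\<close>, and characters of \<open>N\<close> are constant on its
  classes.\<close>

lemma twist_twist: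
  assumes \<psi>: "\<psi> \<in> Irr H"
  shows "twist (twist \<psi>) = \<psi>"
proof
  fix x
  show "twist (twist \<psi>) x = \<psi> x"
  proof (cases "x \<in> N")
    case True
    let ?s = "inv \<sigma> \<otimes> inv \<sigma>"
    have s: "?s \<in> N" using \<sigma> by (simp add: mult_in_N_iff inv_in_N_iff)
    have "inv \<sigma> \<otimes> (inv \<sigma> \<otimes> x \<otimes> \<sigma>) \<otimes> \<sigma> = ?s \<otimes> x \<otimes> inv ?s"
      using \<sigma>(1) True N_sub by (simp add: m_assoc inv_mult_group)
    moreover have "\<psi> (?s \<otimes> x \<otimes> inv ?s) = \<psi> x"
      using Irr_conj[OF group_H \<psi>, of ?s x] s True subgroup m_inv_consistent[OF subgroup s] by simp
    ultimately show ?thesis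
      using True conj_in_N(1)[OF _ \<sigma>(1)] by (simp add: twist_def cut_def)
  next
    case False
    then show ?thesis using Irr_support[OF \<psi>] by (simp add: twist_def cut_def)
  qed
qed

lemma sgn_twist_Irr:
  assumes "\<phi> \<in> Irr G"
  shows "sgn_twist \<phi> \<in> Irr G"
proof -
  obtain d \<rho> where \<rho>: "\<phi> = cut (carrier G) (\<lambda>g. trace (\<rho> g))" "irreducible_rep G d \<rho>"
    using assms by (auto simp: Irr_def)
  note r = irreducible_repE[OF is_group \<rho>(2)]
  define e :: "'a \<Rightarrow> complex" where "e x = (if x \<in> N then 1 else -1)" for x
  have e: "e (x \<otimes> y) = e x * e y" if "x \<in> carrier G" "y \<in> carrier G" for x y
    using that by (simp add: e_def mult_in_N_iff)
  have ee: "e x * e x = 1" for x by (simp add: e_def)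
  have "irreducible_rep G d (\<lambda>x. e x \<cdot>\<^sub>m \<rho> x)"
    unfolding irreducible_rep_def hom_GL_iff[OF is_group] vec_subspace_iff
  proof (intro conjI ballI allI impI)
    show "d > 0" by (rule r(1))
    show "e g \<cdot>\<^sub>m \<rho> g \<in> carrier_mat d d" if "g \<in> carrier G" for g
      using that by (simp add: r(2))
    show "e (g \<otimes> h) \<cdot>\<^sub>m \<rho> (g \<otimes> h) = e g \<cdot>\<^sub>m \<rho> g * (e h \<cdot>\<^sub>m \<rho> h)" if "g \<in> carrier G" "h \<in> carrier G" for g h
      using that r(2)[OF that(1)] r(2)[OF that(2)]
      by (intro eq_matI) (auto simp: e r(3) mult_smult_distrib[of _ d d _ d] mult_smult_assoc_mat[of _ d d _ d])
    show "e \<one> \<cdot>\<^sub>m \<rho> \<one> = 1\<^sub>m d" using r(4) N_closed(3) by (auto simp: e_def)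
    fix W assume W: "(W \<subseteq> carrier_vec d \<and> 0\<^sub>v d \<in> W \<and> (\<forall>v\<in>W. \<forall>w\<in>W. v + w \<in> W) \<and> (\<forall>c. \<forall>v\<in>W. c \<cdot>\<^sub>v v \<in> W)) \<and>
      (\<forall>g\<in>carrier G. \<forall>w\<in>W. (e g \<cdot>\<^sub>m \<rho> g) *\<^sub>v w \<in> W)"
    have "\<rho> g *\<^sub>v w \<in> W" if "g \<in> carrier G" "w \<in> W" for g w
    proof -
      have w: "w \<in> carrier_vec d" using W that by blast
      have "e g \<cdot>\<^sub>v ((e g \<cdot>\<^sub>m \<rho> g) *\<^sub>v w) \<in> W" using W that by blast
      also have "(e g \<cdot>\<^sub>m \<rho> g) *\<^sub>v w = e g \<cdot>\<^sub>v (\<rho> g *\<^sub>v w)"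
        using r(2)[OF that(1)] w by (intro eq_vecI) auto
      finally show ?thesis by (simp add: smult_smult_assoc ee)
    qed
    then show "W = {0\<^sub>v d} \<or> W = carrier_vec d" using W by (intro r(5)) auto
  qed
  moreover have "trace (e x \<cdot>\<^sub>m \<rho> x) = e x * trace (\<rho> x)" if "x \<in> carrier G" for x
    using r(2)[OF that] by (simp add: trace_def sum_distrib_left)
  then have "sgn_twist \<phi> = cut (carrier G) (\<lambda>x. trace (e x \<cdot>\<^sub>m \<rho> x))"
    by (auto simp: \<rho>(1) sgn_twist_def cut_def e_def)
  ultimately show ?thesis unfolding Irr_def by (auto intro!: exI[of _ d])
qed

text \<open>The inner products of \<open>\<phi>\<close> with \<open>\<psi>\<close> and with
  \<open>sgn_twist \<psi>\<close> over \<open>G\<close> give the sum and the difference of the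
  contributions of \<open>N\<close> and of its complement; adding them isolates \<open>N\<close>. In
  particular, a restriction has norm 1 or 2.\<close>

lemma char_inner_restrict:
  assumes \<phi>: "\<phi> \<in> Irr G" and \<psi>: "\<psi> \<in> Irr G"
  shows "char_inner H (cut N \<phi>) (cut N \<psi>) = (if \<phi> = \<psi> then 1 else 0) + (if \<phi> = sgn_twist \<psi> then 1 else 0)"
proof -
  let ?f = "\<lambda>x. \<phi> x * cnj (\<psi> x)"
  let ?n = "of_nat (card N) :: complex"
  have G: "(\<Sum>x\<in>carrier G. \<phi> x * cnj (\<chi> x)) = (if \<phi> = \<chi> then 2 * ?n else 0)" if "\<chi> \<in> Irr G" for \<chi>
    using Irr_orthonormal[OF is_group finite_carrier \<phi> that] card_N_nonzero
    by (auto simp: char_inner_def card_carrier split: if_splits)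
  have "(\<Sum>x\<in>N. ?f x) + (\<Sum>x\<in>carrier G - N. ?f x) = (if \<phi> = \<psi> then 2 * ?n else 0)"
    using G[OF \<psi>] by (simp add: carrier_split)
  moreover have "(\<Sum>x\<in>N. ?f x) - (\<Sum>x\<in>carrier G - N. ?f x) = (if \<phi> = sgn_twist \<psi> then 2 * ?n else 0)"
    using G[OF sgn_twist_Irr[OF \<psi>]] by (simp add: carrier_split sgn_twist_def sum_negf)
  ultimately have "2 * (\<Sum>x\<in>N. ?f x) = (if \<phi> = \<psi> then 2 * ?n else 0) + (if \<phi> = sgn_twist \<psi> then 2 * ?n else 0)"
    by (simp add: algebra_simps split: if_splits)
  then have "(\<Sum>x\<in>N. ?f x) = (if \<phi> = \<psi> then ?n else 0) + (if \<phi> = sgn_twist \<psi> then ?n else 0)"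
    by (auto split: if_splits)
  moreover have "(\<Sum>x\<in>N. cut N \<phi> x * cnj (cut N \<psi> x)) = (\<Sum>x\<in>N. ?f x)"
    by (simp add: cut_def)
  ultimately show ?thesis
    using card_N_nonzero by (simp add: char_inner_def add_divide_distrib)
qed


text \<open>For a minimal \<open>N\<close>-invariant subspace \<open>W\<close>, both \<open>W \<inter> \<sigma>W\<close> and \<open>W + \<sigma>W\<close> are invariant, so either
  \<open>W\<close> is everything or the whole space is the direct sum of \<open>W\<close> and \<open>\<sigma>W\<close>.\<close>

lemma restriction_cases:
  assumes "\<phi> \<in> Irr G"
  obtains "cut N \<phi> \<in> Irr H"
    | \<psi> where "\<psi> \<in> Irr H" "cut N \<phi> = (\<lambda>x. \<psi> x + twist \<psi> x)"
proof -
  obtain d \<rho> where \<rho>: "\<phi> = cut (carrier G) (\<lambda>g. trace (\<rho> g))" "irreducible_rep G d \<rho>"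
    using assms by (auto simp: Irr_def)
  note r = irreducible_repE[OF is_group \<rho>(2)]
  define V where "V = vec_funs d"
  define R where "R g = mat_act d (\<rho> g)" for g
  have irr: "irreducible_fun_rep G V R"
    unfolding V_def R_def by (rule irreducible_rep_mat_act[OF is_group \<rho>(2)])
  have lin: "clinear (R g)" for g by (simp add: R_def clinear_mat_act)
  have RV: "R g v \<in> V" for g v by (simp add: R_def V_def mat_act_closed)
  have R_mult: "R (g \<otimes> h) v = R g (R h v)" if "g \<in> carrier G" "h \<in> carrier G" "v \<in> V" for g h v
    using irr that by (auto simp: irreducible_fun_rep_def fun_rep_def)
  have R_one: "R \<one> v = v" if "v \<in> V" for v
    using irr that by (auto simp: irreducible_fun_rep_def fun_rep_def)
  have sV: "cfun.subspace V" by (simp add: V_def subspace_vec_funs)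
  have H: "fun_rep H (vec_funs d) R"
    using irr N_sub by (simp add: irreducible_fun_rep_def fun_rep_def V_def)
  have tr: "basis_trace b (R g) = \<phi> g" if "g \<in> N" "finite b" "cfun.independent b" "cfun.span b = V" for g b
    using that basis_trace_mat_act[of "\<rho> g" d b] r(2) N_sub by (simp add: R_def V_def \<rho>(1) cut_def)
  have "invariant_subspace H (vec_funs d) R V" "V \<noteq> {0}"
    using irr sV RV by (auto simp: invariant_subspace_def V_def irreducible_fun_rep_def)
  then obtain W where WV: "W \<subseteq> V" and irrW: "irreducible_fun_rep H W R"
    using irreducible_subrep_exists[OF H] by metis
  have sW: "cfun.subspace W" and W0: "W \<noteq> {0}" and RW: "\<And>g w. g \<in> N \<Longrightarrow> w \<in> W \<Longrightarrow> R g w \<in> W"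
    using irrW by (auto simp: irreducible_fun_rep_def fun_rep_def)
  obtain b where b: "finite b" "cfun.independent b" "cfun.span b = W"
    using finite_basis_in_vec_funs[OF sW] WV by (auto simp: V_def)
  define \<psi> where "\<psi> = cut N (\<lambda>g. basis_trace b (R g))"
  have \<psi>: "\<psi> \<in> Irr H"
    using irreducible_fun_rep_char[OF group_H irrW b] by (simp add: \<psi>_def)
  define W' where "W' = R \<sigma> ` W"
  have R\<sigma>_inj: "x = y" if "R \<sigma> x = R \<sigma> y" "x \<in> V" "y \<in> V" for x y
  proof -
    have "x = R (inv \<sigma> \<otimes> \<sigma>) x" using \<sigma>(1) R_one that by simp
    also have "\<dots> = R (inv \<sigma> \<otimes> \<sigma>) y" using \<sigma>(1) that R_mult by (metis inv_closed)
    also have "\<dots> = y" using \<sigma>(1) R_one that by simp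
    finally show ?thesis .
  qed
  \<comment> \<open>Every element outside \<open>N\<close> is \<open>\<sigma>\<close> times an
    element of \<open>N\<close>, so it interchanges \<open>W\<close> and its translate
    \<open>W'\<close>.\<close>
  have out: "R g w \<in> W'" if "g \<in> carrier G" "g \<notin> N" "w \<in> W" for g w
  proof -
    have "inv \<sigma> \<otimes> g \<in> N" using that \<sigma> by (simp add: mult_in_N_iff inv_in_N_iff)
    moreover have "R g w = R \<sigma> (R (inv \<sigma> \<otimes> g) w)"
      using R_mult[of \<sigma> "inv \<sigma> \<otimes> g" w] \<sigma>(1) that WV by (auto simp: m_assoc[symmetric])
    ultimately show ?thesis using RW that(3) by (auto simp: W'_def)
  qed
  have out': "R g w \<in> W" if g: "g \<in> carrier G" "g \<notin> N" and w: "w \<in> W'" for g w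
  proof -
    obtain x where x: "x \<in> W" "w = R \<sigma> x" using w by (auto simp: W'_def)
    have "g \<otimes> \<sigma> \<in> N" using g \<sigma> by (simp add: mult_in_N_iff)
    then have "R (g \<otimes> \<sigma>) x \<in> W" using RW x(1) by blast
    moreover have "x \<in> V" using x(1) WV by blast
    ultimately show ?thesis using R_mult[OF g(1) \<sigma>(1)] x(2) by simp
  qed
  have in': "R g w \<in> W'" if g: "g \<in> N" and w: "w \<in> W'" for g w
  proof -
    obtain x where x: "x \<in> W" "w = R \<sigma> x" using w by (auto simp: W'_def)
    have "g \<otimes> \<sigma> \<in> carrier G" "g \<otimes> \<sigma> \<notin> N" using g \<sigma> N_sub by (simp_all add: mult_in_N_iff)
    then have "R (g \<otimes> \<sigma>) x \<in> W'" using out x(1) by blast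
    then show ?thesis using R_mult[of g \<sigma> x] x \<sigma>(1) N_sub[OF g] WV by auto
  qed
  have sW': "cfun.subspace W'" and W'V: "W' \<subseteq> V"
    using clinear_subspace_image[OF lin sW] RV by (auto simp: W'_def)
  have "invariant_subspace H W R (W \<inter> W')"
    using sW sW' RW in' by (auto simp: invariant_subspace_def cfun.subspace_inter)
  then have "W \<inter> W' = {0} \<or> W \<inter> W' = W" using irrW by (auto simp: irreducible_fun_rep_def)
  then show ?thesis
  proof
    assume "W \<inter> W' = W"
    \<comment> \<open>Here \<open>W \<subseteq> W'\<close>, and elements outside \<open>N\<close>
      take \<open>W'\<close> into \<open>W\<close>; thus \<open>W\<close> is invariant under all of
      \<open>G\<close>.\<close>
    then have "R g w \<in> W" if "g \<in> carrier G" "w \<in> W" for g w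
      using that RW out' by (cases "g \<in> N") blast+
    then have "invariant_subspace G V R W" using sW WV by (auto simp: invariant_subspace_def)
    then have "W = V" using irr W0 by (auto simp: irreducible_fun_rep_def)
    then have "\<psi> = cut N \<phi>" using tr b by (auto simp: \<psi>_def cut_def)
    then show ?thesis using \<psi> that(1) by simp
  next
    assume disj: "W \<inter> W' = {0}"
    define S where "S = {x + y | x y. x \<in> W \<and> y \<in> W'}"
    have sS: "cfun.subspace S" unfolding S_def by (rule cfun.subspace_sums[OF sW sW'])
    have "R g s \<in> S" if g: "g \<in> carrier G" and s: "s \<in> S" for g s
    proof -
      obtain x y where xy: "x \<in> W" "y \<in> W'" "s = x + y" using s by (auto simp: S_def)
      show ?thesis
      proof (cases "g \<in> N")
        case True
        then show ?thesis using RW[OF True xy(1)] in'[OF True xy(2)]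
          unfolding S_def xy(3) clinear_add[OF lin] by blast
      next
        case False
        have "R g x + R g y = R g y + R g x" by (rule add.commute)
        then show ?thesis using out[OF g False xy(1)] out'[OF g False xy(2)]
          unfolding S_def xy(3) clinear_add[OF lin] by blast
      qed
    qed
    moreover have WS: "W \<subseteq> S"
    proof
      fix x assume "x \<in> W"
      moreover have "x = x + 0" by simp
      ultimately show "x \<in> S" unfolding S_def using cfun.subspace_0[OF sW'] by blast
    qed
    moreover have "S \<subseteq> V" using cfun.subspace_add[OF sV] WV W'V by (auto simp: S_def)
    ultimately have "invariant_subspace G V R S" using sS by (auto simp: invariant_subspace_def)
    then have "S = {0} \<or> S = V" using irr by (auto simp: irreducible_fun_rep_def)
    moreover have "S \<noteq> {0}" using WS W0 cfun.subspace_0[OF sW] by blast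
    ultimately have SV: "S = V" by blast
    have bV: "v \<in> V" "v \<in> W" if "v \<in> b" for v using that b(3) WV cfun.span_base by blast+
    let ?b' = "R \<sigma> ` b"
    have inj: "inj_on (R \<sigma>) b" using R\<sigma>_inj bV by (auto intro: inj_onI)
    have spb': "cfun.span ?b' = W'" by (simp add: clinear_span_image[OF lin] b(3) W'_def)
    have indb': "cfun.independent ?b'"
    proof
      assume "cfun.dependent ?b'"
      then obtain u where u: "\<exists>v\<in>?b'. u v \<noteq> 0" "(\<Sum>v\<in>?b'. cscale (u v) v) = 0"
        using cfun.dependent_finite[of ?b'] b(1) by auto
      have "R \<sigma> (\<Sum>v\<in>b. cscale (u (R \<sigma> v)) v) = (\<Sum>v\<in>?b'. cscale (u v) v)"
        by (simp add: clinear_sum[OF lin] clinear_scale[OF lin] sum.reindex[OF inj])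
      also have "\<dots> = R \<sigma> 0" using u(2) clinear_zero[OF lin] by simp
      finally have "(\<Sum>v\<in>b. cscale (u (R \<sigma> v)) v) = 0"
        using R\<sigma>_inj bV sV by (auto intro!: cfun.subspace_sum cfun.subspace_scale cfun.subspace_0)
      then have "u (R \<sigma> v) = 0" if "v \<in> b" for v
        using cfun.independentD[OF b(2,1) subset_refl, of "\<lambda>v. u (R \<sigma> v)"] that by blast
      then show False using u(1) by auto
    qed
    have ind: "cfun.independent (b \<union> ?b')" "b \<inter> ?b' = {}"
      using independent_Un_if_disjoint_spans[OF b(1,2) _ indb'] b spb' disj by auto
    have span: "cfun.span (b \<union> ?b') = V"
      unfolding cfun.span_Un spb' b(3) using SV by (simp add: S_def)
    have "\<phi> g = \<psi> g + twist \<psi> g" if g: "g \<in> N" for g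
    proof -
      let ?g = "inv \<sigma> \<otimes> g \<otimes> \<sigma>"
      have g': "?g \<in> N" using conj_in_N(1)[OF g \<sigma>(1)] .
      \<comment> \<open>\<open>g\<close> acts on \<open>R \<sigma> v\<close> as
        \<open>inv \<sigma> \<otimes> g \<otimes> \<sigma>\<close> acts on \<open>v\<close>; this
        makes the trace on \<open>W'\<close> the twist of the trace on \<open>W\<close>.\<close>
      have comm: "R g (R \<sigma> v) = R \<sigma> (R ?g v)" if v: "v \<in> V" for v
      proof -
        have "R g (R \<sigma> v) = R (g \<otimes> \<sigma>) v" using R_mult[OF N_sub[OF g] \<sigma>(1) v] by simp
        also have "g \<otimes> \<sigma> = \<sigma> \<otimes> ?g" using g N_sub \<sigma>(1) by (simp add: m_assoc[symmetric])
        also have "R (\<sigma> \<otimes> ?g) v = R \<sigma> (R ?g v)" using R_mult[OF \<sigma>(1) N_sub[OF g'] v] .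
        finally show ?thesis .
      qed
      have "\<phi> g = (\<Sum>v\<in>b \<union> ?b'. cfun.representation (b \<union> ?b') (R g v) v)"
        using tr[OF g _ ind(1) span] b(1) by (simp add: basis_trace_def)
      also have "\<dots> = (\<Sum>v\<in>b. cfun.representation (b \<union> ?b') (R g v) v) +
          (\<Sum>v\<in>?b'. cfun.representation (b \<union> ?b') (R g v) v)"
        using b(1) ind(2) by (intro sum.union_disjoint) auto
      also have "(\<Sum>v\<in>b. cfun.representation (b \<union> ?b') (R g v) v) = \<psi> g"
        unfolding \<psi>_def cut_def basis_trace_def if_P[OF g]
      proof (intro sum.cong refl)
        fix v assume "v \<in> b"
        then have "R g v \<in> cfun.span b" using RW[OF g] bV(2) b(3) by simp
        then show "cfun.representation (b \<union> ?b') (R g v) v = cfun.representation b (R g v) v"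
          using cfun.representation_extend[OF ind(1)] by simp
      qed
      also have "(\<Sum>v\<in>?b'. cfun.representation (b \<union> ?b') (R g v) v) =
          (\<Sum>v\<in>b. cfun.representation ?b' (R \<sigma> (R ?g v)) (R \<sigma> v))"
        unfolding sum.reindex[OF inj] o_def
      proof (intro sum.cong refl)
        fix v assume v: "v \<in> b"
        have "R \<sigma> (R ?g v) \<in> cfun.span ?b'" using RW[OF g'] bV(2)[OF v] spb' by (auto simp: W'_def)
        then show "cfun.representation (b \<union> ?b') (R g (R \<sigma> v)) (R \<sigma> v) =
            cfun.representation ?b' (R \<sigma> (R ?g v)) (R \<sigma> v)"
          using cfun.representation_extend[OF ind(1)] comm[OF bV(1)[OF v]] by auto
      qed
      also have "\<dots> = (\<Sum>v\<in>b. cfun.representation b (R ?g v) v)"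
      proof (intro sum.cong refl)
        fix v assume v: "v \<in> b"
        have "cfun.representation ?b' (R \<sigma> (R ?g v)) (R \<sigma> v) =
            (\<Sum>w\<in>b. cfun.representation b (R ?g v) w * cfun.representation ?b' (R \<sigma> w) (R \<sigma> v))"
          using RW[OF g'] bV(2)[OF v] b(3)
          by (intro representation_image[OF indb' b(1,2) lin]) (auto intro: cfun.span_base)
        also have "\<dots> = (\<Sum>w\<in>b. if w = v then cfun.representation b (R ?g v) w else 0)"
          by (intro sum.cong refl)
            (use v inj in \<open>auto simp: cfun.representation_basis[OF indb'] inj_on_def\<close>)
        also have "\<dots> = cfun.representation b (R ?g v) v" using b(1) v by simp
        finally show "cfun.representation ?b' (R \<sigma> (R ?g v)) (R \<sigma> v) = cfun.representation b (R ?g v) v" .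
      qed
      also have "\<dots> = twist \<psi> g"
        using g g' by (simp add: twist_def \<psi>_def cut_def basis_trace_def)
      finally show ?thesis .
    qed
    then have "cut N \<phi> = (\<lambda>x. \<psi> x + twist \<psi> x)"
      by (auto simp: cut_def \<psi>_def twist_def)
    then show ?thesis using that(2) \<psi> by blast
  qed
qed

end

section \<open>Independence of characters and 2-basic sets as families\<close>

lemma char_inner_sum_right:
  "char_inner G \<phi> (\<lambda>x. \<Sum>i\<in>I. f i x) = (\<Sum>i\<in>I. char_inner G \<phi> (f i))"
proof -
  have "(\<Sum>g\<in>carrier G. \<phi> g * cnj (\<Sum>i\<in>I. f i g)) = (\<Sum>i\<in>I. \<Sum>g\<in>carrier G. \<phi> g * cnj (f i g))"
    by (simp add: sum_distrib_left) (rule sum.swap)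
  then show ?thesis by (simp add: char_inner_def sum_divide_distrib[where A = I])
qed

lemma Irr_one_nonzero:
  assumes "group G" "\<phi> \<in> Irr G"
  shows "\<phi> \<one>\<^bsub>G\<^esub> \<noteq> 0"
proof -
  obtain d \<rho> where \<rho>: "\<phi> = cut (carrier G) (\<lambda>g. trace (\<rho> g))" "irreducible_rep G d \<rho>"
    using assms(2) by (auto simp: Irr_def)
  then show ?thesis
    using irreducible_repE(1,4)[OF assms(1) \<rho>(2)] group.is_monoid[OF assms(1)]
    by (simp add: cut_def monoid.one_closed trace_def)
qed

text \<open>The point masses serve both as a basis of the functions on a finite set and, in the
  group algebra, as the group elements. The body is literally the factor that occurs in
  \<open>specht_char\<close>.\<close>

definition delta :: "'a \<Rightarrow> 'a \<Rightarrow> complex" where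
  "delta a = cut {a} (\<lambda>x. 1)"

lemma delta_apply: "delta a x = (if x = a then 1 else 0)"
  by (auto simp: delta_def cut_def)

lemma in_span_deltas:
  assumes "finite A" "\<And>x. x \<notin> A \<Longrightarrow> f x = 0"
  shows "f \<in> cfun.span (delta ` A)"
proof -
  have "f = (\<Sum>a\<in>A. cscale (f a) (delta a))"
  proof
    fix x
    have "(\<Sum>a\<in>A. cscale (f a) (delta a)) x = (\<Sum>a\<in>A. if x = a then f a else 0)"
      unfolding sum_fun_apply by (intro sum.cong) (auto simp: cscale_def delta_apply)
    then show "f x = (\<Sum>a\<in>A. cscale (f a) (delta a)) x"
      using assms by simp
  qed
  also have "\<dots> \<in> cfun.span (delta ` A)"
    by (intro cfun.span_sum cfun.span_scale cfun.span_base) auto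
  finally show ?thesis .
qed

lemma independent_Irr:
  assumes G: "group G" "finite (carrier G)"
  shows "cfun.independent (Irr G)"
  unfolding cfun.independent_explicit_module
proof (intro allI impI)
  fix t u v
  assume t: "finite t" "t \<subseteq> Irr G" "(\<Sum>\<chi>\<in>t. cscale (u \<chi>) \<chi>) = 0" and v: "v \<in> t"
  have "(\<lambda>x. \<Sum>\<chi>\<in>t. u \<chi> * \<chi> x) = (\<lambda>x. 0)"
  proof
    fix x
    show "(\<Sum>\<chi>\<in>t. u \<chi> * \<chi> x) = 0"
      using arg_cong[OF t(3), of "\<lambda>f. f x"] by (simp add: sum_fun_apply cscale_def)
  qed
  then have "char_inner G (\<lambda>x. \<Sum>\<chi>\<in>t. u \<chi> * \<chi> x) v = 0"
    by (simp add: char_inner_def)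
  then have "0 = (\<Sum>\<chi>\<in>t. u \<chi> * char_inner G \<chi> v)"
    by (simp add: char_inner_sum_left)
  also have "\<dots> = (\<Sum>\<chi>\<in>t. if \<chi> = v then u \<chi> else 0)"
    by (intro sum.cong refl) (use t(2) v in \<open>auto simp: Irr_orthonormal[OF G] subset_iff\<close>)
  also have "\<dots> = u v" using t(1) v by simp
  finally show "u v = 0" by simp
qed

text \<open>The irreducible characters are an independent set in the span of the finitely many point
  masses on the group.\<close>

lemma finite_Irr:
  assumes G: "group G" "finite (carrier G)"
  shows "finite (Irr G)"
proof -
  have "\<chi> \<in> cfun.span (delta ` carrier G)" if "\<chi> \<in> Irr G" for \<chi>
    by (rule in_span_deltas[OF G(2)]) (rule Irr_support[OF that])
  then have "Irr G \<subseteq> cfun.span (delta ` carrier G)" by blast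
  then show ?thesis
    using cfun.independent_span_bound[OF finite_imageI[OF G(2)] independent_Irr[OF G]] by blast
qed

text \<open>A collision \<open>f a = f b\<close> is itself a relation, with coefficients 1 and -1.
  Injectivity together with independence of the image is therefore independence of the family, the
  form in which relations are handled below.\<close>

lemma zfun_family_independent_iff:
  assumes "finite B"
  shows "inj_on f B \<and> zfun.independent (f ` B) \<longleftrightarrow>
    (\<forall>u. (\<Sum>b\<in>B. zscale (u b) (f b)) = 0 \<longrightarrow> (\<forall>b\<in>B. u b = 0))"
proof (intro iffI conjI allI impI ballI)
  fix u b assume *: "inj_on f B \<and> zfun.independent (f ` B)" "(\<Sum>b\<in>B. zscale (u b) (f b)) = 0" "b \<in> B"
  let ?v = "\<lambda>y. u (inv_into B f y)"
  have "(\<Sum>y\<in>f ` B. zscale (?v y) y) = (\<Sum>b\<in>B. zscale (u b) (f b))"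
    using * by (subst sum.reindex) auto
  then have "?v (f b) = 0"
    using zfun.independentD[of "f ` B" "f ` B" ?v "f b"] * assms by auto
  then show "u b = 0" using * by simp
next
  assume *: "\<forall>u. (\<Sum>b\<in>B. zscale (u b) (f b)) = 0 \<longrightarrow> (\<forall>b\<in>B. u b = 0)"
  show "inj_on f B"
  proof (rule inj_onI, rule ccontr)
    fix a b assume ab: "a \<in> B" "b \<in> B" "f a = f b" "a \<noteq> b"
    define u :: "'a \<Rightarrow> int" where "u c = (if c = a then 1 else if c = b then -1 else 0)" for c
    have "(\<Sum>c\<in>B. zscale (u c) (f c)) = (\<Sum>c\<in>{a, b}. zscale (u c) (f c))"
      by (rule sum.mono_neutral_right) (use assms ab in \<open>auto simp: u_def zscale_def\<close>)
    also have "\<dots> = 0" using ab by (auto simp: u_def zscale_def fun_eq_iff)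
    finally have "u a = 0" using * ab(1) by blast
    then show False by (simp add: u_def)
  qed
  show "zfun.independent (f ` B)"
  proof
    assume "zfun.dependent (f ` B)"
    then obtain u where u: "\<exists>v\<in>f ` B. u v \<noteq> 0" "(\<Sum>v\<in>f ` B. zscale (u v) v) = 0"
      using zfun.dependent_finite[OF finite_imageI[OF assms]] by blast
    have "(\<Sum>b\<in>B. zscale (u (f b)) (f b)) = 0"
      using u(2) by (simp add: sum.reindex[OF \<open>inj_on f B\<close>])
    then have "\<forall>b\<in>B. u (f b) = 0" by (rule *[rule_format, THEN ballI])
    then show False using u(1) by blast
  qed
qed

lemma two_basic_set_iff:
  assumes "group G" "finite (carrier G)"
  shows "two_basic_set G B \<longleftrightarrow> B \<subseteq> Irr G \<and>
    (\<forall>u :: _ \<Rightarrow> int. (\<forall>x\<in>two_regular G. (\<Sum>\<chi>\<in>B. of_int (u \<chi>) * \<chi> x) = 0) \<longrightarrow> (\<forall>\<chi>\<in>B. u \<chi> = 0)) \<and>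
    (\<forall>\<phi>\<in>Irr G. cut (two_regular G) \<phi> \<in> zfun.span (cut (two_regular G) ` B))"
proof (cases "B \<subseteq> Irr G")
  case True
  then have fin: "finite B" using finite_Irr[OF assms] finite_subset by blast
  have "(\<Sum>\<chi>\<in>B. zscale (u \<chi>) (cut (two_regular G) \<chi>)) =
      cut (two_regular G) (\<lambda>x. \<Sum>\<chi>\<in>B. of_int (u \<chi>) * \<chi> x)" for u :: "_ \<Rightarrow> int"
    by (rule ext) (simp add: sum_fun_apply zscale_def cut_def)
  then have "(\<Sum>\<chi>\<in>B. zscale (u \<chi>) (cut (two_regular G) \<chi>)) = 0 \<longleftrightarrow>
      (\<forall>x\<in>two_regular G. (\<Sum>\<chi>\<in>B. of_int (u \<chi>) * \<chi> x) = 0)" for u :: "_ \<Rightarrow> int"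
    by (auto simp: fun_eq_iff cut_def)
  moreover have "zfun.span (cut (two_regular G) ` B) = zfun.span (cut (two_regular G) ` Irr G) \<longleftrightarrow>
      (\<forall>\<phi>\<in>Irr G. cut (two_regular G) \<phi> \<in> zfun.span (cut (two_regular G) ` B))"
    using True by (auto simp: zfun.span_eq intro: zfun.span_base)
  ultimately show ?thesis
    unfolding two_basic_set_def conj_assoc[symmetric]
    using zfun_family_independent_iff[OF fin, of "cut (two_regular G)"] True by simp
qed (simp add: two_basic_set_def)

section \<open>Constituents of restrictions and the transfer of 2-basic sets\<close>

context index_two_subgroup
begin

abbreviation constituents :: "('a \<Rightarrow> complex) \<Rightarrow> ('a \<Rightarrow> complex) set" where
  "constituents \<phi> \<equiv> irr_constituents H (cut N \<phi>)"

lemma Irr_H_orthonormal: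
  "\<phi> \<in> Irr H \<Longrightarrow> \<psi> \<in> Irr H \<Longrightarrow> char_inner H \<phi> \<psi> = (if \<phi> = \<psi> then 1 else 0)"
  using Irr_orthonormal[OF group_H] finite_N by simp

lemma twist_cut:
  assumes "\<phi> \<in> Irr G"
  shows "twist (cut N \<phi>) = cut N \<phi>"
  using Irr_conj[OF is_group assms, of "inv \<sigma>"] \<sigma>(1) conj_in_N(1)[OF _ \<sigma>(1)] N_sub
  by (auto simp: twist_def cut_def)

lemma constituents_if_sum:
  assumes "C \<subseteq> Irr H" "finite C" "cut N \<phi> = (\<lambda>x. \<Sum>\<psi>\<in>C. \<psi> x)"
  shows "constituents \<phi> = C"
proof -
  have "char_inner H (cut N \<phi>) \<psi> = (if \<psi> \<in> C then 1 else 0)" if "\<psi> \<in> Irr H" for \<psi>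
  proof -
    have "char_inner H (cut N \<phi>) \<psi> = (\<Sum>\<chi>\<in>C. char_inner H \<chi> \<psi>)"
      using char_inner_sum_left[where G = H and I = C and c = "\<lambda>_. 1" and f = "\<lambda>\<chi>. \<chi>"] by (simp add: assms(3))
    also have "\<dots> = (\<Sum>\<chi>\<in>C. if \<chi> = \<psi> then 1 else 0)"
      by (intro sum.cong refl) (use assms(1) that Irr_H_orthonormal in auto)
    finally show ?thesis using assms(2) by simp
  qed
  then show ?thesis using assms(1) by (auto simp: irr_constituents_def split: if_splits)
qed

text \<open>Both cases of Clifford theory have the form \<open>{\<psi>, twist \<psi>}\<close>: an
  irreducible restriction is its own twist and the set collapses. In the reducible case norms
  decide: equal summands would give norm 4, which \<open>char_inner_restrict\<close> rules out, and
  distinct ones give norm 2, which forces \<open>sgn_twist \<phi> = \<phi>\<close>.\<close>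

lemma constituents_cases:
  assumes "\<phi> \<in> Irr G"
  obtains \<psi> where "\<psi> \<in> Irr H" "constituents \<phi> = {\<psi>, twist \<psi>}" "cut N \<phi> = (\<lambda>x. \<Sum>\<chi>\<in>{\<psi>, twist \<psi>}. \<chi> x)"
    "sgn_twist \<phi> \<noteq> \<phi> \<Longrightarrow> constituents \<phi> = {cut N \<phi>}"
proof (rule restriction_cases[OF assms])
  assume \<phi>: "cut N \<phi> \<in> Irr H"
  have "constituents \<phi> = {cut N \<phi>}"
    by (rule constituents_if_sum) (use \<phi> in auto)
  then show ?thesis using that[of "cut N \<phi>"] \<phi> twist_cut[OF assms] by simp
next
  fix \<psi> assume \<psi>: "\<psi> \<in> Irr H" "cut N \<phi> = (\<lambda>x. \<psi> x + twist \<psi> x)"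
  have neq: "twist \<psi> \<noteq> \<psi>"
  proof
    assume "twist \<psi> = \<psi>"
    \<comment> \<open>Two forms of the same function: \<open>char_inner_sum_left\<close> carries
      coefficients, so the factor 2 fits there, while \<open>char_inner_sum_right\<close> takes
      plain sums.\<close>
    then have eq: "cut N \<phi> = (\<lambda>x. \<Sum>\<chi>\<in>{\<psi>}. 2 * \<chi> x)" "cut N \<phi> = (\<lambda>x. \<Sum>i\<in>{..<2::nat}. \<psi> x)" using \<psi>(2) by auto
    have "char_inner H (cut N \<phi>) (cut N \<phi>) = (\<Sum>i\<in>{..<2::nat}. char_inner H (cut N \<phi>) \<psi>)"
      unfolding eq(2) by (rule char_inner_sum_right)
    also have "char_inner H (cut N \<phi>) \<psi> = 2"
      unfolding eq(1) char_inner_sum_left using \<psi>(1) by (simp add: Irr_H_orthonormal)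
    finally have "char_inner H (cut N \<phi>) (cut N \<phi>) = 4" by simp
    then show False unfolding char_inner_restrict[OF assms assms] by (simp split: if_splits)
  qed
  have sum: "cut N \<phi> = (\<lambda>x. \<Sum>\<chi>\<in>{\<psi>, twist \<psi>}. \<chi> x)" using \<psi>(2) neq by auto
  have C: "constituents \<phi> = {\<psi>, twist \<psi>}"
    by (rule constituents_if_sum) (use \<psi> sum twist_Irr in auto)
  have "char_inner H (cut N \<phi>) (cut N \<phi>) = (\<Sum>\<chi>\<in>{\<psi>, twist \<psi>}. char_inner H (cut N \<phi>) \<chi>)"
    unfolding sum by (rule char_inner_sum_right)
  also have "\<dots> = (\<Sum>\<chi>\<in>{\<psi>, twist \<psi>}. \<Sum>\<chi>'\<in>{\<psi>, twist \<psi>}. char_inner H \<chi>' \<chi>)"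
    unfolding sum using char_inner_sum_left[where G = H and I = "{\<psi>, twist \<psi>}" and c = "\<lambda>_. 1" and f = "\<lambda>\<chi>. \<chi>"] by simp
  also have "\<dots> = 2" using neq \<psi>(1) twist_Irr[OF \<psi>(1)] by (simp add: Irr_H_orthonormal)
  finally have "sgn_twist \<phi> = \<phi>"
    unfolding char_inner_restrict[OF assms assms] by (simp split: if_splits)
  then show ?thesis using that[OF \<psi>(1) C sum] by simp
qed

lemma sum_constituents:
  assumes "\<phi> \<in> Irr G"
  shows "cut N \<phi> = (\<lambda>x. \<Sum>\<psi>\<in>constituents \<phi>. \<psi> x)" "finite (constituents \<phi>)"
    "constituents \<phi> \<subseteq> Irr H"
  using constituents_cases[OF assms] twist_Irr by (metis, metis finite.emptyI finite.insertI)
    (auto simp: irr_constituents_def)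

lemma restriction_apply:
  assumes "\<phi> \<in> Irr G" "x \<in> N"
  shows "\<phi> x = (\<Sum>\<psi>\<in>constituents \<phi>. \<psi> x)"
proof -
  have "\<phi> x = cut N \<phi> x" using assms(2) by (simp add: cut_def)
  also have "\<dots> = (\<Sum>\<psi>\<in>constituents \<phi>. \<psi> x)" by (rule fun_cong[OF sum_constituents(1)[OF assms(1)]])
  finally show ?thesis .
qed

lemma twist_in_constituents:
  assumes "\<phi> \<in> Irr G" "\<psi> \<in> constituents \<phi>"
  shows "twist \<psi> \<in> constituents \<phi>"
  by (rule constituents_cases[OF assms(1)]) (use assms(2) twist_twist in auto)

lemma constituents_transitive:
  assumes "\<phi> \<in> Irr G" "\<psi> \<in> constituents \<phi>" "\<psi>' \<in> constituents \<phi>"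
  shows "\<psi>' = \<psi> \<or> \<psi>' = twist \<psi>"
  by (rule constituents_cases[OF assms(1)]) (use assms(2,3) twist_twist in auto)

text \<open>Restrictions are multiplicity-free, so their inner product counts the common
  constituents; \<open>char_inner_restrict\<close> tells when this number is nonzero.\<close>

lemma common_constituent:
  assumes \<phi>: "\<phi> \<in> Irr G" "\<phi>' \<in> Irr G" and \<psi>: "\<psi> \<in> constituents \<phi>" "\<psi> \<in> constituents \<phi>'"
  shows "\<phi> = \<phi>' \<or> \<phi> = sgn_twist \<phi>'"
proof -
  note s = sum_constituents[OF \<phi>(1)] and s' = sum_constituents[OF \<phi>(2)]
  have "char_inner H (cut N \<phi>) (cut N \<phi>') = (\<Sum>\<chi>\<in>constituents \<phi>'. char_inner H (cut N \<phi>) \<chi>)"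
    by (subst s'(1)) (rule char_inner_sum_right)
  also have "\<dots> = (\<Sum>\<chi>\<in>constituents \<phi>'. \<Sum>\<chi>'\<in>constituents \<phi>. char_inner H \<chi>' \<chi>)"
    by (subst s(1)) (use char_inner_sum_left[where G = H and I = "constituents \<phi>" and c = "\<lambda>_. 1" and f = "\<lambda>\<chi>. \<chi>"] in simp)
  also have "\<dots> = (\<Sum>\<chi>\<in>constituents \<phi>'. if \<chi> \<in> constituents \<phi> then 1 else 0)"
  proof (intro sum.cong refl)
    fix \<chi> assume "\<chi> \<in> constituents \<phi>'"
    then have "(\<Sum>\<chi>'\<in>constituents \<phi>. char_inner H \<chi>' \<chi>) = (\<Sum>\<chi>'\<in>constituents \<phi>. if \<chi>' = \<chi> then 1 else 0)"
      using s(3) s'(3) by (intro sum.cong refl) (auto simp: Irr_H_orthonormal subset_iff)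
    then show "(\<Sum>\<chi>'\<in>constituents \<phi>. char_inner H \<chi>' \<chi>) = (if \<chi> \<in> constituents \<phi> then 1 else 0)"
      using s(2) by simp
  qed
  also have "\<dots> = of_nat (card (constituents \<phi>' \<inter> constituents \<phi>))"
    using s'(2) by (simp add: sum.If_cases Int_def)
  also have "\<dots> \<noteq> 0" using s(2) \<psi> by auto
  finally show ?thesis using char_inner_restrict[OF \<phi>] by (auto split: if_splits)
qed

text \<open>\<open>g\<close> is \<open>(g \<otimes> \<sigma>) \<otimes> inv \<sigma>\<close> with
  the first factor in \<open>N\<close>, so the twist does not depend on the choice of
  \<open>\<sigma>\<close>. This allows an odd element centralizing \<open>x\<close> to take its
  place.\<close>

lemma twist_eq_conj:
  assumes \<psi>: "\<psi> \<in> Irr H" and g: "g \<in> carrier G" "g \<notin> N" and x: "x \<in> N"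
  shows "\<psi> (g \<otimes> x \<otimes> inv g) = twist \<psi> x"
proof -
  have n: "g \<otimes> \<sigma> \<in> N" using g \<sigma> by (simp add: mult_in_N_iff)
  have "g \<otimes> x \<otimes> inv g = (g \<otimes> \<sigma>) \<otimes> (inv \<sigma> \<otimes> x \<otimes> \<sigma>) \<otimes> inv (g \<otimes> \<sigma>)"
  proof -
    have "(g \<otimes> \<sigma>) \<otimes> (inv \<sigma> \<otimes> x \<otimes> \<sigma>) \<otimes> inv (g \<otimes> \<sigma>) = g \<otimes> (\<sigma> \<otimes> inv \<sigma>) \<otimes> x \<otimes> (\<sigma> \<otimes> inv \<sigma>) \<otimes> inv g"
      using g(1) \<sigma>(1) N_sub[OF x] by (simp only: m_assoc m_closed inv_closed inv_mult_group)
    then show ?thesis using g(1) \<sigma>(1) N_sub[OF x] by simp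
  qed
  then have "\<psi> (g \<otimes> x \<otimes> inv g) = \<psi> (inv \<sigma> \<otimes> x \<otimes> \<sigma>)"
    using Irr_conj[OF group_H \<psi>, of "g \<otimes> \<sigma>" "inv \<sigma> \<otimes> x \<otimes> \<sigma>"] n conj_in_N(1)[OF x \<sigma>(1)]
      m_inv_consistent[OF subgroup n] by simp
  then show ?thesis using x by (simp add: twist_def cut_def)
qed

lemma Irr_H_conj:
  assumes \<psi>: "\<psi> \<in> Irr H" and g: "g \<in> N" and x: "x \<in> N"
  shows "\<psi> (g \<otimes> x \<otimes> inv g) = \<psi> x"
  using Irr_conj[OF group_H \<psi>, of g x] g x m_inv_consistent[OF subgroup g] by simp

text \<open>If \<open>\<psi>\<close> occurred in no restriction, neither would its twist, and the
  class function \<open>f\<close> would be orthogonal to all of \<open>Irr G\<close>; by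
  \<open>complete\<close> it would vanish at the identity, where its value is
  \<open>2 * \<psi> \<one>\<close>.\<close>

lemma constituent_of_restriction_exists:
  assumes complete: "\<forall>f. (\<forall>g\<in>carrier G. \<forall>x\<in>carrier G. f (g \<otimes> x \<otimes> inv g) = f x) \<longrightarrow>
      (\<forall>\<phi>\<in>Irr G. char_inner G f \<phi> = 0) \<longrightarrow> f \<one> = 0"
    and \<psi>: "\<psi> \<in> Irr H"
  obtains \<phi> where "\<phi> \<in> Irr G" "\<psi> \<in> constituents \<phi>"
proof (rule ccontr)
  assume "\<not> thesis"
  then have no: "\<psi> \<notin> constituents \<phi>" if "\<phi> \<in> Irr G" for \<phi> using that \<open>\<And>\<phi>. \<phi> \<in> Irr G \<Longrightarrow> \<psi> \<in> constituents \<phi> \<Longrightarrow> thesis\<close> by blast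
  note t\<psi> = twist_Irr[OF \<psi>]
  \<comment> \<open>This is the character induced from \<open>\<psi>\<close> to
    \<open>G\<close>.\<close>
  define f where "f = cut N (\<lambda>x. \<psi> x + twist \<psi> x)"
  have "f \<one> = 0"
  proof (rule complete[THEN spec, THEN mp, THEN mp]; intro ballI)
    fix g x assume g: "g \<in> carrier G" and x: "x \<in> carrier G"
    show "f (g \<otimes> x \<otimes> inv g) = f x"
    proof (cases "x \<in> N")
      case True
      then show ?thesis
        using conj_in_N(2)[OF True g] twist_eq_conj[OF \<psi> g _ True] twist_eq_conj[OF t\<psi> g _ True]
          Irr_H_conj[OF \<psi> _ True] Irr_H_conj[OF t\<psi> _ True]
        by (cases "g \<in> N") (simp_all add: f_def cut_def twist_twist[OF \<psi>])
    next
      case False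
      then show ?thesis using g x by (simp add: f_def cut_def mult_in_N_iff inv_in_N_iff)
    qed
  next
    fix \<phi> assume \<phi>: "\<phi> \<in> Irr G"
    have no': "char_inner H (cut N \<phi>) \<psi> = 0" "char_inner H (cut N \<phi>) (twist \<psi>) = 0"
      using no[OF \<phi>] twist_in_constituents[OF \<phi>, of "twist \<psi>"] \<psi> t\<psi> twist_twist[OF \<psi>]
      by (auto simp: irr_constituents_def)
    have eq: "(\<Sum>x\<in>N. \<chi> x * cnj (\<phi> x)) = 0" if "char_inner H (cut N \<phi>) \<chi> = 0" for \<chi>
    proof -
      have "(\<Sum>x\<in>N. cut N \<phi> x * cnj (\<chi> x)) = 0"
        using that card_N_nonzero by (simp add: char_inner_def)
      then have "cnj (\<Sum>x\<in>N. cut N \<phi> x * cnj (\<chi> x)) = 0" by simp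
      then show ?thesis by (simp add: cut_def mult.commute)
    qed
    have "(\<Sum>x\<in>carrier G. f x * cnj (\<phi> x)) = (\<Sum>x\<in>N. (\<psi> x + twist \<psi> x) * cnj (\<phi> x))"
      by (simp add: carrier_split f_def cut_def)
    also have "\<dots> = 0" using eq no' by (simp add: distrib_right sum.distrib)
    finally show "char_inner G f \<phi> = 0" by (simp add: char_inner_def)
  qed
  then have "2 * \<psi> \<one> = 0"
    using N_closed(3) \<sigma>(1) by (simp add: f_def cut_def twist_def)
  then show False using Irr_one_nonzero[OF group_H \<psi>] by simp
qed

lemma two_regular_H:
  assumes "\<And>x. x \<in> two_regular G \<Longrightarrow> x \<in> N"
  shows "two_regular H = two_regular G"
proof -
  have "group.ord H x = ord x" if "x \<in> N" for x
    unfolding group.ord_def[OF group_H] ord_def nat_pow_consistent[of x _ N, symmetric] by simp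
  then have "two_regular H = {x \<in> N. odd (ord x)}" by (auto simp: two_regular_def)
  then show ?thesis using assms N_sub unfolding two_regular_def by blast
qed

lemma two_regular_conj:
  assumes "x \<in> two_regular G" "g \<in> carrier G"
  shows "inv g \<otimes> x \<otimes> g \<in> two_regular G"
proof -
  have x: "x \<in> carrier G" using assms by (simp add: two_regular_def)
  have pow: "(inv g \<otimes> x \<otimes> g) [^] n = inv g \<otimes> x [^] n \<otimes> g" for n :: nat
  proof (induction n)
    case (Suc n)
    have "(inv g \<otimes> x \<otimes> g) [^] Suc n = inv g \<otimes> x [^] n \<otimes> (g \<otimes> inv g) \<otimes> x \<otimes> g"
      using Suc x assms(2) by (simp only: nat_pow_Suc m_assoc m_closed inv_closed nat_pow_closed)
    then show ?case using x assms(2) by (simp add: m_assoc)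
  qed (use assms(2) in simp)
  have "inv g \<otimes> y \<otimes> g = \<one> \<longleftrightarrow> y = \<one>" if "y \<in> carrier G" for y
  proof
    assume "inv g \<otimes> y \<otimes> g = \<one>"
    then have "g \<otimes> (inv g \<otimes> y \<otimes> g) \<otimes> inv g = \<one>" using assms(2) by simp
    moreover have "g \<otimes> (inv g \<otimes> y \<otimes> g) \<otimes> inv g = (g \<otimes> inv g) \<otimes> y \<otimes> (g \<otimes> inv g)"
      using that assms(2) by (simp only: m_assoc m_closed inv_closed)
    ultimately show "y = \<one>" using that assms(2) by simp
  qed (use assms(2) in simp)
  then have "ord (inv g \<otimes> x \<otimes> g) = ord x"
    unfolding ord_def pow using x by simp
  then show ?thesis using assms x by (simp add: two_regular_def)
qed

text \<open>The input from the symmetric group is isolated in the hypotheses: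
  \<open>complete\<close> reaches every irreducible character of \<open>H\<close> from above,
  \<open>reg_in\<close> keeps all 2-regular elements inside \<open>N\<close>, and
  \<open>centralizer\<close> settles the values at the remaining elements of
  \<open>N\<close>.\<close>

theorem restriction_two_basic_set:
  assumes complete: "\<forall>f. (\<forall>g\<in>carrier G. \<forall>x\<in>carrier G. f (g \<otimes> x \<otimes> inv g) = f x) \<longrightarrow>
      (\<forall>\<phi>\<in>Irr G. char_inner G f \<phi> = 0) \<longrightarrow> f \<one> = 0"
    and reg_in: "\<And>x. x \<in> two_regular G \<Longrightarrow> x \<in> N"
    and centralizer: "\<And>x. x \<in> N \<Longrightarrow> x \<notin> two_regular G \<Longrightarrow> \<exists>g\<in>carrier G - N. g \<otimes> x = x \<otimes> g"
    and B: "two_basic_set G B"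
    and self: "\<And>\<phi>. \<phi> \<in> Irr G \<Longrightarrow> sgn_twist \<phi> = \<phi> \<Longrightarrow> \<phi> \<in> B"
  shows "two_basic_set H (restriction_set H B)"
proof -
  define P where "P = two_regular G"
  have P: "two_regular H = P" using two_regular_H[OF reg_in] by (simp add: P_def)
  have PN: "x \<in> N" if "x \<in> P" for x using that reg_in by (simp add: P_def)
  note iffG = two_basic_set_iff[OF is_group finite_carrier, folded P_def]
  have BI: "B \<subseteq> Irr G" and
    Bind: "\<And>u :: _ \<Rightarrow> int. (\<And>x. x \<in> P \<Longrightarrow> (\<Sum>\<chi>\<in>B. of_int (u \<chi>) * \<chi> x) = 0) \<Longrightarrow> \<forall>\<chi>\<in>B. u \<chi> = 0" and
    Bspan: "\<And>\<phi>. \<phi> \<in> Irr G \<Longrightarrow> cut P \<phi> \<in> zfun.span (cut P ` B)"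
    using B unfolding iffG by blast+
  have Bfin: "finite B" using BI finite_Irr[OF is_group finite_carrier] finite_subset by blast
  have Binj: "\<phi> = \<phi>'" if "\<phi> \<in> B" "\<phi>' \<in> B" "cut P \<phi> = cut P \<phi>'" for \<phi> \<phi>'
    using B that by (auto simp: two_basic_set_def P_def inj_on_def)
  define D where "D = restriction_set H B"
  have D: "D = (\<Union>\<phi>\<in>B. constituents \<phi>)" by (simp add: D_def restriction_set_def)
  have DI: "D \<subseteq> Irr H" unfolding D using sum_constituents(3) BI by blast
  have Dfin: "finite D" unfolding D using Bfin BI sum_constituents(2) by blast
  have Dtw: "twist \<psi> \<in> D" if "\<psi> \<in> D" for \<psi> using that twist_in_constituents BI unfolding D by blast
  have cut_restrict: "cut P \<phi> = (\<Sum>\<psi>\<in>constituents \<phi>. cut P \<psi>)" if "\<phi> \<in> Irr G" for \<phi>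
  proof
    fix x
    show "cut P \<phi> x = (\<Sum>\<psi>\<in>constituents \<phi>. cut P \<psi>) x"
      using restriction_apply[OF that, of x] PN unfolding sum_fun_apply cut_def[of P] by auto
  qed
  have B_in: "cut P \<phi> \<in> zfun.span (cut P ` D)" if "\<phi> \<in> B" for \<phi>
  proof -
    have "\<phi> \<in> Irr G" using that BI by blast
    show ?thesis
      unfolding cut_restrict[OF \<open>\<phi> \<in> Irr G\<close>]
      by (intro zfun.span_sum zfun.span_base imageI) (use that D in auto)
  qed
  have span: "cut P \<psi> \<in> zfun.span (cut P ` D)" if \<psi>: "\<psi> \<in> Irr H" for \<psi>
  proof -
    obtain \<phi> where \<phi>: "\<phi> \<in> Irr G" "\<psi> \<in> constituents \<phi>"
      using constituent_of_restriction_exists[OF complete \<psi>] by blast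
    show ?thesis
    proof (cases "sgn_twist \<phi> = \<phi>")
      case True
      then have "\<psi> \<in> D" using self[OF \<phi>(1) True] \<phi>(2) D by blast
      then show ?thesis by (intro zfun.span_base imageI)
    next
      case False
      then have "constituents \<phi> = {cut N \<phi>}" using constituents_cases[OF \<phi>(1)] by metis
      then have "cut P \<psi> = cut P \<phi>" using \<phi>(2) PN by (auto simp: cut_def)
      also have "\<dots> \<in> zfun.span (cut P ` B)" by (rule Bspan[OF \<phi>(1)])
      also have "\<dots> \<subseteq> zfun.span (cut P ` D)"
        by (rule zfun.span_minimal) (use B_in zfun.subspace_span in auto)
      finally show ?thesis .
    qed
  qed
  \<comment> \<open>\<open>\<phi>\<close> and \<open>sgn_twist \<phi>'\<close> are compared on
    \<open>P\<close>, which lies in \<open>N\<close>, where the sign is trivial; injectivity of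
    \<open>cut P\<close> on \<open>B\<close> then gives the contradiction.\<close>
  have disj: "constituents \<phi> \<inter> constituents \<phi>' = {}" if \<phi>: "\<phi> \<in> B" "\<phi>' \<in> B" "\<phi> \<noteq> \<phi>'" for \<phi> \<phi>'
  proof (rule ccontr)
    assume "constituents \<phi> \<inter> constituents \<phi>' \<noteq> {}"
    then have "\<phi> = sgn_twist \<phi>'" using common_constituent[of \<phi> \<phi>'] \<phi> BI by blast
    then have "cut P \<phi> = cut P \<phi>'" using PN by (auto simp: cut_def sgn_twist_def)
    then show False using Binj \<phi> by blast
  qed
  have ind: "\<forall>\<psi>\<in>D. u \<psi> = 0"
    if u: "\<And>x. x \<in> P \<Longrightarrow> (\<Sum>\<psi>\<in>D. of_int (u \<psi>) * \<psi> x) = 0" for u :: "('a \<Rightarrow> complex) \<Rightarrow> int"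
  proof -
    define f where "f x = (\<Sum>\<psi>\<in>D. of_int (u \<psi>) * \<psi> x)" for x
    \<comment> \<open>The coefficients of \<open>f\<close> plus its twist. They are invariant under
      \<open>twist\<close>, hence constant on the constituents of each member of
      \<open>B\<close>.\<close>
    define v where "v \<psi> = u \<psi> + u (twist \<psi>)" for \<psi>
    have v_twist: "v (twist \<psi>) = v \<psi>" if "\<psi> \<in> D" for \<psi>
      using that DI twist_twist by (auto simp: v_def)
    have f_twist: "f (inv \<sigma> \<otimes> x \<otimes> \<sigma>) = (\<Sum>\<psi>\<in>D. of_int (u (twist \<psi>)) * \<psi> x)" if "x \<in> N" for x
    proof -
      have "f (inv \<sigma> \<otimes> x \<otimes> \<sigma>) = (\<Sum>\<psi>\<in>D. of_int (u \<psi>) * twist \<psi> x)"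
        using that by (simp add: f_def twist_def cut_def)
      also have "\<dots> = (\<Sum>\<psi>\<in>D. of_int (u (twist \<psi>)) * \<psi> x)"
        by (rule sum.reindex_bij_witness[of _ twist twist]) (use Dtw DI twist_twist in auto)
      finally show ?thesis .
    qed
    have v_sum: "(\<Sum>\<psi>\<in>D. of_int (v \<psi>) * \<psi> x) = 0" if x: "x \<in> P" for x
    proof -
      have "inv \<sigma> \<otimes> x \<otimes> \<sigma> \<in> P" using two_regular_conj[OF _ \<sigma>(1)] x by (simp add: P_def)
      then have "f x + f (inv \<sigma> \<otimes> x \<otimes> \<sigma>) = 0" using u x by (simp add: f_def)
      then show ?thesis
        unfolding f_twist[OF PN[OF x]] by (simp add: f_def v_def distrib_right sum.distrib)
    qed
    \<comment> \<open>The common value of \<open>v\<close> on the constituents of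
      \<open>\<phi>\<close>. Since any two constituents are equal or twists of each other, the
      choice does not matter.\<close>
    define w where "w \<phi> = v (SOME \<psi>. \<psi> \<in> constituents \<phi>)" for \<phi>
    have w: "v \<psi> = w \<phi>" if \<phi>: "\<phi> \<in> B" and \<psi>: "\<psi> \<in> constituents \<phi>" for \<phi> \<psi>
    proof -
      have "(SOME \<psi>. \<psi> \<in> constituents \<phi>) \<in> constituents \<phi>" using someI[of "\<lambda>\<psi>. \<psi> \<in> constituents \<phi>"] \<psi> by blast
      then have "(SOME \<psi>. \<psi> \<in> constituents \<phi>) = \<psi> \<or> (SOME \<psi>. \<psi> \<in> constituents \<phi>) = twist \<psi>"
        using constituents_transitive \<phi> \<psi> BI by blast
      moreover have "\<psi> \<in> D" using \<phi> \<psi> D by blast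
      ultimately show ?thesis using v_twist[of \<psi>] unfolding w_def by metis
    qed
    have "\<forall>\<phi>\<in>B. w \<phi> = 0"
    proof (rule Bind)
      fix x assume x: "x \<in> P"
      have "(\<Sum>\<phi>\<in>B. of_int (w \<phi>) * \<phi> x) = (\<Sum>\<phi>\<in>B. \<Sum>\<psi>\<in>constituents \<phi>. of_int (v \<psi>) * \<psi> x)"
      proof (intro sum.cong refl)
        fix \<phi> assume \<phi>: "\<phi> \<in> B"
        have "\<phi> x = (\<Sum>\<psi>\<in>constituents \<phi>. \<psi> x)"
          using restriction_apply \<phi> BI PN[OF x] by blast
        then show "of_int (w \<phi>) * \<phi> x = (\<Sum>\<psi>\<in>constituents \<phi>. of_int (v \<psi>) * \<psi> x)"
          using w[OF \<phi>] by (simp add: sum_distrib_left)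
      qed
      also have "\<dots> = (\<Sum>\<psi>\<in>D. of_int (v \<psi>) * \<psi> x)"
        unfolding D by (rule sum.UNION_disjoint[symmetric]) (use Bfin sum_constituents(2) BI disj in auto)
      finally show "(\<Sum>\<phi>\<in>B. of_int (w \<phi>) * \<phi> x) = 0" using v_sum[OF x] by simp
    qed
    then have v0: "v \<psi> = 0" if "\<psi> \<in> D" for \<psi> using that w unfolding D by auto
    have f_anti: "f (inv \<sigma> \<otimes> x \<otimes> \<sigma>) = - f x" if "x \<in> N" for x
    proof -
      have "(\<Sum>\<psi>\<in>D. of_int (u (twist \<psi>)) * \<psi> x) = (\<Sum>\<psi>\<in>D. - (of_int (u \<psi>) * \<psi> x))"
      proof (intro sum.cong refl)
        fix \<psi> assume "\<psi> \<in> D"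
        then have "u (twist \<psi>) = - u \<psi>" using v0 by (simp add: v_def eq_neg_iff_add_eq_0 add.commute)
        then show "of_int (u (twist \<psi>)) * \<psi> x = - (of_int (u \<psi>) * \<psi> x)" by simp
      qed
      then show ?thesis unfolding f_twist[OF that] by (simp add: f_def sum_negf)
    qed
    have f0: "f x = 0" if x: "x \<in> N" for x
    proof (cases "x \<in> P")
      case True
      then show ?thesis using u by (simp add: f_def)
    next
      case False
      then obtain g where g: "g \<in> carrier G" "g \<notin> N" "g \<otimes> x = x \<otimes> g"
        using centralizer[OF x] by (auto simp: P_def)
      have gx: "g \<otimes> x \<otimes> inv g = x" using g x N_sub by (simp add: m_assoc)
      have "f x = (\<Sum>\<psi>\<in>D. of_int (u \<psi>) * \<psi> (g \<otimes> x \<otimes> inv g))" by (simp add: gx f_def)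
      also have "\<dots> = (\<Sum>\<psi>\<in>D. of_int (u \<psi>) * twist \<psi> x)"
        by (intro sum.cong refl) (use twist_eq_conj[OF _ g(1,2) x] DI in auto)
      also have "\<dots> = f (inv \<sigma> \<otimes> x \<otimes> \<sigma>)"
        using x by (simp add: f_def twist_def cut_def)
      finally show ?thesis using f_anti[OF x] by simp
    qed
    show ?thesis
    proof
      fix \<psi> assume \<psi>: "\<psi> \<in> D"
      \<comment> \<open>With \<open>f\<close> zero on all of \<open>N\<close> and not merely on
        \<open>P\<close>, orthonormality reads off each coefficient.\<close>
      have "char_inner H f \<psi> = (\<Sum>\<chi>\<in>D. of_int (u \<chi>) * char_inner H \<chi> \<psi>)"
        unfolding f_def by (rule char_inner_sum_left)
      also have "\<dots> = (\<Sum>\<chi>\<in>D. if \<chi> = \<psi> then of_int (u \<chi>) else 0)"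
        by (intro sum.cong refl) (use \<psi> DI in \<open>auto simp: Irr_H_orthonormal subset_iff\<close>)
      also have "\<dots> = of_int (u \<psi>)" using Dfin \<psi> by simp
      finally show "u \<psi> = 0" using f0 by (simp add: char_inner_def)
    qed
  qed
  show ?thesis
    using two_basic_set_iff[OF group_H, of D] finite_N DI ind span
    unfolding P D_def[symmetric] by auto
qed

end

section \<open>Young diagrams and the group algebra of the symmetric group\<close>

text \<open>Cells are pairs of row and column, and diagrams are finite down-closed sets of cells. In
  this form conjugation of a partition is the image under \<open>prod.swap\<close>.\<close>

definition young :: "(nat \<times> nat) set \<Rightarrow> bool" where
  "young D \<longleftrightarrow> finite D \<and> (\<forall>i j i' j'. (i, j) \<in> D \<longrightarrow> i' \<le> i \<longrightarrow> j' \<le> j \<longrightarrow> (i', j') \<in> D)"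

text \<open>For diagrams of partitions this is the dominance order.\<close>

definition dominated :: "(nat \<times> nat) set \<Rightarrow> (nat \<times> nat) set \<Rightarrow> bool" where
  "dominated D E \<longleftrightarrow> (\<forall>k. card {c \<in> D. fst c < k} \<le> card {c \<in> E. fst c < k})"

lemma youngD: "young D \<Longrightarrow> (i, j) \<in> D \<Longrightarrow> i' \<le> i \<Longrightarrow> j' \<le> j \<Longrightarrow> (i', j') \<in> D"
  unfolding young_def by blast

lemma down_closed_eq_lessThan:
  fixes S :: "nat set"
  assumes "finite S" "\<And>i j. i \<in> S \<Longrightarrow> j \<le> i \<Longrightarrow> j \<in> S"
  shows "S = {..<card S}"
proof (cases "S = {}")
  case False
  then have "Max S \<in> S" using assms(1) by simp
  then have S: "S = {..Max S}" using assms(2)[of "Max S"] Max_ge[OF assms(1)] by blast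
  have "card S = Suc (Max S)" by (subst S) simp
  then show ?thesis using S by (simp add: lessThan_Suc_atMost)
qed simp

lemma card_column_below:
  assumes "young E"
  shows "card {c \<in> E. snd c = j \<and> fst c < k} = min k (card {c \<in> E. snd c = j})"
proof -
  define I where "I = {i. (i, j) \<in> E}"
  have "I = fst ` {c \<in> E. snd c = j}" by (force simp: I_def)
  then have fin: "finite I" using assms by (simp add: young_def)
  have I: "I = {..<card I}"
    by (rule down_closed_eq_lessThan[OF fin]) (use youngD[OF assms] in \<open>auto simp: I_def\<close>)
  have "{c \<in> E. snd c = j} = (\<lambda>i. (i, j)) ` I" by (auto simp: I_def)
  then have 1: "card {c \<in> E. snd c = j} = card I" by (simp add: card_image inj_on_def)
  have "{c \<in> E. snd c = j \<and> fst c < k} = (\<lambda>i. (i, j)) ` (I \<inter> {..<k})" by (auto simp: I_def)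
  then have "card {c \<in> E. snd c = j \<and> fst c < k} = card (I \<inter> {..<k})" by (simp add: card_image inj_on_def)
  also have "I \<inter> {..<k} = {..<min k (card I)}" by (subst I) auto
  finally show ?thesis using 1 by simp
qed

text \<open>Mutual dominance equates the numbers of cells in the first \<open>k\<close> rows.
  Successive differences are the row lengths, and these determine a down-closed set.\<close>

lemma young_dominated_antisym:
  assumes D: "young D" and E: "young E" and "dominated D E" "dominated E D"
  shows "D = E"
proof -
  have eq: "card {c \<in> D. fst c < k} = card {c \<in> E. fst c < k}" for k
    using assms(3,4) by (auto simp: dominated_def intro: le_antisym)
  have row: "card {c \<in> F. fst c < Suc i} = card {c \<in> F. fst c < i} + card {j. (i, j) \<in> F}" if F: "young F" for F i
  proof -
    have fin: "finite F" using F by (simp add: young_def)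
    have "{c \<in> F. fst c < Suc i} = {c \<in> F. fst c < i} \<union> {c \<in> F. fst c = i}" by auto
    then have "card {c \<in> F. fst c < Suc i} = card {c \<in> F. fst c < i} + card {c \<in> F. fst c = i}"
      using fin by (simp add: card_Un_disjoint disjoint_iff)
    also have "{c \<in> F. fst c = i} = Pair i ` {j. (i, j) \<in> F}" by auto
    finally show ?thesis by (simp add: card_image inj_on_def)
  qed
  have rows: "{j. (i, j) \<in> F} = {..<card {j. (i, j) \<in> F}}" if F: "young F" for F i
  proof (rule down_closed_eq_lessThan)
    have "{j. (i, j) \<in> F} \<subseteq> snd ` F" by force
    then show "finite {j. (i, j) \<in> F}" using F by (auto simp: young_def intro: finite_subset)
  qed (use youngD[OF F] in auto)
  have "{j. (i, j) \<in> D} = {j. (i, j) \<in> E}" for i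
    using eq[of "Suc i"] eq[of i] row[OF D, of i] row[OF E, of i] rows[OF D, of i] rows[OF E, of i] by simp
  then show ?thesis by (auto simp: set_eq_iff)
qed

text \<open>The maps \<open>r\<close> and \<open>c\<close> place the same entries into
  \<open>D\<close> and \<open>E\<close>, and \<open>inj\<close> says that no two entries share both
  a row of \<open>r\<close> and a column of \<open>c\<close>: the setting of the basic combinatorial
  lemma on dominance.\<close>

context
  fixes X :: "nat set" and D E :: "(nat \<times> nat) set" and r c :: "nat \<Rightarrow> nat \<times> nat"
  assumes X: "finite X" and E: "young E"
    and r: "bij_betw r X D" and c: "bij_betw c X E"
    and inj: "inj_on (\<lambda>x. (fst (r x), snd (c x))) X"
begin

text \<open>Entries in one column of \<open>c\<close> lie in different rows of \<open>r\<close>, so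
  at most \<open>k\<close> of them are in the first \<open>k\<close> rows, and never more than the
  height of the column. The smaller bound counts the cells of that column in the first
  \<open>k\<close> rows.\<close>

lemma card_rows_column_le:
  "card {x \<in> X. fst (r x) < k \<and> snd (c x) = j} \<le> card {e \<in> E. snd e = j \<and> fst e < k}"
proof -
  have "card {x \<in> X. fst (r x) < k \<and> snd (c x) = j} \<le> card {..<k}"
    by (rule card_inj_on_le[of "\<lambda>x. fst (r x)"]) (use inj in \<open>auto simp: inj_on_def\<close>)
  moreover have "card {x \<in> X. fst (r x) < k \<and> snd (c x) = j} \<le> card {e \<in> E. snd e = j}"
    by (rule card_inj_on_le[of c]) (use c E in \<open>auto simp: bij_betw_def inj_on_def young_def\<close>)
  ultimately show ?thesis by (simp add: card_column_below[OF E])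
qed

lemma card_rows_eq: "card {x \<in> X. fst (r x) < k} = card {d \<in> D. fst d < k}"
proof (rule bij_betw_same_card[of r])
  show "bij_betw r {x \<in> X. fst (r x) < k} {d \<in> D. fst d < k}"
    using r by (auto simp: bij_betw_def inj_on_def)
qed

lemma card_rows_columns: "card {x \<in> X. fst (r x) < k} = (\<Sum>j\<in>snd ` E. card {x \<in> X. fst (r x) < k \<and> snd (c x) = j})"
proof -
  have "{x \<in> X. fst (r x) < k} = (\<Union>j\<in>snd ` E. {x \<in> X. fst (r x) < k \<and> snd (c x) = j})"
    using c by (auto simp: bij_betw_def)
  also have "card \<dots> = (\<Sum>j\<in>snd ` E. card {x \<in> X. fst (r x) < k \<and> snd (c x) = j})"
    by (rule card_UN_disjoint) (use E X in \<open>auto simp: young_def\<close>)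
  finally show ?thesis .
qed

lemma card_rows_columns': "card {e \<in> E. fst e < k} = (\<Sum>j\<in>snd ` E. card {e \<in> E. snd e = j \<and> fst e < k})"
proof -
  have "{e \<in> E. fst e < k} = (\<Union>j\<in>snd ` E. {e \<in> E. snd e = j \<and> fst e < k})" by auto
  also have "card \<dots> = (\<Sum>j\<in>snd ` E. card {e \<in> E. snd e = j \<and> fst e < k})"
    by (rule card_UN_disjoint) (use E in \<open>auto simp: young_def\<close>)
  finally show ?thesis .
qed

lemma dominated_if_rows_meet_columns_once: "dominated D E"
  unfolding dominated_def
proof
  fix k
  show "card {d \<in> D. fst d < k} \<le> card {e \<in> E. fst e < k}"
    unfolding card_rows_eq[symmetric] card_rows_columns card_rows_columns'
    by (intro sum_mono card_rows_column_le)
qed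

text \<open>All inequalities in the proof of dominance are equalities here, so a column of height \<open>h\<close>
  meets exactly the first \<open>h\<close> rows.\<close>

lemma crossing_in_diagram:
  assumes DE: "D = E" and x: "x \<in> X"
  shows "(fst (r x), snd (c x)) \<in> E"
proof (rule ccontr)
  let ?i = "fst (r x)" and ?j = "snd (c x)"
  assume out: "(?i, ?j) \<notin> E"
  have cx: "c x \<in> E" using c x by (auto simp: bij_betw_def)
  then have j: "?j \<in> snd ` E" by blast
  have "(\<Sum>j\<in>snd ` E. card {x \<in> X. fst (r x) < ?i \<and> snd (c x) = j}) = (\<Sum>j\<in>snd ` E. card {e \<in> E. snd e = j \<and> fst e < ?i})"
    unfolding card_rows_columns[symmetric] card_rows_columns'[symmetric] card_rows_eq by (simp only: DE)
  then have eq: "card {y \<in> X. fst (r y) < ?i \<and> snd (c y) = ?j} = card {e \<in> E. snd e = ?j \<and> fst e < ?i}"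
    by (rule sum_mono_inv) (use card_rows_column_le j E in \<open>auto simp: young_def\<close>)
  \<comment> \<open>The missing cell in row \<open>?i\<close> cuts off column \<open>?j\<close>
    above that row. The equality of cardinalities then puts every entry of this column, including
    \<open>x\<close>, into a row before \<open>?i\<close>.\<close>
  have "{e \<in> E. snd e = ?j \<and> fst e < ?i} = {e \<in> E. snd e = ?j}"
  proof -
    have "fst e < ?i" if "e \<in> E" "snd e = ?j" for e
    proof (rule ccontr)
      assume "\<not> fst e < ?i"
      moreover have "(fst e, ?j) \<in> E" using that by (metis prod.collapse)
      ultimately show False using out youngD[OF E] by (metis not_less order_refl)
    qed
    then show ?thesis by blast
  qed
  also have "card \<dots> = card {y \<in> X. snd (c y) = ?j}"
    by (rule bij_betw_same_card[symmetric, of c]) (use c in \<open>auto simp: bij_betw_def inj_on_def\<close>)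
  finally have "card {y \<in> X. fst (r y) < ?i \<and> snd (c y) = ?j} = card {y \<in> X. snd (c y) = ?j}" using eq by simp
  then have "{y \<in> X. fst (r y) < ?i \<and> snd (c y) = ?j} = {y \<in> X. snd (c y) = ?j}"
    using X by (intro card_subset_eq) auto
  then show False using x by blast
qed

end

section \<open>The group algebra with row and column sums\<close>

lemma convolution_apply:
  "convolution n f g x = (if x permutes {1..n} then \<Sum>y | y permutes {1..n}. f y * g (inv' y \<circ> x) else 0)"
  by (simp add: convolution_def cut_def)

locale symmetric_algebra =
  fixes n :: nat
begin

definition P :: "(nat \<Rightarrow> nat) set" where "P = {p. p permutes {1..n}}"

abbreviation conv (infixl "\<star>" 70) where "f \<star> g \<equiv> convolution n f g"

abbreviation A where "A \<equiv> group_algebra n"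

lemma finite_P: "finite P"
  by (simp add: P_def finite_permutations)

lemma A_iff: "f \<in> A \<longleftrightarrow> (\<forall>x. x \<notin> P \<longrightarrow> f x = 0)"
  by (simp add: group_algebra_def P_def)

lemma P_closed: "p \<in> P \<Longrightarrow> q \<in> P \<Longrightarrow> p \<circ> q \<in> P" "p \<in> P \<Longrightarrow> inv' p \<in> P" "id \<in> P"
  by (auto simp: P_def intro: permutes_compose permutes_inv permutes_id)

lemma P_inv: "p \<in> P \<Longrightarrow> inv' p \<circ> p = id" "p \<in> P \<Longrightarrow> p \<circ> inv' p = id" "p \<in> P \<Longrightarrow> inv' (inv' p) = p"
  by (auto simp: P_def permutes_inv_o permutes_inv_inv)

lemma P_inv_comp: "p \<in> P \<Longrightarrow> q \<in> P \<Longrightarrow> inv' (p \<circ> q) = inv' q \<circ> inv' p"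
  by (auto simp: P_def permutes_bij o_inv_distrib)

lemma P_cancel:
  "p \<in> P \<Longrightarrow> inv' p \<circ> (p \<circ> x) = x" "p \<in> P \<Longrightarrow> p \<circ> (inv' p \<circ> x) = x"
  "p \<in> P \<Longrightarrow> x \<circ> p \<circ> inv' p = x" "p \<in> P \<Longrightarrow> x \<circ> inv' p \<circ> p = x"
  using P_inv by (simp_all add: o_assoc[symmetric], simp_all add: o_assoc)

lemma sum_P_left: "p \<in> P \<Longrightarrow> (\<Sum>x\<in>P. f (p \<circ> x)) = (\<Sum>x\<in>P. f x)"
  by (rule sum.reindex_bij_witness[of _ "\<lambda>x. inv' p \<circ> x" "\<lambda>x. p \<circ> x"]) (simp_all only: P_closed P_cancel)

lemma sum_P_inv: "(\<Sum>x\<in>P. f (inv' x)) = (\<Sum>x\<in>P. f x)"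
  by (rule sum.reindex_bij_witness[of _ "\<lambda>x. inv' x" "\<lambda>x. inv' x"]) (simp_all only: P_closed P_inv)

lemma conv_apply: "x \<in> P \<Longrightarrow> (f \<star> g) x = (\<Sum>y\<in>P. f y * g (inv' y \<circ> x))"
  by (simp add: convolution_apply P_def)

lemma conv_in: "f \<star> g \<in> A"
  by (simp add: group_algebra_def convolution_apply)

lemma A_eqI: "f \<in> A \<Longrightarrow> g \<in> A \<Longrightarrow> (\<And>x. x \<in> P \<Longrightarrow> f x = g x) \<Longrightarrow> f = g"
  unfolding A_iff by (rule ext) metis

lemma conv_assoc: "(f \<star> g) \<star> h = f \<star> (g \<star> h)"
proof (rule A_eqI[OF conv_in conv_in])
  fix x assume x: "x \<in> P"
  have "((f \<star> g) \<star> h) x = (\<Sum>y\<in>P. \<Sum>z\<in>P. f z * (g (inv' z \<circ> y) * h (inv' y \<circ> x)))"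
    unfolding conv_apply[OF x] by (intro sum.cong refl) (simp add: conv_apply sum_distrib_right mult.assoc)
  also have "\<dots> = (\<Sum>z\<in>P. \<Sum>y\<in>P. f z * (g (inv' z \<circ> y) * h (inv' y \<circ> x)))"
    by (rule sum.swap)
  also have "\<dots> = (\<Sum>z\<in>P. \<Sum>y\<in>P. f z * (g y * h (inv' y \<circ> (inv' z \<circ> x))))"
  proof (rule sum.cong[OF refl])
    fix z assume z: "z \<in> P"
    have "(\<Sum>y\<in>P. f z * (g (inv' z \<circ> y) * h (inv' y \<circ> x))) =
        (\<Sum>y\<in>P. f z * (g (inv' z \<circ> (z \<circ> y)) * h (inv' (z \<circ> y) \<circ> x)))"
      by (rule sum_P_left[OF z, symmetric])
    also have "\<dots> = (\<Sum>y\<in>P. f z * (g y * h (inv' y \<circ> (inv' z \<circ> x))))"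
      by (intro sum.cong refl) (simp only: P_cancel(1)[OF z] P_inv_comp[OF z] comp_assoc)
    finally show "(\<Sum>y\<in>P. f z * (g (inv' z \<circ> y) * h (inv' y \<circ> x))) =
        (\<Sum>y\<in>P. f z * (g y * h (inv' y \<circ> (inv' z \<circ> x))))" .
  qed
  also have "\<dots> = (\<Sum>z\<in>P. f z * (g \<star> h) (inv' z \<circ> x))"
    using P_closed(1)[OF P_closed(2) x] by (intro sum.cong refl) (simp only: conv_apply sum_distrib_left)
  also have "\<dots> = (f \<star> (g \<star> h)) x" by (rule conv_apply[OF x, symmetric])
  finally show "((f \<star> g) \<star> h) x = (f \<star> (g \<star> h)) x" .
qed

lemma clinear_conv_right: "clinear (\<lambda>g. f \<star> g)"
  by (auto simp: clinear_iff fun_eq_iff convolution_apply cscale_def distrib_left sum.distrib sum_distrib_left mult_ac)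

lemma clinear_conv_left: "clinear (\<lambda>f. f \<star> g)"
  by (auto simp: clinear_iff fun_eq_iff convolution_apply cscale_def distrib_right sum.distrib sum_distrib_left mult_ac)

lemma subspace_A: "cfun.subspace A"
  by (auto simp: cfun.subspace_def group_algebra_def cscale_def)

lemma delta_conv: "p \<in> P \<Longrightarrow> x \<in> P \<Longrightarrow> (delta p \<star> f) x = f (inv' p \<circ> x)"
proof -
  assume p: "p \<in> P" and x: "x \<in> P"
  have "(delta p \<star> f) x = (\<Sum>y\<in>P. if y = p then f (inv' y \<circ> x) else 0)"
    unfolding conv_apply[OF x] by (intro sum.cong refl) (simp add: delta_apply)
  then show ?thesis using p finite_P by simp
qed

lemma conv_delta:
  assumes p: "p \<in> P" and x: "x \<in> P"
  shows "(f \<star> delta p) x = f (x \<circ> inv' p)"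
proof -
  have "inv' y \<circ> x = p \<longleftrightarrow> y = x \<circ> inv' p" if y: "y \<in> P" for y
  proof
    assume "inv' y \<circ> x = p"
    then have "x = y \<circ> p" using P_cancel(2)[OF y] by metis
    then show "y = x \<circ> inv' p" using P_cancel(3)[OF p] by metis
  next
    assume *: "y = x \<circ> inv' p"
    have "inv' y \<circ> x = p \<circ> inv' x \<circ> x" unfolding * P_inv_comp[OF x P_closed(2)[OF p]] P_inv(3)[OF p] ..
    then show "inv' y \<circ> x = p" by (simp only: P_cancel(4)[OF x])
  qed
  then have "(f \<star> delta p) x = (\<Sum>y\<in>P. if y = x \<circ> inv' p then f y else 0)"
    unfolding conv_apply[OF x] by (intro sum.cong refl) (simp add: delta_apply)
  also have "\<dots> = f (x \<circ> inv' p)"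
    using P_closed(1)[OF x P_closed(2)[OF p]] finite_P by simp
  finally show ?thesis .
qed

lemma delta_in_A: "p \<in> P \<Longrightarrow> delta p \<in> A"
  by (auto simp: A_iff delta_apply)

lemma delta_mult:
  assumes p: "p \<in> P" and q: "q \<in> P"
  shows "delta p \<star> delta q = delta (p \<circ> q)"
proof (rule A_eqI[OF conv_in delta_in_A[OF P_closed(1)[OF p q]]])
  fix x assume x: "x \<in> P"
  have "x \<circ> inv' q = p \<longleftrightarrow> x = p \<circ> q" using P_cancel(3,4)[OF q] by metis
  then show "(delta p \<star> delta q) x = delta (p \<circ> q) x"
    by (simp add: conv_delta[OF q x] delta_apply)
qed

lemma conv_delta_id: "f \<in> A \<Longrightarrow> f \<star> delta id = f" "f \<in> A \<Longrightarrow> delta id \<star> f = f"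
  by (erule A_eqI[OF conv_in], simp add: conv_delta[OF P_closed(3)],
      erule A_eqI[OF conv_in], simp add: delta_conv[OF P_closed(3)])

lemma A_expand: "f \<in> A \<Longrightarrow> f = (\<Sum>p\<in>P. cscale (f p) (delta p))"
proof
  fix x assume f: "f \<in> A"
  have "(\<Sum>p\<in>P. cscale (f p) (delta p)) x = (\<Sum>p\<in>P. if x = p then f p else 0)"
    unfolding sum_fun_apply by (intro sum.cong) (auto simp: cscale_def delta_apply)
  then show "f x = (\<Sum>p\<in>P. cscale (f p) (delta p)) x"
    using f finite_P by (auto simp: A_iff)
qed

lemma conv_expand_left: "f \<in> A \<Longrightarrow> f \<star> g = (\<Sum>p\<in>P. cscale (f p) (delta p \<star> g))"
proof -
  assume "f \<in> A"
  then have "f \<star> g = (\<Sum>p\<in>P. cscale (f p) (delta p)) \<star> g" using A_expand by metis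
  then show ?thesis by (simp add: clinear_sum[OF clinear_conv_left] clinear_scale[OF clinear_conv_left])
qed


lemma P_apply_in: "p \<in> P \<Longrightarrow> x \<in> {1..n} \<Longrightarrow> p x \<in> {1..n}"
  unfolding P_def using permutes_in_image by fastforce

lemma P_permutation: "p \<in> P \<Longrightarrow> permutation p"
  by (auto simp: P_def permutation_permutes)

lemma sign_P: "p \<in> P \<Longrightarrow> q \<in> P \<Longrightarrow> sign (p \<circ> q) = sign p * sign q" "p \<in> P \<Longrightarrow> sign (inv' p) = sign p"
  by (simp_all add: P_permutation sign_compose sign_inverse)

lemma conv_scale: "cscale c f \<star> g = cscale c (f \<star> g)" "f \<star> cscale c g = cscale c (f \<star> g)"
  using clinear_scale[OF clinear_conv_left] clinear_scale[OF clinear_conv_right] by auto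

lemma conv_zero: "0 \<star> g = 0" "f \<star> 0 = 0"
  using clinear_zero[OF clinear_conv_left] clinear_zero[OF clinear_conv_right] by auto

lemma conv_expand_middle:
  assumes "f \<in> A"
  shows "g \<star> f \<star> h = (\<Sum>p\<in>P. cscale (f p) (g \<star> (delta p \<star> h)))"
  by (simp only: conv_assoc conv_expand_left[OF assms] clinear_sum[OF clinear_conv_right] conv_scale)

text \<open>A filling sends each entry to its cell; it is the inverse of a tableau.\<close>

definition filling :: "(nat \<times> nat) set \<Rightarrow> (nat \<Rightarrow> nat \<times> nat) \<Rightarrow> bool" where
  "filling D t \<longleftrightarrow> bij_betw t {1..n} D"

text \<open>One definition covers both groups of a tableau: \<open>k\<close> is
  \<open>fst \<circ> t\<close> or \<open>snd \<circ> t\<close>, sending an entry to its row or its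
  column.\<close>

definition stab :: "(nat \<Rightarrow> nat) \<Rightarrow> (nat \<Rightarrow> nat) set" where
  "stab k = {p \<in> P. \<forall>x\<in>{1..n}. k (p x) = k x}"

definition row_sum :: "(nat \<Rightarrow> nat \<times> nat) \<Rightarrow> (nat \<Rightarrow> nat) \<Rightarrow> complex" where
  "row_sum t = cut (stab (fst \<circ> t)) (\<lambda>p. 1)"

definition col_sum :: "(nat \<Rightarrow> nat \<times> nat) \<Rightarrow> (nat \<Rightarrow> nat) \<Rightarrow> complex" where
  "col_sum t = cut (stab (snd \<circ> t)) (\<lambda>p. of_int (sign p))"

lemma stab_P: "p \<in> stab k \<Longrightarrow> p \<in> P"
  by (simp add: stab_def)

lemma stab_comp: "p \<in> stab k \<Longrightarrow> q \<in> stab k \<Longrightarrow> p \<circ> q \<in> stab k"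
  using P_apply_in P_closed(1) by (auto simp: stab_def)

lemma stab_inv:
  assumes "p \<in> stab k"
  shows "inv' p \<in> stab k"
proof -
  have p: "p \<in> P" using assms by (rule stab_P)
  have "k (inv' p x) = k x" if x: "x \<in> {1..n}" for x
  proof -
    have "inv' p x \<in> {1..n}" using P_apply_in[OF P_closed(2)[OF p] x] .
    then have "k (p (inv' p x)) = k (inv' p x)" using assms by (simp add: stab_def)
    moreover have "p (inv' p x) = x" using fun_cong[OF P_inv(2)[OF p], of x] by simp
    ultimately show ?thesis by simp
  qed
  then show ?thesis using P_closed(2)[OF p] by (simp add: stab_def)
qed

lemma stab_comp_iff:
  assumes "p \<in> stab k" "x \<in> P"
  shows "x \<circ> p \<in> stab k \<longleftrightarrow> x \<in> stab k" "p \<circ> x \<in> stab k \<longleftrightarrow> x \<in> stab k"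
proof -
  note p = stab_P[OF assms(1)]
  show "x \<circ> p \<in> stab k \<longleftrightarrow> x \<in> stab k"
    using stab_comp[OF _ stab_inv[OF assms(1)], of "x \<circ> p"] stab_comp[OF _ assms(1), of x]
    by (auto simp: P_cancel(3)[OF p])
  show "p \<circ> x \<in> stab k \<longleftrightarrow> x \<in> stab k"
    using stab_comp[OF stab_inv[OF assms(1)], of "p \<circ> x"] stab_comp[OF assms(1), of x]
    by (auto simp: P_cancel(1)[OF p])
qed

lemma sums_in_A: "row_sum t \<in> A" "col_sum t \<in> A"
  by (auto simp: A_iff row_sum_def col_sum_def cut_def stab_P)

lemma row_sum_absorb:
  assumes p: "p \<in> stab (fst \<circ> t)"
  shows "row_sum t \<star> delta p = row_sum t" "delta p \<star> row_sum t = row_sum t"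
  by (rule A_eqI[OF conv_in sums_in_A(1)], simp add: conv_delta[OF stab_P[OF p]] row_sum_def cut_def
        stab_comp_iff[OF stab_inv[OF p]])
    (rule A_eqI[OF conv_in sums_in_A(1)], simp add: delta_conv[OF stab_P[OF p]] row_sum_def cut_def
        stab_comp_iff[OF stab_inv[OF p]])

lemma col_sum_absorb:
  assumes p: "p \<in> stab (snd \<circ> t)"
  shows "col_sum t \<star> delta p = cscale (of_int (sign p)) (col_sum t)"
    "delta p \<star> col_sum t = cscale (of_int (sign p)) (col_sum t)"
proof -
  note pP = stab_P[OF p] and i = P_closed(2)[OF stab_P[OF p]]
  have c: "cscale (of_int (sign p)) (col_sum t) \<in> A"
    using sums_in_A(2) subspace_A by (simp add: cfun.subspace_scale)
  show "col_sum t \<star> delta p = cscale (of_int (sign p)) (col_sum t)"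
    by (rule A_eqI[OF conv_in c])
      (simp add: conv_delta[OF pP] col_sum_def cut_def cscale_def stab_comp_iff[OF stab_inv[OF p]]
        sign_P(1)[OF _ i] sign_P(2)[OF pP])
  show "delta p \<star> col_sum t = cscale (of_int (sign p)) (col_sum t)"
    by (rule A_eqI[OF conv_in c])
      (simp add: delta_conv[OF pP] col_sum_def cut_def cscale_def stab_comp_iff[OF stab_inv[OF p]]
        sign_P(1)[OF i] sign_P(2)[OF pP])
qed

lemma cscale_eq_uminus_self: "f = cscale (-1) f \<Longrightarrow> f = 0"
  by (auto simp: fun_eq_iff cscale_def)

text \<open>Two entries in a common row of \<open>t\<close> and a common column of \<open>t'\<close>
  give a transposition that the row sum absorbs and the column sum absorbs with sign -1, so the
  product equals its negative.\<close>

lemma common_transposition_zero: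
  assumes "\<not> inj_on (\<lambda>x. (fst (t x), snd (t' x))) {1..n}"
  shows "row_sum t \<star> col_sum t' = 0" "col_sum t' \<star> row_sum t = 0"
proof -
  obtain x y where xy: "x \<in> {1..n}" "y \<in> {1..n}" "x \<noteq> y" "fst (t x) = fst (t y)" "snd (t' x) = snd (t' y)"
    using assms by (auto simp: inj_on_def)
  define s where "s = transpose x y"
  have "s permutes {1..n}" unfolding s_def using xy(1,2) by (rule permutes_swap_id)
  then have P: "s \<in> P" by (simp add: P_def)
  have r: "s \<in> stab (fst \<circ> t)" and c: "s \<in> stab (snd \<circ> t')"
    using P xy by (auto simp: stab_def s_def transpose_def)
  have sgn: "sign s = -1" using xy(3) by (simp add: s_def sign_swap_id)
  have "row_sum t \<star> col_sum t' = row_sum t \<star> (delta s \<star> col_sum t')"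
    by (simp only: row_sum_absorb(1)[OF r] conv_assoc[symmetric])
  also have "\<dots> = cscale (-1) (row_sum t \<star> col_sum t')"
    by (simp only: col_sum_absorb(2)[OF c] sgn conv_scale of_int_minus of_int_1)
  finally show "row_sum t \<star> col_sum t' = 0" by (rule cscale_eq_uminus_self)
  have "col_sum t' \<star> row_sum t = (col_sum t' \<star> delta s) \<star> row_sum t"
    by (simp only: row_sum_absorb(2)[OF r] conv_assoc)
  also have "\<dots> = cscale (-1) (col_sum t' \<star> row_sum t)"
    by (simp only: col_sum_absorb(1)[OF c] sgn conv_scale of_int_minus of_int_1)
  finally show "col_sum t' \<star> row_sum t = 0" by (rule cscale_eq_uminus_self)
qed

lemma stab_conj:
  assumes p: "p \<in> P" and x: "x \<in> P"
  shows "inv' p \<circ> x \<in> stab k \<longleftrightarrow> x \<circ> inv' p \<in> stab (k \<circ> inv' p)"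
proof -
  have "(\<forall>z\<in>{1..n}. k (inv' p (x (inv' p z))) = k (inv' p z)) \<longleftrightarrow> (\<forall>z\<in>{1..n}. k (inv' p (x z)) = k z)"
  proof (intro iffI ballI)
    fix z assume *: "\<forall>z\<in>{1..n}. k (inv' p (x (inv' p z))) = k (inv' p z)" and z: "z \<in> {1..n}"
    have "inv' p (p z) = z" using fun_cong[OF P_inv(1)[OF p], of z] by simp
    then show "k (inv' p (x z)) = k z" using *[rule_format, OF P_apply_in[OF p z]] by simp
  next
    fix z assume "\<forall>z\<in>{1..n}. k (inv' p (x z)) = k z" and z: "z \<in> {1..n}"
    then show "k (inv' p (x (inv' p z))) = k (inv' p z)" using P_apply_in[OF P_closed(2)[OF p] z] by blast
  qed
  then show ?thesis
    using P_closed(1)[OF P_closed(2)[OF p] x] P_closed(1)[OF x P_closed(2)[OF p]] by (simp add: stab_def)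
qed

text \<open>Conjugation by \<open>p\<close> carries the sums of \<open>t\<close> to those of the
  translated tableau. As a filling is inverse to a tableau, the translate is
  \<open>t \<circ> inv' p\<close>.\<close>

lemma delta_sum_commute:
  assumes p: "p \<in> P"
  shows "delta p \<star> row_sum t = row_sum (t \<circ> inv' p) \<star> delta p"
    "delta p \<star> col_sum t = col_sum (t \<circ> inv' p) \<star> delta p"
proof -
  note i = P_closed(2)[OF p]
  show "delta p \<star> row_sum t = row_sum (t \<circ> inv' p) \<star> delta p"
    by (rule A_eqI[OF conv_in conv_in])
      (simp add: delta_conv[OF p] conv_delta[OF p] row_sum_def cut_def stab_conj[OF p] comp_assoc)
  show "delta p \<star> col_sum t = col_sum (t \<circ> inv' p) \<star> delta p"
    by (rule A_eqI[OF conv_in conv_in])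
      (simp add: delta_conv[OF p] conv_delta[OF p] col_sum_def cut_def stab_conj[OF p] comp_assoc
        sign_P(1)[OF _ i] sign_P(1)[OF i])
qed

lemma filling_comp: "filling D t \<Longrightarrow> p \<in> P \<Longrightarrow> filling D (t \<circ> inv' p)"
  unfolding filling_def
  by (rule bij_betw_trans[of _ _ "{1..n}"]) (auto simp: P_def permutes_inv permutes_imp_bij)

text \<open>By linearity the middle factor is a group element, and moving it past one of the sums
  translates a filling. Without dominance some row of one filling meets a column of the other twice,
  whichever translate is taken.\<close>

lemma not_dominated_zero:
  assumes t: "filling D t" and t': "filling E t'" and E: "young E" and nd: "\<not> dominated D E" and f: "f \<in> A"
  shows "row_sum t \<star> f \<star> col_sum t' = 0" "col_sum t' \<star> f \<star> row_sum t = 0"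
proof -
  have zero: "row_sum s \<star> col_sum s' = 0" "col_sum s' \<star> row_sum s = 0" if "filling D s" "filling E s'" for s s'
    using common_transposition_zero dominated_if_rows_meet_columns_once[OF _ E] that nd
    unfolding filling_def by blast+
  have "row_sum t \<star> (delta p \<star> col_sum t') = 0" if p: "p \<in> P" for p
    unfolding delta_sum_commute(2)[OF p] conv_assoc[symmetric] zero(1)[OF t filling_comp[OF t' p]] conv_zero ..
  then show "row_sum t \<star> f \<star> col_sum t' = 0"
    unfolding conv_expand_middle[OF f] by (simp add: cfun.scale_zero_right)
  have "col_sum t' \<star> (delta p \<star> row_sum t) = 0" if p: "p \<in> P" for p
    unfolding delta_sum_commute(1)[OF p] conv_assoc[symmetric] zero(2)[OF filling_comp[OF t p] t'] conv_zero ..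
  then show "col_sum t' \<star> f \<star> row_sum t = 0"
    unfolding conv_expand_middle[OF f] by (simp add: cfun.scale_zero_right)
qed

text \<open>If no row of \<open>t\<close> meets a column of its translate by \<open>p\<close> twice, moving each entry within its row
  to the column it has in the translate is a row permutation \<open>w\<close>, and \<open>w \<circ> p\<close> preserves columns.\<close>

lemma row_delta_col_scalar:
  assumes t: "filling D t" and D: "young D" and p: "p \<in> P"
  shows "\<exists>c. row_sum t \<star> (delta p \<star> col_sum t) = cscale c (row_sum t \<star> col_sum t)"
proof (cases "inj_on (\<lambda>x. (fst (t x), snd ((t \<circ> inv' p) x))) {1..n}")
  case False
  have "row_sum t \<star> (delta p \<star> col_sum t) = 0"
    unfolding delta_sum_commute(2)[OF p] conv_assoc[symmetric] common_transposition_zero(1)[OF False] conv_zero ..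
  then show ?thesis by (intro exI[of _ 0]) (simp add: cfun.scale_zero_left)
next
  case True
  let ?t' = "t \<circ> inv' p"
  have bt: "bij_betw t {1..n} D" and bt': "bij_betw ?t' {1..n} D"
    using t filling_comp[OF t p] by (simp_all add: filling_def)
  have cell: "(fst (t x), snd (?t' x)) \<in> D" if "x \<in> {1..n}" for x
    using crossing_in_diagram[OF _ D bt bt' True refl that] by simp
  \<comment> \<open>\<open>w\<close> sends \<open>x\<close> to the entry of \<open>t\<close> at the
    crossing of the row of \<open>x\<close> in \<open>t\<close> with its column in the translate.
    The identity outside \<open>{1..n}\<close> makes it a permutation of that set.\<close>
  define w where "w x = (if x \<in> {1..n} then inv_into {1..n} t (fst (t x), snd (?t' x)) else x)" for x
  have tw: "t (w x) = (fst (t x), snd (?t' x))" and w_in: "w x \<in> {1..n}" if "x \<in> {1..n}" for x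
    using cell[OF that] bt that by (auto simp: w_def bij_betw_def f_inv_into_f inv_into_into)
  have "inj_on w {1..n}"
  proof (rule inj_onI)
    fix x y assume xy: "x \<in> {1..n}" "y \<in> {1..n}" "w x = w y"
    have "(fst (t x), snd (?t' x)) = t (w x)" by (rule tw[OF xy(1), symmetric])
    also have "\<dots> = (fst (t y), snd (?t' y))" unfolding xy(3) by (rule tw[OF xy(2)])
    finally show "x = y" by (rule inj_onD[OF True _ xy(1,2)])
  qed
  moreover have "w ` {1..n} \<subseteq> {1..n}" using w_in by blast
  ultimately have "bij_betw w {1..n} {1..n}"
    using endo_inj_surj[OF finite_atLeastAtMost] unfolding bij_betw_def by blast
  then have "w permutes {1..n}" by (rule bij_imp_permutes) (simp only: w_def if_False)
  then have w: "w \<in> P" by (simp add: P_def)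
  have wr: "w \<in> stab (fst \<circ> t)" using w tw by (simp add: stab_def)
  have wc: "w \<circ> p \<in> stab (snd \<circ> t)"
  proof -
    have "snd (t (w (p x))) = snd (t x)" if "x \<in> {1..n}" for x
      using tw[OF P_apply_in[OF p that]] fun_cong[OF P_inv(1)[OF p], of x] by simp
    then show ?thesis using P_closed(1)[OF w p] by (simp add: stab_def)
  qed
  \<comment> \<open>\<open>p\<close> is the row permutation \<open>inv' w\<close> followed on the
    right by the column permutation \<open>w \<circ> p\<close>; the sums absorb both, and the sign
    of the latter is the scalar.\<close>
  have "delta p = delta (inv' w) \<star> delta (w \<circ> p)"
    using delta_mult[OF P_closed(2)[OF w] P_closed(1)[OF w p]] P_cancel(1)[OF w] by simp
  then have "row_sum t \<star> (delta p \<star> col_sum t) = (row_sum t \<star> delta (inv' w)) \<star> (delta (w \<circ> p) \<star> col_sum t)"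
    by (simp only: conv_assoc)
  also have "\<dots> = cscale (of_int (sign (w \<circ> p))) (row_sum t \<star> col_sum t)"
    by (simp only: row_sum_absorb(1)[OF stab_inv[OF wr]] col_sum_absorb(2)[OF wc] conv_scale)
  finally show ?thesis by blast
qed

text \<open>Von Neumann's lemma on Young symmetrizers, by linearity from the case of a group element
  in the middle.\<close>

lemma row_conv_col_scalar:
  assumes t: "filling D t" and D: "young D" and f: "f \<in> A"
  shows "\<exists>c. row_sum t \<star> f \<star> col_sum t = cscale c (row_sum t \<star> col_sum t)"
proof -
  obtain c where c: "\<And>p. p \<in> P \<Longrightarrow> row_sum t \<star> (delta p \<star> col_sum t) = cscale (c p) (row_sum t \<star> col_sum t)"
    using row_delta_col_scalar[OF t D] by metis
  have "row_sum t \<star> f \<star> col_sum t = (\<Sum>p\<in>P. cscale (f p) (cscale (c p) (row_sum t \<star> col_sum t)))"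
    unfolding conv_expand_middle[OF f] by (intro sum.cong refl) (simp only: c)
  also have "\<dots> = cscale (\<Sum>p\<in>P. f p * c p) (row_sum t \<star> col_sum t)"
    by (simp add: cfun.scale_sum_left cfun.scale_scale)
  finally show ?thesis by blast
qed

text \<open>A permutation preserving both rows and columns is the identity, so a single term
  survives. The value 1 shows that the symmetrizer is nonzero and lets scalars be read off at
  \<open>id\<close>.\<close>

lemma row_col_id:
  assumes t: "filling D t"
  shows "(row_sum t \<star> col_sum t) id = 1"
proof -
  have "row_sum t y * col_sum t (inv' y \<circ> id) = (if y = id then 1 else 0)" if y: "y \<in> P" for y
  proof (cases "y \<in> stab (fst \<circ> t) \<and> inv' y \<in> stab (snd \<circ> t)")
    case True
    then have yc: "y \<in> stab (snd \<circ> t)" using stab_inv[of "inv' y"] P_inv(3)[OF y] by simp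
    have "y x = x" for x
    proof (cases "x \<in> {1..n}")
      case x: True
      have "t (y x) = t x" using True yc x by (simp add: stab_def prod_eq_iff)
      then show ?thesis
        by (rule inj_onD[OF bij_betw_imp_inj_on[OF t[unfolded filling_def]] _ P_apply_in[OF y x] x])
    next
      case False
      then show ?thesis using y by (auto simp: P_def permutes_def)
    qed
    then have "y = id" by auto
    then show ?thesis using True by (simp add: row_sum_def col_sum_def cut_def)
  next
    case False
    have "id \<in> stab k" for k using P_closed(3) by (simp add: stab_def)
    then have "y \<noteq> id" using False by auto
    then show ?thesis using False by (auto simp: row_sum_def col_sum_def cut_def)
  qed
  then have "(row_sum t \<star> col_sum t) id = (\<Sum>y\<in>P. if y = id then 1 else 0)"
    unfolding conv_apply[OF P_closed(3)] by (intro sum.cong refl) auto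
  then show ?thesis using P_closed(3) finite_P by simp
qed

end

section \<open>Specht modules\<close>

context symmetric_algebra
begin

text \<open>The adjoint for the standard Hermitian form: the value of
  \<open>star f \<star> f\<close> at \<open>id\<close> is the squared norm of
  \<open>f\<close>.\<close>

definition star :: "((nat \<Rightarrow> nat) \<Rightarrow> complex) \<Rightarrow> (nat \<Rightarrow> nat) \<Rightarrow> complex" where
  "star f = cut P (\<lambda>x. cnj (f (inv' x)))"

lemma star_in_A: "star f \<in> A"
  by (simp add: A_iff star_def cut_def)

lemma star_conv_self_eq_0:
  assumes f: "f \<in> A" and "star f \<star> f = 0"
  shows "f = 0"
proof -
  have "0 = (star f \<star> f) id" by (simp add: assms(2))
  also have "\<dots> = (\<Sum>y\<in>P. cnj (f (inv' y)) * f (inv' y))"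
    unfolding conv_apply[OF P_closed(3)] by (intro sum.cong refl) (simp add: star_def cut_def)
  also have "\<dots> = (\<Sum>y\<in>P. cnj (f y) * f y)" by (rule sum_P_inv)
  also have "\<dots> = (\<Sum>y\<in>P. of_real ((cmod (f y))\<^sup>2))"
    by (intro sum.cong refl) (simp only: complex_norm_square mult.commute)
  also have "\<dots> = of_real (\<Sum>y\<in>P. (cmod (f y))\<^sup>2)" by (simp only: of_real_sum)
  finally have "complex_of_real (\<Sum>y\<in>P. (cmod (f y))\<^sup>2) = 0" by (rule sym)
  then have "(\<Sum>y\<in>P. (cmod (f y))\<^sup>2) = 0" by (simp only: of_real_eq_0_iff)
  then have "\<forall>y\<in>P. f y = 0" using finite_P by (simp add: sum_nonneg_eq_0_iff)
  then show ?thesis using f by (auto simp: A_iff fun_eq_iff)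
qed

lemma star_conv_self: "star (star f \<star> f) = star f \<star> f"
proof (rule A_eqI[OF star_in_A conv_in])
  fix x assume x: "x \<in> P"
  have "star (star f \<star> f) x = cnj (\<Sum>y\<in>P. cnj (f (inv' y)) * f (inv' y \<circ> inv' x))"
    using x by (simp add: star_def cut_def conv_apply[OF P_closed(2)[OF x]])
  also have "\<dots> = (\<Sum>y\<in>P. f (inv' y) * cnj (f (inv' y \<circ> inv' x)))" by simp
  also have "\<dots> = (\<Sum>y\<in>P. f (inv' (inv' x \<circ> y)) * cnj (f (inv' (inv' x \<circ> y) \<circ> inv' x)))"
    by (rule sum_P_left[OF P_closed(2)[OF x], symmetric])
  also have "\<dots> = (\<Sum>y\<in>P. cnj (f (inv' y)) * f (inv' y \<circ> x))"
    by (intro sum.cong refl)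
      (simp only: P_inv_comp[OF P_closed(2)[OF x]] P_inv(3)[OF x] comp_assoc P_inv(2)[OF x] comp_id mult.commute)
  also have "\<dots> = (star f \<star> f) x"
    unfolding conv_apply[OF x] by (intro sum.cong refl) (simp add: star_def cut_def)
  finally show "star (star f \<star> f) x = (star f \<star> f) x" .
qed

text \<open>With \<open>h = u\<^sup>* u\<close> we have \<open>h = h\<^sup>*\<close> and \<open>h\<^sup>* h = u\<^sup>* (u h) = 0\<close>; positivity gives \<open>h = 0\<close>, then \<open>u = 0\<close>.\<close>

lemma left_ideal_square_zero:
  assumes U: "U \<subseteq> A" "\<And>f u. f \<in> A \<Longrightarrow> u \<in> U \<Longrightarrow> f \<star> u \<in> U" and sq: "\<And>u v. u \<in> U \<Longrightarrow> v \<in> U \<Longrightarrow> u \<star> v = 0"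
    and u: "u \<in> U"
  shows "u = 0"
proof -
  define h where "h = star u \<star> u"
  have h: "h \<in> U" unfolding h_def by (rule U(2)[OF star_in_A u])
  have "star h \<star> h = star u \<star> (u \<star> h)"
    unfolding h_def star_conv_self by (rule conv_assoc)
  also have "\<dots> = 0" by (simp only: sq[OF u h] conv_zero)
  finally have "h = 0" by (rule star_conv_self_eq_0[OF subsetD[OF U(1) h]])
  then show ?thesis unfolding h_def by (rule star_conv_self_eq_0[OF subsetD[OF U(1) u]])
qed

lemma A_subset_span: "A \<subseteq> cfun.span (delta ` P)"
proof
  fix f assume f: "f \<in> A"
  show "f \<in> cfun.span (delta ` P)"
    by (rule in_span_deltas[OF finite_P]) (use f in \<open>simp add: A_iff\<close>)
qed

lemma carrier_sym_group: "carrier (sym_group n) = P"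
  by (simp add: sym_group_def P_def)

lemma fun_rep_left_ideal:
  assumes "cfun.subspace U" "U \<subseteq> A" "\<And>f u. f \<in> A \<Longrightarrow> u \<in> U \<Longrightarrow> f \<star> u \<in> U"
  shows "fun_rep (sym_group n) U (\<lambda>g. convolution n (delta g))"
  unfolding fun_rep_def carrier_sym_group sym_group_mult sym_group_one
proof (intro conjI ballI)
  fix g h u assume g: "g \<in> P" and h: "h \<in> P" and u: "u \<in> U"
  show "delta (g \<circ> h) \<star> u = delta g \<star> (delta h \<star> u)"
    by (simp only: delta_mult[OF g h, symmetric] conv_assoc)
next
  fix u assume "u \<in> U"
  then show "delta id \<star> u = u" using assms(2) conv_delta_id(2) by blast
qed (use assms clinear_conv_right delta_in_A in auto)

text \<open>The linear extension of \<open>\<chi>\<close> to the group algebra is cyclic because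
  \<open>y \<circ> z\<close> and \<open>z \<circ> y\<close> are conjugate.\<close>

lemma class_function_trace:
  assumes \<chi>: "\<chi> \<in> Irr (sym_group n)"
  shows "(\<Sum>x\<in>P. (f \<star> g) x * \<chi> x) = (\<Sum>x\<in>P. (g \<star> f) x * \<chi> x)"
proof -
  have expand: "(\<Sum>x\<in>P. (f \<star> g) x * \<chi> x) = (\<Sum>y\<in>P. \<Sum>z\<in>P. f y * g z * \<chi> (y \<circ> z))" for f g
  proof -
    have "(\<Sum>x\<in>P. (f \<star> g) x * \<chi> x) = (\<Sum>x\<in>P. \<Sum>y\<in>P. f y * g (inv' y \<circ> x) * \<chi> x)"
      by (intro sum.cong refl) (simp only: conv_apply sum_distrib_right)
    also have "\<dots> = (\<Sum>y\<in>P. \<Sum>x\<in>P. f y * g (inv' y \<circ> x) * \<chi> x)" by (rule sum.swap)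
    also have "\<dots> = (\<Sum>y\<in>P. \<Sum>z\<in>P. f y * g z * \<chi> (y \<circ> z))"
    proof (rule sum.cong[OF refl])
      fix y assume y: "y \<in> P"
      have "(\<Sum>x\<in>P. f y * g (inv' y \<circ> x) * \<chi> x) = (\<Sum>z\<in>P. f y * g (inv' y \<circ> (y \<circ> z)) * \<chi> (y \<circ> z))"
        by (rule sum_P_left[OF y, symmetric])
      then show "(\<Sum>x\<in>P. f y * g (inv' y \<circ> x) * \<chi> x) = (\<Sum>z\<in>P. f y * g z * \<chi> (y \<circ> z))"
        by (simp only: P_cancel(1)[OF y])
    qed
    finally show ?thesis .
  qed
  have comm: "\<chi> (y \<circ> z) = \<chi> (z \<circ> y)" if y: "y \<in> P" and z: "z \<in> P" for y z
  proof -
    have "inv\<^bsub>sym_group n\<^esub> y = inv' y" using y by (intro sym_group_inv_equality) (simp add: carrier_sym_group)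
    then have "\<chi> (y \<circ> (z \<circ> y) \<circ> inv' y) = \<chi> (z \<circ> y)"
      using Irr_conj[OF sym_group_is_group \<chi>, of y "z \<circ> y"] y P_closed(1)[OF z y]
      by (simp add: carrier_sym_group sym_group_mult)
    moreover have "y \<circ> (z \<circ> y) \<circ> inv' y = y \<circ> z"
      by (simp only: comp_assoc P_inv(2)[OF y] comp_id)
    ultimately show ?thesis by simp
  qed
  have "(\<Sum>x\<in>P. (f \<star> g) x * \<chi> x) = (\<Sum>z\<in>P. \<Sum>y\<in>P. f y * g z * \<chi> (y \<circ> z))"
    unfolding expand by (rule sum.swap)
  also have "\<dots> = (\<Sum>x\<in>P. (g \<star> f) x * \<chi> x)"
    unfolding expand by (intro sum.cong refl) (simp add: comm mult.commute)
  finally show ?thesis .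
qed

text \<open>The automorphism of the group algebra that multiplies each group element by its sign. It
  exchanges row sums with column sums of the transposed filling.\<close>

definition sgn_mult :: "((nat \<Rightarrow> nat) \<Rightarrow> complex) \<Rightarrow> (nat \<Rightarrow> nat) \<Rightarrow> complex" where
  "sgn_mult f = (\<lambda>p. of_int (sign p) * f p)"

lemma sgn_mult_in_A: "f \<in> A \<Longrightarrow> sgn_mult f \<in> A"
  by (simp add: A_iff sgn_mult_def)

lemma sgn_mult_conv: "sgn_mult (f \<star> g) = sgn_mult f \<star> sgn_mult g"
proof (rule A_eqI[OF sgn_mult_in_A[OF conv_in] conv_in])
  fix x assume x: "x \<in> P"
  have "of_int (sign x) * (f y * g (inv' y \<circ> x)) = sgn_mult f y * sgn_mult g (inv' y \<circ> x)" if y: "y \<in> P" for y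
  proof -
    have "sign x = sign y * sign (inv' y \<circ> x)"
      using sign_P(1)[OF y P_closed(1)[OF P_closed(2)[OF y] x]] P_cancel(2)[OF y] by simp
    then show ?thesis by (simp add: sgn_mult_def)
  qed
  then show "sgn_mult (f \<star> g) x = (sgn_mult f \<star> sgn_mult g) x"
    by (simp add: sgn_mult_def[of "f \<star> g"] conv_apply[OF x] sum_distrib_left)
qed

lemma sgn_mult_row_sum: "sgn_mult (row_sum t) = col_sum (prod.swap \<circ> t)"
  by (rule ext) (simp add: sgn_mult_def row_sum_def col_sum_def cut_def stab_def)

lemma sgn_mult_col_sum: "sgn_mult (col_sum t) = row_sum (prod.swap \<circ> t)"
proof
  fix p :: "nat \<Rightarrow> nat"
  have "of_int (sign p) * of_int (sign p) = (1 :: complex)"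
    by (metis of_int_1 of_int_mult sign_idempotent)
  then show "sgn_mult (col_sum t) p = row_sum (prod.swap \<circ> t) p"
    by (simp add: sgn_mult_def row_sum_def col_sum_def cut_def stab_def)
qed

end

section \<open>Irreducibility of Specht modules and traces on them\<close>

locale specht = symmetric_algebra +
  fixes D :: "(nat \<times> nat) set" and t :: "nat \<Rightarrow> nat \<times> nat"
  assumes young: "young D" and filling: "filling D t"
begin

definition e where "e = row_sum t \<star> col_sum t"

definition V where "V = (\<lambda>f. f \<star> e) ` A"

definition chi where "chi = cut P (\<lambda>g. lin_trace V (convolution n (delta g)))"

lemma e_in_A: "e \<in> A"
  by (simp add: e_def conv_in)

lemma e_id: "e id = 1"
  by (simp add: e_def row_col_id[OF filling])

lemma e_nonzero: "e \<noteq> 0"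
  using e_id by auto

lemma V_sub: "V \<subseteq> A"
  by (auto simp: V_def conv_in)

lemma e_in_V: "e \<in> V"
  unfolding V_def
  by (rule image_eqI[of _ _ "delta id"]) (simp_all only: conv_delta_id(2)[OF e_in_A] delta_in_A P_closed(3))

lemma subspace_V: "cfun.subspace V"
  unfolding V_def by (rule clinear_subspace_image[OF clinear_conv_left subspace_A])

lemma V_ideal: "v \<in> V \<Longrightarrow> f \<star> v \<in> V"
  unfolding V_def by (auto simp: conv_assoc[symmetric] conv_in)

lemma e_scalar: "v \<in> V \<Longrightarrow> \<exists>c. e \<star> v = cscale c e"
proof -
  assume "v \<in> V"
  then obtain f where "v = f \<star> e" by (auto simp: V_def)
  then have "e \<star> v = row_sum t \<star> (col_sum t \<star> (f \<star> row_sum t)) \<star> col_sum t"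
    by (simp only: e_def conv_assoc)
  then show ?thesis using row_conv_col_scalar[OF filling young conv_in] unfolding e_def by simp
qed

text \<open>Elements of \<open>U\<close> have \<open>e\<close> as a right factor, so if
  \<open>e\<close> annihilates \<open>U\<close> then all products in \<open>U\<close> vanish and
  positivity gives \<open>U = {0}\<close>. Otherwise some \<open>e \<star> u\<close> is a nonzero
  multiple of \<open>e\<close>, and \<open>e\<close> generates \<open>V\<close>.\<close>

lemma ideal_zero_or_V:
  assumes U: "cfun.subspace U" "U \<subseteq> V" "\<And>f u. f \<in> A \<Longrightarrow> u \<in> U \<Longrightarrow> f \<star> u \<in> U"
  shows "(\<forall>u\<in>U. e \<star> u = 0) \<and> U = {0} \<or> U = V"
proof (cases "\<forall>u\<in>U. e \<star> u = 0")
  case True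
  have sq: "u \<star> v = 0" if u: "u \<in> U" and v: "v \<in> U" for u v
  proof -
    obtain f where f: "u = f \<star> e" using u U(2) unfolding V_def by blast
    have "e \<star> v = 0" using True v by blast
    then show ?thesis by (simp only: f conv_assoc conv_zero)
  qed
  have "u = 0" if "u \<in> U" for u
    by (rule left_ideal_square_zero[OF subset_trans[OF U(2) V_sub] U(3) sq that])
  then show ?thesis using True cfun.subspace_0[OF U(1)] by blast
next
  case False
  then obtain u where u: "u \<in> U" "e \<star> u \<noteq> 0" by blast
  obtain c where c: "e \<star> u = cscale c e" using e_scalar u(1) U(2) by blast
  then have "c \<noteq> 0" using u(2) by auto
  then have "e = cscale (inverse c) (e \<star> u)" by (simp add: c cfun.scale_scale)
  then have "e \<in> U" using cfun.subspace_scale[OF U(1) U(3)[OF e_in_A u(1)]] by metis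
  then have "V \<subseteq> U" using U(3) by (auto simp: V_def)
  then show ?thesis using U(2) by blast
qed

lemma irreducible_V: "irreducible_fun_rep (sym_group n) V (\<lambda>g. convolution n (delta g))"
  unfolding irreducible_fun_rep_def
proof (intro conjI allI impI)
  show "fun_rep (sym_group n) V (\<lambda>g. convolution n (delta g))"
    by (rule fun_rep_left_ideal[OF subspace_V V_sub V_ideal])
  show "V \<noteq> {0}" using e_in_V e_nonzero by blast
  fix U assume "invariant_subspace (sym_group n) V (\<lambda>g. convolution n (delta g)) U"
  then have U: "cfun.subspace U" "U \<subseteq> V" "\<And>p u. p \<in> P \<Longrightarrow> u \<in> U \<Longrightarrow> delta p \<star> u \<in> U"
    by (auto simp: invariant_subspace_def carrier_sym_group)
  have "f \<star> u \<in> U" if "f \<in> A" "u \<in> U" for f u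
    unfolding conv_expand_left[OF that(1)]
    by (intro cfun.subspace_sum[OF U(1)] cfun.subspace_scale[OF U(1)] U(3) that(2))
  then show "U = {0} \<or> U = V" using ideal_zero_or_V[OF U(1,2)] by blast
qed

lemma basis_V: obtains b where "finite b" "cfun.independent b" "cfun.span b = V"
  using finite_basis_exists[OF subspace_V _ finite_imageI[OF finite_P]] V_sub A_subset_span by blast

lemma chi_eq_basis_trace:
  assumes "finite b" "cfun.independent b" "cfun.span b = V"
  shows "chi = cut P (\<lambda>g. basis_trace b (convolution n (delta g)))"
  unfolding chi_def using lin_trace_eq_basis_trace[OF assms clinear_conv_right V_ideal] by simp

lemma chi_Irr: "chi \<in> Irr (sym_group n)"
proof -
  obtain b where b: "finite b" "cfun.independent b" "cfun.span b = V" by (rule basis_V)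
  show ?thesis
    using irreducible_fun_rep_char[OF sym_group_is_group irreducible_V b]
    by (simp add: carrier_sym_group chi_eq_basis_trace[OF b])
qed

text \<open>The linear extension of \<open>chi\<close> to the group algebra, which is the trace of
  left multiplication on \<open>V\<close>. It depends on the character only, so it can be shared by
  different fillings.\<close>

definition tr where "tr f = (\<Sum>g\<in>P. f g * chi g)"

lemma tr_eq_basis_trace:
  assumes b: "finite b" "cfun.independent b" "cfun.span b = V" and f: "f \<in> A"
  shows "tr f = basis_trace b (convolution n f)"
proof -
  have inV: "delta g \<star> v \<in> cfun.span b" if "v \<in> b" for g v
    using that b(3) V_ideal cfun.span_base by blast
  have "basis_trace b (convolution n f) = (\<Sum>v\<in>b. \<Sum>g\<in>P. f g * cfun.representation b (delta g \<star> v) v)"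
    unfolding basis_trace_def
  proof (intro sum.cong refl)
    fix v assume v: "v \<in> b"
    have "cfun.representation b (f \<star> v) = (\<lambda>w. \<Sum>g\<in>P. cfun.representation b (cscale (f g) (delta g \<star> v)) w)"
      unfolding conv_expand_left[OF f]
      by (rule cfun.representation_sum[OF b(2)]) (rule cfun.span_scale[OF inV[OF v]])
    then show "cfun.representation b (f \<star> v) v = (\<Sum>g\<in>P. f g * cfun.representation b (delta g \<star> v) v)"
      by (simp add: cfun.representation_scale[OF b(2) inV[OF v]])
  qed
  also have "\<dots> = (\<Sum>g\<in>P. f g * basis_trace b (convolution n (delta g)))"
    unfolding basis_trace_def sum_distrib_left by (rule sum.swap)
  also have "\<dots> = tr f"
    unfolding tr_def chi_eq_basis_trace[OF b] by (intro sum.cong refl) (simp add: cut_def)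
  finally show ?thesis by (rule sym)
qed

lemma tr_zero:
  assumes "f \<in> A" "\<And>v. v \<in> V \<Longrightarrow> f \<star> v = 0"
  shows "tr f = 0"
proof -
  obtain b where b: "finite b" "cfun.independent b" "cfun.span b = V" by (rule basis_V)
  have "f \<star> v = 0" if "v \<in> b" for v using assms(2) b(3) that cfun.span_base by blast
  then show ?thesis
    by (simp add: tr_eq_basis_trace[OF b assms(1)] basis_trace_def cfun.representation_zero)
qed

text \<open>Left multiplication by this product annihilates \<open>V\<close>: the elements of
  \<open>V\<close> end with \<open>row_sum t \<star> col_sum t\<close>, and \<open>row_sum s\<close>
  with \<open>col_sum t\<close> already gives zero, whatever stands between them.\<close>

lemma tr_row_sum_zero:
  assumes s: "filling E s" and nd: "\<not> dominated E D"
  shows "tr (row_sum s \<star> f) = 0"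
proof (rule tr_zero[OF conv_in])
  fix v assume "v \<in> V"
  then obtain g where "v = g \<star> e" by (auto simp: V_def)
  then have "row_sum s \<star> f \<star> v = row_sum s \<star> (f \<star> (g \<star> row_sum t)) \<star> col_sum t"
    by (simp only: e_def conv_assoc)
  then show "row_sum s \<star> f \<star> v = 0" by (simp only: not_dominated_zero(1)[OF s filling young nd conv_in])
qed

lemma tr_col_sum_zero:
  assumes s: "filling E s" "young E" and nd: "\<not> dominated D E"
  shows "tr (col_sum s \<star> f) = 0"
proof (rule tr_zero[OF conv_in])
  fix v assume "v \<in> V"
  then obtain g where "v = g \<star> e" by (auto simp: V_def)
  then have "col_sum s \<star> f \<star> v = (col_sum s \<star> (f \<star> g) \<star> row_sum t) \<star> col_sum t"
    by (simp only: e_def conv_assoc)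
  moreover have "col_sum s \<star> (f \<star> g) \<star> row_sum t = 0" by (rule not_dominated_zero(2)[OF filling s nd conv_in])
  ultimately show "col_sum s \<star> f \<star> v = 0" by (simp only: conv_zero)
qed

text \<open>Left multiplication by \<open>e \<star> f\<close> has rank at most one, with image spanned by \<open>e\<close>, so its trace is
  its eigenvalue at \<open>e\<close>.\<close>

lemma tr_nonzero: "\<exists>f\<in>A. tr (e \<star> f) \<noteq> 0"
proof -
  have "\<exists>v\<in>V. e \<star> v \<noteq> 0"
  proof (rule ccontr)
    assume *: "\<not> (\<exists>v\<in>V. e \<star> v \<noteq> 0)"
    have sq: "u \<star> v = 0" if u: "u \<in> V" and v: "v \<in> V" for u v
    proof -
      obtain f where f: "u = f \<star> e" using u unfolding V_def by blast
      have "e \<star> v = 0" using * v by blast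
      then show ?thesis by (simp only: f conv_assoc conv_zero)
    qed
    have "e = 0" by (rule left_ideal_square_zero[OF V_sub V_ideal sq e_in_V])
    then show False using e_nonzero by blast
  qed
  then obtain f where f: "f \<in> A" "e \<star> (f \<star> e) \<noteq> 0" by (auto simp: V_def)
  obtain b where b: "finite b" "cfun.independent b" "cfun.span b = V" by (rule basis_V)
  have bV: "v \<in> V" if "v \<in> b" for v using that b(3) cfun.span_base by blast
  \<comment> \<open>The factor by which \<open>(e \<star> f) \<star> v\<close> is a multiple of
    \<open>e\<close>, read off at \<open>id\<close>, where \<open>e\<close> has the value 1.\<close>
  define \<phi> where "\<phi> v = ((e \<star> f) \<star> v) id" for v
  have \<phi>: "(e \<star> f) \<star> v = cscale (\<phi> v) e" if v: "v \<in> V" for v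
  proof -
    obtain c where c: "(e \<star> f) \<star> v = cscale c e"
      using e_scalar[OF V_ideal[OF v]] unfolding conv_assoc by blast
    have "\<phi> v = c" unfolding \<phi>_def c by (simp add: cscale_def e_id)
    then show ?thesis using c by simp
  qed
  have "tr (e \<star> f) = (\<Sum>v\<in>b. \<phi> v * cfun.representation b e v)"
    unfolding tr_eq_basis_trace[OF b conv_in] basis_trace_def
    by (intro sum.cong refl) (use e_in_V b(3) in \<open>simp add: \<phi>[OF bV] cfun.representation_scale[OF b(2)]\<close>)
  also have "\<dots> = \<phi> e"
  proof -
    have "(e \<star> f) \<star> e = (e \<star> f) \<star> (\<Sum>v\<in>b. cscale (cfun.representation b e v) v)"
      using cfun.sum_representation_eq[OF b(2) _ b(1) subset_refl, of e] e_in_V b(3) by simp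
    also have "\<dots> = (\<Sum>v\<in>b. cscale (cfun.representation b e v) (cscale (\<phi> v) e))"
      by (simp add: clinear_sum[OF clinear_conv_right] conv_scale \<phi>[OF bV])
    finally have "((e \<star> f) \<star> e) id = (\<Sum>v\<in>b. cscale (cfun.representation b e v) (cscale (\<phi> v) e)) id"
      by simp
    then show ?thesis
      unfolding \<phi>[OF e_in_V] sum_fun_apply by (simp add: cscale_def e_id mult.commute)
  qed
  finally have "tr (e \<star> f) = \<phi> e" .
  moreover have "\<phi> e \<noteq> 0" using f(2) \<phi>[OF e_in_V] by (auto simp: conv_assoc)
  ultimately have "tr (e \<star> f) \<noteq> 0" by simp
  then show ?thesis using f(1) by (rule bexI)
qed

text \<open>Multiplication by the sign exchanges row and column sums, and the character determines in
  dominance order which of these have nonzero trace.\<close>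

lemma self_associated_symmetric:
  assumes "\<And>p. p \<in> P \<Longrightarrow> of_int (sign p) * chi p = chi p"
  shows "prod.swap ` D = D"
proof -
  have sgn: "tr (sgn_mult f) = tr f" for f
  proof -
    have eq: "sgn_mult f p * chi p = f p * chi p" if "p \<in> P" for p
      using assms[OF that] by (simp add: sgn_mult_def mult_ac)
    show ?thesis unfolding tr_def by (rule sum.cong[OF refl eq])
  qed
  have young': "young (prod.swap ` D)"
    unfolding young_def
  proof (intro conjI allI impI)
    show "finite (prod.swap ` D)" using young by (simp add: young_def)
    fix i j i' j' assume "(i, j) \<in> prod.swap ` D" "i' \<le> i" "j' \<le> j"
    then have "(j', i') \<in> D" using youngD[OF young, of j i] by auto
    then show "(i', j') \<in> prod.swap ` D" by (rule rev_image_eqI) simp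
  qed
  have filling': "filling (prod.swap ` D) (prod.swap \<circ> t)"
    using filling unfolding filling_def
    by (rule bij_betw_trans) (auto simp: bij_betw_def inj_on_def)
  obtain f where f: "tr (e \<star> f) \<noteq> 0" using tr_nonzero by blast
  then have "tr (row_sum t \<star> (col_sum t \<star> f)) \<noteq> 0" by (simp add: e_def conv_assoc)
  then have "tr (col_sum (prod.swap \<circ> t) \<star> sgn_mult (col_sum t \<star> f)) \<noteq> 0"
    unfolding sgn_mult_row_sum[symmetric] sgn_mult_conv[symmetric] sgn .
  then have 1: "dominated D (prod.swap ` D)" using tr_col_sum_zero[OF filling' young'] by blast
  \<comment> \<open>The vanishing results need the sum as leftmost factor; cyclicity moves
    \<open>row_sum t\<close> to the end so that \<open>col_sum t\<close> leads.\<close>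
  have "tr (row_sum t \<star> (col_sum t \<star> f)) = tr ((col_sum t \<star> f) \<star> row_sum t)"
    unfolding tr_def by (rule class_function_trace[OF chi_Irr])
  then have "tr (col_sum t \<star> (f \<star> row_sum t)) \<noteq> 0" using f by (simp add: e_def conv_assoc)
  then have "tr (row_sum (prod.swap \<circ> t) \<star> sgn_mult (f \<star> row_sum t)) \<noteq> 0"
    unfolding sgn_mult_col_sum[symmetric] sgn_mult_conv[symmetric] sgn .
  then have 2: "dominated (prod.swap ` D) D" using tr_row_sum_zero[OF filling'] by blast
  show ?thesis by (rule young_dominated_antisym[OF young' young 2 1])
qed

end

text \<open>Some product led by \<open>row_sum t\<close> has nonzero trace on its own Specht module.
  Equal characters give equal \<open>tr\<close>, so the trace on the other module is nonzero too,
  which is possible only under dominance.\<close>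

lemma specht_chi_dominated:
  assumes S: "specht n D t" and S': "specht n E s" and eq: "specht.chi n t = specht.chi n s"
  shows "dominated D E"
proof -
  interpret S: specht n D t by fact
  interpret S': specht n E s by fact
  obtain f where "S.tr (convolution n S.e f) \<noteq> 0" using S.tr_nonzero by blast
  then have "S.tr (convolution n (S.row_sum t) (convolution n (S.col_sum t) f)) \<noteq> 0"
    by (simp only: S.e_def S.conv_assoc not_False_eq_True)
  moreover have "S.tr = S'.tr" by (rule ext) (simp only: S.tr_def S'.tr_def eq)
  ultimately show ?thesis using S'.tr_row_sum_zero[OF S.filling] by metis
qed

section \<open>Cycle types\<close>

text \<open>Forward iterates only: for a permutation moving finitely many points they already fill
  the whole cycle.\<close>

definition orb :: "('a \<Rightarrow> 'a) \<Rightarrow> 'a \<Rightarrow> 'a set" where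
  "orb p x = range (\<lambda>i. (p ^^ i) x)"

lemma orb_iff: "y \<in> orb p x \<longleftrightarrow> (\<exists>k. y = (p ^^ k) x)"
  by (auto simp: orb_def)

lemma orb_subset:
  assumes "p permutes S" "x \<in> S"
  shows "orb p x \<subseteq> S"
proof
  fix y assume "y \<in> orb p x"
  then obtain k where "y = (p ^^ k) x" unfolding orb_iff by blast
  then show "y \<in> S" using permutes_in_image[OF permutes_funpow[OF assms(1)]] assms(2) by simp
qed

lemma orb_self: "x \<in> orb p x"
  unfolding orb_def by (rule range_eqI[of _ _ 0]) simp

lemma card_orb:
  assumes "permutation p"
  shows "card (orb p x) = least_power p x" "finite (orb p x)"
proof -
  have eq: "orb p x = set (support p x)" unfolding orb_def by (rule support_set[OF assms, symmetric])
  show "card (orb p x) = least_power p x"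
    unfolding eq distinct_card[OF cycle_of_permutation[OF assms]] by simp
  show "finite (orb p x)" unfolding eq by simp
qed

lemma orb_eq_if_meet:
  assumes "permutation p" "z \<in> orb p x" "z \<in> orb p y"
  shows "orb p x = orb p y"
proof (rule ccontr)
  assume neq: "orb p x \<noteq> orb p y"
  have range: "orb p x \<in> range (\<lambda>a. set (support p a))" for x
    unfolding orb_def support_set[OF assms(1), symmetric] by (rule rangeI)
  have "orb p x \<inter> orb p y = {}"
    by (rule disjointD[OF disjoint_support[OF assms(1)] range range neq])
  then show False using assms(2,3) by blast
qed

lemma orb_funpow:
  assumes "permutation p"
  shows "orb p ((p ^^ k) x) = orb p x"
proof (rule orb_eq_if_meet[OF assms orb_self])
  show "(p ^^ k) x \<in> orb p x" unfolding orb_def by (rule rangeI)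
qed

lemma funpow_eq_funpow_iff:
  assumes p: "permutation p"
  shows "(p ^^ k) x = (p ^^ l) x \<longleftrightarrow> k mod card (orb p x) = l mod card (orb p x)"
proof -
  have *: "(p ^^ k) x = (p ^^ l) x \<longleftrightarrow> k mod card (orb p x) = l mod card (orb p x)" if "k \<le> l" for k l
  proof -
    have "(p ^^ k) x = (p ^^ l) x \<longleftrightarrow> (p ^^ (l - k)) x = x"
    proof
      assume "(p ^^ k) x = (p ^^ l) x"
      then show "(p ^^ (l - k)) x = x"
        using funpow_diff[OF bij_is_inj[OF permutation_bijective[OF p]] that] by blast
    next
      assume "(p ^^ (l - k)) x = x"
      then have "(p ^^ k) x = (p ^^ k) ((p ^^ (l - k)) x)" by simp
      also have "\<dots> = (p ^^ (k + (l - k))) x" by (simp only: funpow_add o_apply)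
      finally show "(p ^^ k) x = (p ^^ l) x" using that by simp
    qed
    also have "\<dots> \<longleftrightarrow> card (orb p x) dvd l - k"
      by (simp only: card_orb(1)[OF p] least_power_dvd[OF p])
    also have "\<dots> \<longleftrightarrow> l mod card (orb p x) = k mod card (orb p x)"
      by (rule mod_eq_dvd_iff_nat[OF that, symmetric])
    finally show ?thesis by (simp only: eq_commute)
  qed
  show ?thesis using *[of k l] *[of l k] by (cases "k \<le> l") (auto simp only: eq_commute nat_le_linear)
qed

text \<open>The cycles form a set, so each is counted once; fixed points are cycles of length 1, and
  the parts add up to \<open>n\<close>.\<close>

definition cycle_type :: "nat \<Rightarrow> (nat \<Rightarrow> nat) \<Rightarrow> nat multiset" where
  "cycle_type n p = image_mset card (mset_set (orb p ` {1..n}))"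

lemma count_cycle_type: "count (cycle_type n p) k = card {Q \<in> orb p ` {1..n}. card Q = k}"
proof -
  have "count (cycle_type n p) k = (\<Sum>Q | Q \<in># mset_set (orb p ` {1..n}) \<and> k = card Q. count (mset_set (orb p ` {1..n})) Q)"
    unfolding cycle_type_def by (rule count_image_mset')
  also have "\<dots> = (\<Sum>Q\<in>{Q \<in> orb p ` {1..n}. card Q = k}. 1)"
    by (rule sum.cong) auto
  finally show ?thesis by simp
qed

text \<open>Cycles of \<open>p\<close> are matched with cycles of \<open>q\<close> of the same
  length by \<open>F\<close>, with base points \<open>b Q\<close> and \<open>c Q\<close>; then
  \<open>\<tau>\<close> sends the \<open>k\<close>-th iterate of the first to the
  \<open>k\<close>-th iterate of the second.\<close>

lemma conjugate_if_cycle_type_eq: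
  assumes p: "p permutes {1..n}" and q: "q permutes {1..n}" and eq: "cycle_type n p = cycle_type n q"
  shows "\<exists>\<tau>. \<tau> permutes {1..n} \<and> q = \<tau> \<circ> p \<circ> inv' \<tau>"
proof -
  let ?X = "{1..n}"
  let ?Op = "orb p ` ?X" and ?Oq = "orb q ` ?X"
  have pp: "permutation p" and qq: "permutation q" using p q by (auto simp: permutation_permutes)
  \<comment> \<open>Equal multiplicities give one bijection for each cycle length \<open>k\<close>;
    \<open>F\<close> glues these together.\<close>
  define h where "h k = (SOME h. bij_betw h {Q \<in> ?Op. card Q = k} {Q \<in> ?Oq. card Q = k})" for k
  have "\<exists>h. bij_betw h {Q \<in> ?Op. card Q = k} {Q \<in> ?Oq. card Q = k}" for k
    by (rule finite_same_card_bij, simp, simp, simp only: count_cycle_type[symmetric] eq)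
  then have h: "bij_betw (h k) {Q \<in> ?Op. card Q = k} {Q \<in> ?Oq. card Q = k}" for k
    unfolding h_def by (rule someI_ex)
  define F where "F Q = h (card Q) Q" for Q
  have F: "F Q \<in> ?Oq \<and> card (F Q) = card Q" if "Q \<in> ?Op" for Q
  proof -
    have "h (card Q) Q \<in> h (card Q) ` {Q' \<in> ?Op. card Q' = card Q}" using that by blast
    then show ?thesis using h[of "card Q"] unfolding bij_betw_def F_def by blast
  qed
  have F_inj: "Q = Q'" if Q: "Q \<in> ?Op" "Q' \<in> ?Op" "F Q = F Q'" for Q Q'
  proof -
    have c: "card Q = card Q'" using F Q by metis
    then have "h (card Q) Q = h (card Q) Q'" using Q(3) by (simp add: F_def)
    then show ?thesis using bij_betw_imp_inj_on[OF h[of "card Q"]] Q(1,2) c by (auto dest: inj_onD)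
  qed
  define b where "b Q = inv_into ?X (orb p) Q" for Q
  define c where "c Q = inv_into ?X (orb q) (F Q)" for Q
  have b: "b Q \<in> ?X" "orb p (b Q) = Q" if "Q \<in> ?Op" for Q
    using that unfolding b_def by (rule inv_into_into, rule f_inv_into_f)
  have c: "c Q \<in> ?X" "orb q (c Q) = F Q" if "Q \<in> ?Op" for Q
    using F[OF that, THEN conjunct1] unfolding c_def by (rule inv_into_into, rule f_inv_into_f)
  have p_in: "(p ^^ k) x \<in> ?X" if "x \<in> ?X" for k x
    using permutes_in_image[OF permutes_funpow[OF p]] that by blast
  have q_in: "(q ^^ k) x \<in> ?X" if "x \<in> ?X" for k x
    using permutes_in_image[OF permutes_funpow[OF q]] that by blast
  \<comment> \<open>The exponent is determined only modulo the cycle length. As matched cycles have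
    equal length, \<open>\<tau>\<close> is independent of the choice, which is the content of
    \<open>\<tau>_funpow\<close>.\<close>
  define \<kappa> where "\<kappa> x = (SOME k. (p ^^ k) (b (orb p x)) = x)" for x
  define \<tau> where "\<tau> x = (if x \<in> ?X then (q ^^ \<kappa> x) (c (orb p x)) else x)" for x
  have \<kappa>: "(p ^^ \<kappa> x) (b (orb p x)) = x" if "x \<in> ?X" for x
  proof -
    have "x \<in> orb p (b (orb p x))" using b(2)[OF imageI[OF that]] orb_self by metis
    then obtain k where "x = (p ^^ k) (b (orb p x))" unfolding orb_iff by blast
    from this[symmetric] show ?thesis unfolding \<kappa>_def by (rule someI)
  qed
  have \<tau>_funpow: "\<tau> ((p ^^ k) (b Q)) = (q ^^ k) (c Q)" if Q: "Q \<in> ?Op" for Q k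
  proof -
    let ?x = "(p ^^ k) (b Q)"
    have x: "?x \<in> ?X" by (rule p_in[OF b(1)[OF Q]])
    have ox: "orb p ?x = Q" using orb_funpow[OF pp] b(2)[OF Q] by simp
    have "(p ^^ \<kappa> ?x) (b Q) = (p ^^ k) (b Q)" using \<kappa>[OF x] unfolding ox .
    then have "\<kappa> ?x mod card Q = k mod card Q"
      unfolding funpow_eq_funpow_iff[OF pp] b(2)[OF Q] .
    then have "(q ^^ \<kappa> ?x) (c Q) = (q ^^ k) (c Q)"
      unfolding funpow_eq_funpow_iff[OF qq] c(2)[OF Q] using F[OF Q] by simp
    then show ?thesis using x by (simp only: \<tau>_def if_True ox)
  qed
  have rep: "\<exists>Q\<in>?Op. \<exists>k. x = (p ^^ k) (b Q)" if "x \<in> ?X" for x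
    by (intro bexI[of _ "orb p x"] exI[of _ "\<kappa> x"] imageI that) (rule \<kappa>[OF that, symmetric])
  have \<tau>_in: "\<tau> ` ?X \<subseteq> ?X"
    using q_in c(1) by (auto simp: \<tau>_def simp del: atLeastAtMost_iff)
  have "inj_on \<tau> ?X"
  proof (rule inj_onI)
    fix x y assume x: "x \<in> ?X" and y: "y \<in> ?X" and xy: "\<tau> x = \<tau> y"
    obtain Q k where Q: "Q \<in> ?Op" "x = (p ^^ k) (b Q)" using rep[OF x] by blast
    obtain Q' l where Q': "Q' \<in> ?Op" "y = (p ^^ l) (b Q')" using rep[OF y] by blast
    have eq: "(q ^^ k) (c Q) = (q ^^ l) (c Q')"
      using xy unfolding Q(2) Q'(2) \<tau>_funpow[OF Q(1)] \<tau>_funpow[OF Q'(1)] .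
    have "F Q = orb q ((q ^^ k) (c Q))" using orb_funpow[OF qq] c(2)[OF Q(1)] by simp
    also have "\<dots> = F Q'" unfolding eq using orb_funpow[OF qq] c(2)[OF Q'(1)] by simp
    finally have OO: "Q = Q'" by (rule F_inj[OF Q(1) Q'(1)])
    have "k mod card (F Q) = l mod card (F Q)"
      using eq unfolding OO[symmetric] funpow_eq_funpow_iff[OF qq] c(2)[OF Q(1)] .
    then have "(p ^^ k) (b Q) = (p ^^ l) (b Q)"
      unfolding funpow_eq_funpow_iff[OF pp] b(2)[OF Q(1)] using F[OF Q(1)] by simp
    then show "x = y" using Q(2) Q'(2) OO by simp
  qed
  then have "bij_betw \<tau> ?X ?X"
    using endo_inj_surj[OF finite_atLeastAtMost \<tau>_in] unfolding bij_betw_def by blast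
  then have \<tau>: "\<tau> permutes ?X" by (rule bij_imp_permutes) (simp only: \<tau>_def if_False)
  have "q (\<tau> x) = \<tau> (p x)" for x
  proof (cases "x \<in> ?X")
    case True
    then obtain Q k where Q: "Q \<in> ?Op" "x = (p ^^ k) (b Q)" using rep by blast
    have "\<tau> (p x) = \<tau> ((p ^^ Suc k) (b Q))" unfolding Q(2) by simp
    also have "\<dots> = q (\<tau> x)" unfolding Q(2) \<tau>_funpow[OF Q(1)] by simp
    finally show ?thesis by (rule sym)
  next
    case False
    then have "p x = x" "q x = x" "\<tau> x = x"
      using permutes_not_in[OF p] permutes_not_in[OF q] permutes_not_in[OF \<tau>] by blast+
    then show ?thesis by simp
  qed
  then have "q \<circ> \<tau> = \<tau> \<circ> p" by (simp add: fun_eq_iff)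
  then have "q \<circ> \<tau> \<circ> inv' \<tau> = \<tau> \<circ> p \<circ> inv' \<tau>" by simp
  then have "q = \<tau> \<circ> p \<circ> inv' \<tau>" by (simp add: comp_assoc permutes_inv_o(1)[OF \<tau>])
  then show ?thesis using \<tau> by blast
qed

definition type_partition :: "nat \<Rightarrow> (nat \<Rightarrow> nat) \<Rightarrow> nat list" where
  "type_partition n p = rev (sorted_list_of_multiset (cycle_type n p))"

lemma mset_type_partition: "mset (type_partition n p) = cycle_type n p"
  by (simp add: type_partition_def)

lemma type_partition_is_partition:
  assumes p: "p permutes {1..n}"
  shows "is_partition (type_partition n p) n"
proof -
  have pp: "permutation p" using p by (auto simp: permutation_permutes)
  have "sorted_wrt (\<ge>) (type_partition n p)"
    unfolding type_partition_def sorted_wrt_rev by (rule sorted_sorted_list_of_multiset)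
  moreover have "0 \<notin> set (type_partition n p)"
  proof
    assume "0 \<in> set (type_partition n p)"
    then have "0 \<in># cycle_type n p" by (metis mset_type_partition set_mset_mset)
    then obtain x where "card (orb p x) = 0" by (auto simp: cycle_type_def)
    then show False using card_orb(2)[OF pp] orb_self[of x p] by auto
  qed
  moreover have "sum_list (type_partition n p) = n"
  proof -
    have "sum_list (type_partition n p) = sum_mset (cycle_type n p)"
      by (metis mset_type_partition sum_mset_sum_list)
    also have "\<dots> = (\<Sum>Q\<in>orb p ` {1..n}. card Q)"
      by (simp add: cycle_type_def sum_unfold_sum_mset)
    also have "\<dots> = card (\<Union>(orb p ` {1..n}))"
    proof (rule card_Union_disjoint[symmetric])
      show "pairwise disjnt (orb p ` {1..n})"
      proof (rule pairwiseI)
        fix Q Q' assume "Q \<in> orb p ` {1..n}" "Q' \<in> orb p ` {1..n}" and neq: "Q \<noteq> Q'"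
        then obtain x y where xy: "Q = orb p x" "Q' = orb p y" by blast
        have "z \<notin> Q'" if "z \<in> Q" for z
          using orb_eq_if_meet[OF pp, of z x y] neq that unfolding xy by blast
        then show "disjnt Q Q'" unfolding disjnt_iff by blast
      qed
    qed (use card_orb(2)[OF pp] in auto)
    also have "\<Union>(orb p ` {1..n}) = {1..n}"
    proof
      show "\<Union>(orb p ` {1..n}) \<subseteq> {1..n}"
        by (rule UN_least) (rule orb_subset[OF p])
      show "{1..n} \<subseteq> \<Union>(orb p ` {1..n})" using orb_self[of _ p] by blast
    qed
    finally show ?thesis by simp
  qed
  ultimately show ?thesis by (simp add: is_partition_def)
qed

lemma finite_partitions: "finite {\<mu>. is_partition \<mu> n}"
proof (rule finite_subset)
  show "finite {xs. set xs \<subseteq> {..n} \<and> length xs \<le> n}" by (rule finite_lists_length_le) simp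
  show "{\<mu>. is_partition \<mu> n} \<subseteq> {xs. set xs \<subseteq> {..n} \<and> length xs \<le> n}"
  proof
    fix \<mu> assume "\<mu> \<in> {\<mu>. is_partition \<mu> n}"
    then have \<mu>: "0 \<notin> set \<mu>" "sum_list \<mu> = n" by (auto simp: is_partition_def)
    have "length \<mu> \<le> sum_list \<mu>" using \<mu>(1) by (induction \<mu>) auto
    then show "\<mu> \<in> {xs. set xs \<subseteq> {..n} \<and> length xs \<le> n}"
      using \<mu> member_le_sum_list by fastforce
  qed
qed

section \<open>Cycle lengths, parity and 2-regular permutations\<close>

lemma sign_cycle_of_list: "distinct cs \<Longrightarrow> cs \<noteq> [] \<Longrightarrow> sign (cycle_of_list cs) = (-1) ^ (length cs - 1)"
proof (induction cs rule: cycle_of_list.induct)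
  case (1 i j cs)
  have eq: "sign (cycle_of_list (i # j # cs)) = sign (transpose i j) * sign (cycle_of_list (j # cs))"
    unfolding cycle_of_list.simps by (rule sign_compose[OF permutation_swap_id permutation_of_cycle])
  show ?case unfolding eq using 1 by (simp add: sign_swap_id)
qed auto

text \<open>The witness agrees with \<open>p\<close> on the cycle through \<open>a\<close> and fixes
  all other points; having even length, it is a product of an odd number of transpositions.\<close>

lemma odd_commuting_permutation:
  assumes p: "p permutes S" and even: "even (least_power p a)" and a: "a \<in> S" and S: "finite S"
  shows "\<exists>\<sigma>. \<sigma> permutes S \<and> sign \<sigma> = -1 \<and> \<sigma> \<circ> p = p \<circ> \<sigma>"
proof (intro exI conjI)
  have pp: "permutation p" using p S by (auto simp: permutation_permutes)
  let ?cs = "support p a" and ?\<sigma> = "cycle_of_list (support p a)"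
  have cs: "set ?cs = orb p a" unfolding orb_def by (rule support_set[OF pp])
  have "orb p a \<subseteq> S" by (rule orb_subset[OF p a])
  then show "?\<sigma> permutes S"
    using cycle_permutes[of ?cs] cs by (auto intro: permutes_subset)
  have pos: "least_power p a > 0" by (rule least_power_of_permutation(2)[OF pp])
  have "odd (least_power p a - 1)" using even pos by simp
  then show "sign ?\<sigma> = -1"
    using sign_cycle_of_list[OF cycle_of_permutation[OF pp, of a]] pos by simp
  show "?\<sigma> \<circ> p = p \<circ> ?\<sigma>"
  proof
    fix x
    have px: "p x \<in> orb p a \<longleftrightarrow> x \<in> orb p a"
    proof -
      have "orb p (p x) = orb p x" using orb_funpow[OF pp, of 1 x] by simp
      then show ?thesis
        using orb_eq_if_meet[OF pp, of "p x" "p x" a] orb_eq_if_meet[OF pp, of x x a] orb_self[of _ p] by blast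
    qed
    show "(?\<sigma> \<circ> p) x = (p \<circ> ?\<sigma>) x"
    proof (cases "x \<in> orb p a")
      case True
      then show ?thesis
        using cycle_restrict[OF pp, of x a] cycle_restrict[OF pp, of "p x" a] px by (simp add: cs del: set_map)
    next
      case False
      then show ?thesis
        using id_outside_supp[of x ?cs] id_outside_supp[of "p x" ?cs] px by (simp add: cs del: set_map)
    qed
  qed
qed

text \<open>The product of the cycle lengths of all points is a multiple of each of them and odd as
  a product of odd numbers.\<close>

lemma odd_power_id:
  assumes p: "p permutes S" "finite S" and odd: "\<And>x. x \<in> S \<Longrightarrow> odd (least_power p x)"
  shows "\<exists>m. odd m \<and> p ^^ m = id"
proof (intro exI conjI)
  have pp: "permutation p" using p by (auto simp: permutation_permutes)
  let ?m = "\<Prod>x\<in>S. least_power p x"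
  show "odd ?m"
  proof
    assume "even ?m"
    then obtain x where "x \<in> S" "even (least_power p x)"
      using prime_dvd_prod_iff[OF p(2) two_is_prime_nat, of "least_power p"] by blast
    then show False using odd by blast
  qed
  show "p ^^ ?m = id"
  proof
    fix x
    show "(p ^^ ?m) x = id x"
    proof (cases "x \<in> S")
      case True
      then show ?thesis using least_power_dvd[OF pp, of x ?m] p(2) by (simp add: dvd_prodI)
    next
      case False
      then show ?thesis using permutes_not_in[OF permutes_funpow[OF p(1)]] by simp
    qed
  qed
qed

lemma sym_group_pow: "x [^]\<^bsub>sym_group n\<^esub> k = x ^^ k" for k :: nat
proof (induction k)
  case 0
  then show ?case by (simp add: sym_group_one nat_pow_def id_def)
next
  case (Suc k)
  have "x [^]\<^bsub>sym_group n\<^esub> Suc k = x [^]\<^bsub>sym_group n\<^esub> k \<circ> x" by (simp add: nat_pow_def sym_group_mult)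
  also have "\<dots> = x ^^ Suc k" unfolding Suc by (rule funpow_Suc_right[symmetric])
  finally show ?case .
qed

lemma finite_sym_group: "finite (carrier (sym_group n))"
  by (simp add: sym_group_def finite_permutations)

lemma two_regular_even:
  assumes "x \<in> two_regular (sym_group n)"
  shows "evenperm x"
proof -
  interpret group "sym_group n" by (rule sym_group_is_group)
  have x: "x \<in> carrier (sym_group n)" "odd (ord x)" using assms by (auto simp: two_regular_def)
  have xp: "permutation x" by (rule sym_group_carrier'[OF x(1)])
  have "sign (x ^^ k) = sign x ^ k" for k
    by (induction k)
      (simp_all only: funpow.simps sign_compose[OF xp permutation_funpow[OF xp]] sign_id power_0 power_Suc)
  moreover have "x ^^ ord x = id" using pow_ord_eq_1[OF x(1)] by (simp add: sym_group_pow sym_group_one)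
  ultimately have "sign x ^ ord x = 1" by (metis sign_id)
  then show ?thesis using x(2) by (auto simp: sign_def split: if_splits)
qed

lemma odd_centralizer_if_not_two_regular:
  assumes x: "x permutes {1..n}" and nr: "x \<notin> two_regular (sym_group n)"
  shows "\<exists>g. g permutes {1..n} \<and> \<not> evenperm g \<and> g \<circ> x = x \<circ> g"
proof -
  interpret group "sym_group n" by (rule sym_group_is_group)
  have xc: "x \<in> carrier (sym_group n)" using x by (simp add: sym_group_carrier)
  have "\<exists>a\<in>{1..n}. even (least_power x a)"
  proof (rule ccontr)
    assume "\<not> ?thesis"
    then obtain m where m: "odd m" "x ^^ m = id" using odd_power_id[OF x] by auto
    then have "ord x dvd m" using pow_eq_id[OF xc, of m] by (simp add: sym_group_pow sym_group_one)
    then have "odd (ord x)" using m(1) dvd_trans by blast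
    then show False using nr xc by (simp add: two_regular_def)
  qed
  then obtain a where "a \<in> {1..n}" "even (least_power x a)" by blast
  then obtain g where "g permutes {1..n}" "sign g = -1" "g \<circ> x = x \<circ> g"
    using odd_commuting_permutation[OF x] by auto
  then show ?thesis by (auto simp: sign_def split: if_splits)
qed

section \<open>Characters of symmetric and alternating groups\<close>

lemma in_young_diagram: "(i, j) \<in> young_diagram \<mu> \<longleftrightarrow> i < length \<mu> \<and> j < \<mu> ! i"
  by (simp add: young_diagram_def)

lemma young_diagram_Sigma: "young_diagram \<mu> = (SIGMA i:{..<length \<mu>}. {..<\<mu> ! i})"
  by (auto simp: young_diagram_def)

lemma card_young_diagram: "card (young_diagram \<mu>) = sum_list \<mu>"
  by (simp add: young_diagram_Sigma sum_list_sum_nth atLeast0LessThan)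

lemma is_partition_nth_pos: "is_partition \<mu> n \<Longrightarrow> i < length \<mu> \<Longrightarrow> 0 < \<mu> ! i"
  unfolding is_partition_def by (metis gr0I nth_mem)

lemma young_young_diagram:
  assumes "is_partition \<mu> n"
  shows "young (young_diagram \<mu>)"
  unfolding young_def
proof (intro conjI allI impI)
  show "finite (young_diagram \<mu>)" by (simp add: young_diagram_Sigma)
  fix i j i' j' assume ij: "(i, j) \<in> young_diagram \<mu>" "i' \<le> i" "j' \<le> j"
  have "\<mu> ! i \<le> \<mu> ! i'"
  proof (cases "i' = i")
    case False
    then show ?thesis
      using assms ij(1,2) sorted_wrt_nth_less[of "(\<ge>)" \<mu> i' i] by (simp add: is_partition_def in_young_diagram)
  qed simp
  then show "(i', j') \<in> young_diagram \<mu>" using ij by (simp add: in_young_diagram)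
qed

lemma length_eq_card_column:
  assumes "is_partition \<mu> n"
  shows "length \<mu> = card {i. (i, 0) \<in> young_diagram \<mu>}"
proof -
  have "{i. (i, 0) \<in> young_diagram \<mu>} = {..<length \<mu>}"
    using is_partition_nth_pos[OF assms] by (auto simp: in_young_diagram)
  then show ?thesis by simp
qed

lemma nth_eq_card_row:
  assumes "i < length \<mu>"
  shows "\<mu> ! i = card {j. (i, j) \<in> young_diagram \<mu>}"
proof -
  have "{j. (i, j) \<in> young_diagram \<mu>} = {..<\<mu> ! i}" using assms by (auto simp: in_young_diagram)
  then show ?thesis by simp
qed

lemma young_diagram_inj:
  assumes "is_partition \<mu> n" "is_partition \<nu> n" "young_diagram \<mu> = young_diagram \<nu>"
  shows "\<mu> = \<nu>"
proof (rule nth_equalityI)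
  show "length \<mu> = length \<nu>"
    unfolding length_eq_card_column[OF assms(1)] length_eq_card_column[OF assms(2)] assms(3) ..
  fix i assume "i < length \<mu>"
  moreover then have "i < length \<nu>" using \<open>length \<mu> = length \<nu>\<close> by simp
  ultimately show "\<mu> ! i = \<nu> ! i" using assms(3) by (simp only: nth_eq_card_row)
qed

text \<open>\<open>conj_partition\<close> lists the column lengths, as many as the first row is
  long. By symmetry that number is the number of rows, and column \<open>j\<close> is as long as row
  \<open>j\<close>.\<close>

lemma conj_partition_fixed:
  assumes \<mu>: "is_partition \<mu> n" and sym: "prod.swap ` young_diagram \<mu> = young_diagram \<mu>"
  shows "conj_partition \<mu> = \<mu>"
proof (cases "\<mu> = []")
  case True
  then show ?thesis by (simp add: conj_partition_def)
next
  case False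
  have swap: "(i, j) \<in> young_diagram \<mu> \<longleftrightarrow> (j, i) \<in> young_diagram \<mu>" for i j
  proof -
    have "(i, j) \<in> young_diagram \<mu> \<Longrightarrow> (j, i) \<in> young_diagram \<mu>" for i j
      using imageI[of "(i, j)" "young_diagram \<mu>" prod.swap] unfolding sym by simp
    then show ?thesis by blast
  qed
  have "hd \<mu> = card {j. (0, j) \<in> young_diagram \<mu>}"
    using False nth_eq_card_row[of 0 \<mu>] by (simp add: hd_conv_nth)
  also have "\<dots> = length \<mu>" unfolding length_eq_card_column[OF \<mu>] swap[of 0] ..
  finally have hd: "hd \<mu> = length \<mu>" .
  have col: "length (filter (\<lambda>k. j < k) \<mu>) = \<mu> ! j" if "j < length \<mu>" for j
  proof -
    have "length (filter (\<lambda>k. j < k) \<mu>) = card {i. (i, j) \<in> young_diagram \<mu>}"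
      by (simp add: length_filter_conv_card in_young_diagram)
    also have "\<dots> = \<mu> ! j" unfolding nth_eq_card_row[OF that] swap[of _ j] ..
    finally show ?thesis .
  qed
  show ?thesis
    by (rule nth_equalityI) (use False in \<open>simp_all add: conj_partition_def hd col\<close>)
qed

text \<open>Row \<open>i\<close> is filled with the numbers above
  \<open>sum_list (take i \<mu>)\<close> up to \<open>sum_list (take (Suc i) \<mu>)\<close>. These
  blocks are disjoint, and surjectivity follows by counting.\<close>

lemma tableau_bij: "bij_betw (tableau \<mu>) (young_diagram \<mu>) {1..sum_list \<mu>}"
proof -
  have take_mono: "sum_list (take i \<mu>) \<le> sum_list (take k \<mu>)" if "i \<le> k" for i k
  proof -
    have "take k \<mu> = take i \<mu> @ take (k - i) (drop i \<mu>)"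
      using that by (metis le_add_diff_inverse take_add)
    then show ?thesis by simp
  qed
  have less: "tableau \<mu> (i, j) \<le> sum_list (take (Suc i) \<mu>)" if "(i, j) \<in> young_diagram \<mu>" for i j
    using that by (simp add: tableau_def in_young_diagram take_Suc_conv_app_nth)
  have lt: "tableau \<mu> (i, j) < tableau \<mu> (i', j')" if "(i, j) \<in> young_diagram \<mu>" "i < i'" for i j i' j'
    using less[OF that(1)] take_mono[of "Suc i" i'] that(2) by (simp add: tableau_def)
  have inj: "inj_on (tableau \<mu>) (young_diagram \<mu>)"
  proof (rule inj_onI)
    fix x y assume xy: "x \<in> young_diagram \<mu>" "y \<in> young_diagram \<mu>" "tableau \<mu> x = tableau \<mu> y"
    obtain i j where x: "x = (i, j)" by (cases x)
    obtain i' j' where y: "y = (i', j')" by (cases y)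
    have "i = i'"
      using lt[of i j i' j'] lt[of i' j' i j] xy unfolding x y by (metis less_irrefl nat_neq_iff)
    then show "x = y" using xy(3) by (simp add: x y tableau_def)
  qed
  have "tableau \<mu> ` young_diagram \<mu> \<subseteq> {1..sum_list \<mu>}"
  proof (rule image_subsetI)
    fix x assume x: "x \<in> young_diagram \<mu>"
    obtain i j where ij: "x = (i, j)" by (cases x)
    have "tableau \<mu> x \<le> sum_list (take (length \<mu>) \<mu>)"
      using less[of i j] take_mono[of "Suc i" "length \<mu>"] x unfolding ij in_young_diagram by linarith
    then show "tableau \<mu> x \<in> {1..sum_list \<mu>}" by (simp add: ij tableau_def)
  qed
  moreover have "card (tableau \<mu> ` young_diagram \<mu>) = card {1..sum_list \<mu>}"
    by (simp add: card_image[OF inj] card_young_diagram)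
  ultimately have "tableau \<mu> ` young_diagram \<mu> = {1..sum_list \<mu>}"
    by (intro card_subset_eq) auto
  then show ?thesis using inj by (simp add: bij_betw_def)
qed

definition cell :: "nat list \<Rightarrow> nat \<Rightarrow> nat \<times> nat" where
  "cell \<mu> = inv_into (young_diagram \<mu>) (tableau \<mu>)"

lemma cell_tableau: "c \<in> young_diagram \<mu> \<Longrightarrow> cell \<mu> (tableau \<mu> c) = c"
  unfolding cell_def using tableau_bij by (simp add: bij_betw_def inv_into_f_f)

lemma tableau_cell:
  assumes "x \<in> {1..sum_list \<mu>}"
  shows "tableau \<mu> (cell \<mu> x) = x" "cell \<mu> x \<in> young_diagram \<mu>"
  unfolding cell_def using assms tableau_bij[of \<mu>]
  by (auto simp: bij_betw_def intro: f_inv_into_f inv_into_into simp del: atLeastAtMost_iff)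

lemma specht_partition:
  assumes "is_partition \<mu> n"
  shows "specht n (young_diagram \<mu>) (cell \<mu>)"
proof
  show "young (young_diagram \<mu>)" by (rule young_young_diagram[OF assms])
  show "symmetric_algebra.filling n (young_diagram \<mu>) (cell \<mu>)"
    unfolding symmetric_algebra.filling_def cell_def
    using bij_betw_inv_into[OF tableau_bij[of \<mu>]] assms by (simp add: is_partition_def)
qed

text \<open>One side moves cells through \<open>tableau\<close>, the other moves entries through its
  inverse \<open>cell\<close>. The auxiliary fact \<open>iff\<close>, for an arbitrary coordinate
  \<open>k\<close> of a cell, serves rows and columns alike.\<close>

lemma stabilizers_eq:
  fixes \<mu> :: "nat list"
  defines "n \<equiv> sum_list \<mu>"
  shows "row_stabilizer \<mu> = symmetric_algebra.stab n (fst \<circ> cell \<mu>)"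
    and "column_stabilizer \<mu> = symmetric_algebra.stab n (snd \<circ> cell \<mu>)"
proof -
  let ?D = "young_diagram \<mu>" and ?t = "tableau \<mu>"
  have iff: "(\<forall>c\<in>?D. \<exists>c'\<in>?D. k c' = k c \<and> p (?t c) = ?t c') \<longleftrightarrow>
      (\<forall>x\<in>{1..n}. (k \<circ> cell \<mu>) (p x) = (k \<circ> cell \<mu>) x)" if p: "p permutes {1..n}"
    for k :: "nat \<times> nat \<Rightarrow> nat" and p
  proof (intro iffI ballI)
    fix x assume *: "\<forall>c\<in>?D. \<exists>c'\<in>?D. k c' = k c \<and> p (?t c) = ?t c'" and x: "x \<in> {1..n}"
    note tx = tableau_cell[OF x[unfolded n_def]]
    obtain c' where c': "c' \<in> ?D" "k c' = k (cell \<mu> x)" "p (?t (cell \<mu> x)) = ?t c'"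
      using *[rule_format, OF tx(2)] by blast
    show "(k \<circ> cell \<mu>) (p x) = (k \<circ> cell \<mu>) x"
      using c'(2,3) cell_tableau[OF c'(1)] unfolding tx(1) by simp
  next
    fix c assume *: "\<forall>x\<in>{1..n}. (k \<circ> cell \<mu>) (p x) = (k \<circ> cell \<mu>) x" and c: "c \<in> ?D"
    have tc: "?t c \<in> {1..n}" using c tableau_bij[of \<mu>] unfolding n_def bij_betw_def by blast
    then have ptc: "p (?t c) \<in> {1..n}" using permutes_in_image[OF p] by simp
    have "k (cell \<mu> (p (?t c))) = k c" using *[rule_format, OF tc] by (simp add: cell_tableau[OF c])
    then show "\<exists>c'\<in>?D. k c' = k c \<and> p (?t c) = ?t c'"
      using tableau_cell[OF ptc[unfolded n_def]] by (intro bexI[of _ "cell \<mu> (p (?t c))"]) simp_all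
  qed
  have row: "(\<forall>i j. (i, j) \<in> ?D \<longrightarrow> (\<exists>j'. (i, j') \<in> ?D \<and> p (?t (i, j)) = ?t (i, j'))) \<longleftrightarrow>
      (\<forall>c\<in>?D. \<exists>c'\<in>?D. fst c' = fst c \<and> p (?t c) = ?t c')" for p
    by (auto simp: Bex_def Ball_def)
  have col: "(\<forall>i j. (i, j) \<in> ?D \<longrightarrow> (\<exists>i'. (i', j) \<in> ?D \<and> p (?t (i, j)) = ?t (i', j))) \<longleftrightarrow>
      (\<forall>c\<in>?D. \<exists>c'\<in>?D. snd c' = snd c \<and> p (?t c) = ?t c')" for p
    by (auto simp: Bex_def Ball_def)
  show "row_stabilizer \<mu> = symmetric_algebra.stab n (fst \<circ> cell \<mu>)"
    unfolding row_stabilizer_def symmetric_algebra.stab_def symmetric_algebra.P_def row n_def[symmetric]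
    using iff[of _ fst] by blast
  show "column_stabilizer \<mu> = symmetric_algebra.stab n (snd \<circ> cell \<mu>)"
    unfolding column_stabilizer_def symmetric_algebra.stab_def symmetric_algebra.P_def col n_def[symmetric]
    using iff[of _ snd] by blast
qed

lemma specht_char_eq:
  assumes "is_partition \<mu> n"
  shows "specht_char \<mu> = specht.chi n (cell \<mu>)"
proof -
  interpret specht n "young_diagram \<mu>" "cell \<mu>" by (rule specht_partition[OF assms])
  have n: "sum_list \<mu> = n" using assms by (simp add: is_partition_def)
  have "young_symmetrizer \<mu> = e"
    unfolding young_symmetrizer_def e_def row_sum_def col_sum_def stabilizers_eq n ..
  then have "specht_module \<mu> = V" unfolding specht_module_def V_def n by simp
  then show ?thesis
    unfolding specht_char_def chi_def carrier_sym_group n delta_def by simp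
qed

lemma specht_char_Irr: "is_partition \<mu> n \<Longrightarrow> specht_char \<mu> \<in> Irr (sym_group n)"
  using specht.chi_Irr[OF specht_partition] specht_char_eq by simp

lemma specht_char_inj:
  assumes "is_partition \<mu> n" "is_partition \<nu> n" "specht_char \<mu> = specht_char \<nu>"
  shows "\<mu> = \<nu>"
proof -
  note s = specht_partition[OF assms(1)] specht_partition[OF assms(2)]
  have eq: "specht.chi n (cell \<mu>) = specht.chi n (cell \<nu>)"
    using assms by (simp add: specht_char_eq)
  have "young_diagram \<mu> = young_diagram \<nu>"
    by (rule young_dominated_antisym[OF young_young_diagram[OF assms(1)] young_young_diagram[OF assms(2)]
          specht_chi_dominated[OF s eq] specht_chi_dominated[OF s(2,1) eq[symmetric]]])
  then show ?thesis by (rule young_diagram_inj[OF assms(1,2)])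
qed

section \<open>Completeness of the Specht characters\<close>

lemma char_inner_cnj: "char_inner G \<psi> \<phi> = cnj (char_inner G \<phi> \<psi>)"
  by (simp add: char_inner_def mult.commute)

text \<open>There are as many Specht characters as partitions of \<open>n\<close>, hence at least as many as conjugacy
  classes; being orthonormal, they span the class functions.\<close>

lemma class_function_orthogonal_to_specht_chars:
  assumes cl: "\<And>g x. g permutes {1..n} \<Longrightarrow> x permutes {1..n} \<Longrightarrow> f (g \<circ> x \<circ> inv' g) = f x"
    and orth: "\<And>\<mu>. is_partition \<mu> n \<Longrightarrow> char_inner (sym_group n) f (specht_char \<mu>) = 0"
    and x: "x permutes {1..n}"
  shows "f x = 0"
proof (rule ccontr)
  assume nz: "f x \<noteq> 0"
  let ?G = "sym_group n"
  define T where "T = {\<mu>. is_partition \<mu> n}"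
  define S where "S = specht_char ` T"
  define h where "h = cut (carrier ?G) f"
  \<comment> \<open>Indicators of the sets of permutations of given cycle type. They bound the
    dimension of the space of class functions by the number of partitions.\<close>
  define ind where "ind \<mu> = cut (carrier ?G) (\<lambda>p. if type_partition n p = \<mu> then 1 else 0)" for \<mu>
  have finT: "finite T" unfolding T_def by (rule finite_partitions)
  have S_Irr: "S \<subseteq> Irr ?G" using specht_char_Irr by (auto simp: S_def T_def)
  have in_span: "\<phi> \<in> cfun.span (ind ` T)"
    if c: "\<And>g x. g permutes {1..n} \<Longrightarrow> x permutes {1..n} \<Longrightarrow> \<phi> (g \<circ> x \<circ> inv' g) = \<phi> x"
      and supp: "\<And>x. x \<notin> carrier ?G \<Longrightarrow> \<phi> x = 0" for \<phi> :: "(nat \<Rightarrow> nat) \<Rightarrow> complex"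
  proof -
    \<comment> \<open>A representative of the class. The chosen value matters only where the
      indicator is nonzero, and there a witness exists.\<close>
    define r where "r \<mu> = (SOME p. p permutes {1..n} \<and> type_partition n p = \<mu>)" for \<mu>
    have "\<phi> = (\<Sum>\<mu>\<in>T. cscale (\<phi> (r \<mu>)) (ind \<mu>))"
    proof
      fix p
      show "\<phi> p = (\<Sum>\<mu>\<in>T. cscale (\<phi> (r \<mu>)) (ind \<mu>)) p"
      proof (cases "p permutes {1..n}")
        case True
        let ?\<mu> = "type_partition n p"
        have \<mu>: "?\<mu> \<in> T" unfolding T_def using type_partition_is_partition[OF True] by simp
        have r: "r ?\<mu> permutes {1..n} \<and> type_partition n (r ?\<mu>) = ?\<mu>"
          unfolding r_def by (rule someI[of _ p]) (use True in simp)
        then have "cycle_type n (r ?\<mu>) = cycle_type n p" by (metis mset_type_partition)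
        then obtain \<tau> where \<tau>: "\<tau> permutes {1..n}" "p = \<tau> \<circ> r ?\<mu> \<circ> inv' \<tau>"
          using conjugate_if_cycle_type_eq[OF _ True] r by blast
        have "\<phi> p = \<phi> (\<tau> \<circ> r ?\<mu> \<circ> inv' \<tau>)" by (rule arg_cong[OF \<tau>(2)])
        also have "\<dots> = \<phi> (r ?\<mu>)" by (rule c[OF \<tau>(1) r[THEN conjunct1]])
        finally have "\<phi> p = \<phi> (r ?\<mu>)" .
        moreover have "(\<Sum>\<mu>\<in>T. cscale (\<phi> (r \<mu>)) (ind \<mu>)) p = (\<Sum>\<mu>\<in>T. if ?\<mu> = \<mu> then \<phi> (r \<mu>) else 0)"
          unfolding sum_fun_apply
          by (intro sum.cong refl) (use True in \<open>simp add: cscale_def ind_def cut_def sym_group_carrier\<close>)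
        ultimately show ?thesis using \<mu> finT by simp
      next
        case False
        then show ?thesis
          using supp by (simp add: sum_fun_apply cscale_def ind_def cut_def sym_group_carrier)
      qed
    qed
    also have "\<dots> \<in> cfun.span (ind ` T)"
      by (intro cfun.span_sum cfun.span_scale cfun.span_base) auto
    finally show ?thesis .
  qed
  have conj_in: "g \<circ> y \<circ> inv' g permutes {1..n}" if "g permutes {1..n}" "y permutes {1..n}" for g y
    using that by (intro permutes_compose permutes_inv)
  have h_in: "h \<in> cfun.span (ind ` T)"
  proof (rule in_span)
    fix g y assume g: "g permutes {1..n}" and y: "y permutes {1..n}"
    show "h (g \<circ> y \<circ> inv' g) = h y"
      unfolding h_def cut_def sym_group_carrier if_P[OF conj_in[OF g y]] if_P[OF y] by (rule cl[OF g y])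
  qed (simp add: h_def cut_def)
  have S_in: "S \<subseteq> cfun.span (ind ` T)"
  proof
    fix \<chi> assume "\<chi> \<in> S"
    then have \<chi>: "\<chi> \<in> Irr ?G" using S_Irr by blast
    show "\<chi> \<in> cfun.span (ind ` T)"
    proof (rule in_span)
      fix g y assume "g permutes {1..n}" "y permutes {1..n}"
      then show "\<chi> (g \<circ> y \<circ> inv' g) = \<chi> y"
        using Irr_conj[OF sym_group_is_group \<chi>, of g y] by (simp add: sym_group_carrier sym_group_mult)
    qed (rule Irr_support[OF \<chi>])
  qed
  \<comment> \<open>The functions orthogonal to \<open>h\<close> form a subspace containing
    \<open>S\<close>; with \<open>h\<close> in the span of \<open>S\<close>, the function
    \<open>h\<close> would be orthogonal to itself and hence zero.\<close>
  have h_notin: "h \<notin> cfun.span S"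
  proof
    assume "h \<in> cfun.span S"
    moreover have "cfun.subspace {g. char_inner ?G g h = 0}"
      unfolding cfun.subspace_def
      by (auto simp: char_inner_def cscale_def distrib_right sum.distrib add_divide_distrib
          sum_distrib_left[symmetric] mult.assoc)
    moreover have "char_inner ?G \<chi> h = 0" if \<chi>: "\<chi> \<in> S" for \<chi>
    proof -
      have "char_inner ?G f \<chi> = 0" using orth \<chi> by (auto simp: S_def T_def)
      then have "char_inner ?G h \<chi> = 0" by (simp add: char_inner_def h_def cut_def)
      then show ?thesis using char_inner_cnj[of ?G \<chi> h] by simp
    qed
    ultimately have "char_inner ?G h h = 0"
      using cfun.span_minimal[of S "{g. char_inner ?G g h = 0}"] by blast
    then have "(\<Sum>p\<in>carrier ?G. h p * cnj (h p)) = 0"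
      using finite_sym_group[of n] group.is_monoid[OF sym_group_is_group, of n]
      by (auto simp: char_inner_def dest: monoid.one_closed)
    then have "complex_of_real (\<Sum>p\<in>carrier ?G. (cmod (h p))\<^sup>2) = 0"
      by (simp only: of_real_sum complex_norm_square)
    then have "(\<Sum>p\<in>carrier ?G. (cmod (h p))\<^sup>2) = 0" by (simp only: of_real_eq_0_iff)
    then have "\<forall>p\<in>carrier ?G. h p = 0"
      using finite_sym_group by (simp add: sum_nonneg_eq_0_iff)
    then show False using nz x by (simp add: h_def cut_def sym_group_carrier)
  qed
  have indep: "cfun.independent (insert h S)"
    by (rule cfun.independent_insertI[OF h_notin])
      (rule cfun.independent_mono[OF independent_Irr[OF sym_group_is_group finite_sym_group] S_Irr])
  \<comment> \<open>One independent function too many: the set has more elements than there are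
    partitions, inside a span of at most that many functions.\<close>
  have "card (insert h S) \<le> card (ind ` T)"
    using cfun.independent_span_bound[OF finite_imageI[OF finT] indep, of ind] h_in S_in by simp
  also have "\<dots> \<le> card T" by (rule card_image_le[OF finT])
  also have "card T = card S"
    unfolding S_def by (rule card_image[symmetric]) (use specht_char_inj in \<open>auto simp: inj_on_def T_def\<close>)
  also have "card S < card (insert h S)"
    using h_notin cfun.span_base[of h S] finT by (auto simp: S_def card_insert_if)
  finally show False by simp
qed

text \<open>An irreducible character that is not a Specht character is orthogonal to all of them, so
  as a class function it vanishes at the identity, where its value is its degree.\<close>

lemma Irr_sym_group:
  assumes \<phi>: "\<phi> \<in> Irr (sym_group n)"
  obtains \<mu> where "is_partition \<mu> n" "\<phi> = specht_char \<mu>"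
proof (rule ccontr)
  assume "\<not> thesis"
  then have "char_inner (sym_group n) \<phi> (specht_char \<mu>) = 0" if "is_partition \<mu> n" for \<mu>
    using Irr_orthonormal[OF sym_group_is_group finite_sym_group \<phi> specht_char_Irr[OF that]] that
      \<open>\<And>\<mu>. is_partition \<mu> n \<Longrightarrow> \<phi> = specht_char \<mu> \<Longrightarrow> thesis\<close> by auto
  moreover have "\<phi> (g \<circ> x \<circ> inv' g) = \<phi> x" if "g permutes {1..n}" "x permutes {1..n}" for g x
    using Irr_conj[OF sym_group_is_group \<phi>, of g x] that by (simp add: sym_group_carrier sym_group_mult)
  ultimately have "\<phi> id = 0"
    using class_function_orthogonal_to_specht_chars[of n \<phi> id] permutes_id by blast
  then show False using Irr_one_nonzero[OF sym_group_is_group \<phi>] by (simp add: sym_group_one)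
qed

section \<open>The alternating group and the transfer theorem\<close>

lemma index_two_alt_group:
  assumes "n \<ge> 2"
  shows "index_two_subgroup (sym_group n) (carrier (alt_group n)) (transpose 1 2)"
proof (intro index_two_subgroup.intro index_two_subgroup_axioms.intro)
  show "group (sym_group n)" by (rule sym_group_is_group)
  show "finite (carrier (sym_group n))" by (rule finite_sym_group)
  show "subgroup (carrier (alt_group n)) (sym_group n)" by (rule alt_group_is_subgroup)
  show "transpose 1 2 \<in> carrier (sym_group n)"
    unfolding sym_group_carrier by (rule permutes_swap_id) (use assms in auto)
  show "transpose 1 2 \<notin> carrier (alt_group n)"
    by (simp add: alt_group_carrier evenperm_swap)
  fix x y assume x: "x \<in> carrier (sym_group n)" "x \<notin> carrier (alt_group n)"
    and y: "y \<in> carrier (sym_group n)" "y \<notin> carrier (alt_group n)"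
  then show "x \<otimes>\<^bsub>sym_group n\<^esub> y \<in> carrier (alt_group n)"
    using evenperm_comp[OF sym_group_carrier'[OF x(1)] sym_group_carrier'[OF y(1)]]
    by (simp add: alt_group_carrier sym_group_carrier sym_group_mult permutes_compose)
qed

lemma restriction_set_self:
  assumes "group G" "finite (carrier G)" "B \<subseteq> Irr G"
  shows "restriction_set G B = B"
proof -
  have "irr_constituents G (cut (carrier G) \<chi>) = {\<chi>}" if "\<chi> \<in> B" for \<chi>
  proof -
    have \<chi>: "\<chi> \<in> Irr G" using that assms(3) by blast
    have "cut (carrier G) \<chi> = \<chi>" using Irr_support[OF \<chi>] by (auto simp: cut_def)
    then show ?thesis
      using Irr_orthonormal[OF assms(1,2) \<chi>] \<chi> by (auto simp: irr_constituents_def split: if_splits)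
  qed
  then show ?thesis by (simp add: restriction_set_def)
qed

lemma alt_group_eq_sym_group_1: "alt_group 1 = sym_group 1"
proof -
  have "{p. p permutes {1..1 :: nat}} = {id}" by (auto simp: permutes_sing)
  then show ?thesis by (auto simp: alt_group_def sym_group_def)
qed

theorem proposition1p1:
  fixes n :: nat and B :: "((nat \<Rightarrow> nat) \<Rightarrow> complex) set"
  assumes "n > 0"
    and "two_basic_set (sym_group n) B"
    and "\<And>\<mu>. is_partition \<mu> n \<Longrightarrow> conj_partition \<mu> = \<mu> \<Longrightarrow> specht_char \<mu> \<in> B"
  shows "two_basic_set (alt_group n) (restriction_set (alt_group n) B)"
proof (cases "n = 1")
  case True
  \<comment> \<open>In degree 1 the alternating group is the whole symmetric group and there is no
    odd permutation to twist with; restricting \<open>B\<close> leaves it unchanged.\<close>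
  have "B \<subseteq> Irr (sym_group n)" using assms(2) by (simp add: two_basic_set_def)
  then show ?thesis
    using assms(2) restriction_set_self[OF sym_group_is_group finite_sym_group] True
    by (simp add: alt_group_eq_sym_group_1[simplified])
next
  case False
  then have n: "n \<ge> 2" using assms(1) by simp
  interpret I: index_two_subgroup "sym_group n" "carrier (alt_group n)" "transpose 1 2"
    by (rule index_two_alt_group[OF n])
  have H: "I.H = alt_group n" by (simp add: alt_group_def)
  have inv: "inv\<^bsub>sym_group n\<^esub> g = inv' g" if "g \<in> carrier (sym_group n)" for g
    by (rule sym_group_inv_equality[OF that])
  have "two_basic_set I.H (restriction_set I.H B)"
  proof (rule I.restriction_two_basic_set)
    show "\<forall>f. (\<forall>g\<in>carrier (sym_group n). \<forall>x\<in>carrier (sym_group n).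
        f (g \<otimes>\<^bsub>sym_group n\<^esub> x \<otimes>\<^bsub>sym_group n\<^esub> inv\<^bsub>sym_group n\<^esub> g) = f x) \<longrightarrow>
      (\<forall>\<phi>\<in>Irr (sym_group n). char_inner (sym_group n) f \<phi> = 0) \<longrightarrow> f \<one>\<^bsub>sym_group n\<^esub> = 0"
    proof (intro allI impI)
      fix f :: "(nat \<Rightarrow> nat) \<Rightarrow> complex"
      assume cl: "\<forall>g\<in>carrier (sym_group n). \<forall>x\<in>carrier (sym_group n).
          f (g \<otimes>\<^bsub>sym_group n\<^esub> x \<otimes>\<^bsub>sym_group n\<^esub> inv\<^bsub>sym_group n\<^esub> g) = f x"
        and orth: "\<forall>\<phi>\<in>Irr (sym_group n). char_inner (sym_group n) f \<phi> = 0"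
      show "f \<one>\<^bsub>sym_group n\<^esub> = 0"
        unfolding sym_group_one
      proof (rule class_function_orthogonal_to_specht_chars[of n f id])
        fix g x assume "g permutes {1..n}" "x permutes {1..n}"
        then have gx: "g \<in> carrier (sym_group n)" "x \<in> carrier (sym_group n)"
          by (simp_all add: sym_group_carrier)
        show "f (g \<circ> x \<circ> inv' g) = f x"
          using cl[rule_format, OF gx] unfolding inv[OF gx(1)] sym_group_mult .
      next
        fix \<mu> assume "is_partition \<mu> n"
        then show "char_inner (sym_group n) f (specht_char \<mu>) = 0" using orth specht_char_Irr by blast
      qed (rule permutes_id)
    qed
    show "x \<in> carrier (alt_group n)" if "x \<in> two_regular (sym_group n)" for x
      using two_regular_even[OF that] that by (simp add: alt_group_carrier two_regular_def sym_group_carrier)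
    show "\<exists>g\<in>carrier (sym_group n) - carrier (alt_group n). g \<otimes>\<^bsub>sym_group n\<^esub> x = x \<otimes>\<^bsub>sym_group n\<^esub> g"
      if "x \<in> carrier (alt_group n)" "x \<notin> two_regular (sym_group n)" for x
      using odd_centralizer_if_not_two_regular[OF _ that(2)] that(1)
      by (auto simp: alt_group_carrier sym_group_carrier sym_group_mult)
    show "two_basic_set (sym_group n) B" by (rule assms(2))
    show "\<phi> \<in> B" if \<phi>: "\<phi> \<in> Irr (sym_group n)" "I.sgn_twist \<phi> = \<phi>" for \<phi>
    proof -
      obtain \<mu> where \<mu>: "is_partition \<mu> n" "\<phi> = specht_char \<mu>" by (rule Irr_sym_group[OF \<phi>(1)])
      interpret S: specht n "young_diagram \<mu>" "cell \<mu>" by (rule specht_partition[OF \<mu>(1)])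
      have "prod.swap ` young_diagram \<mu> = young_diagram \<mu>"
      proof (rule S.self_associated_symmetric)
        fix p assume "p \<in> S.P"
        then have p: "p permutes {1..n}" by (simp add: S.P_def)
        have "I.sgn_twist S.chi p = S.chi p" using \<phi>(2) unfolding \<mu>(2) specht_char_eq[OF \<mu>(1)] by simp
        then show "of_int (sign p) * S.chi p = S.chi p"
          using p by (auto simp: I.sgn_twist_def alt_group_carrier sign_def split: if_splits)
      qed
      then show ?thesis using assms(3)[OF \<mu>(1) conj_partition_fixed[OF \<mu>(1)]] \<mu>(2) by simp
    qed
  qed
  then show ?thesis unfolding H .
qed

end
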